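(* Let $k$ be a non-negative multiplicity function on a reduced root system $\mathscr{R}$ in $\mathbb{R}^N$. For $t\in\mathbb{R}$, the unitary operator $\exp(t(2E_x+2\langle k\rangle+N-2))$ on $L^2(\mathbb{R}^N,w_{k,0}(x)\,dx)$ is given by $$\exp\bigl(t(2E_x+2\langle k\rangle+N-2)\bigr)F(x)=e^{(2\langle k\rangle+N-2)t}F(e^{2t}x).$$
   Context: $N\ge1$; all functions are complex-valued. A reduced root system $\mathscr{R}$ on $\mathbb{R}^N$ is a finite subset of $\mathbb{R}^N\setminus\{0\}$, stable under the orthogonal reflection $r_\alpha$ in the hyperplane $(\mathbb{R}\alpha)^\perp$ for every $\alpha\in\mathscr{R}$, with $\mathscr{R}\cap\mathbb{R}\alpha=\{\alpha,-\alpha\}$ for all $\alpha\in\mathscr{R}$. A multiplicity function is a function $k\colon\mathscr{R}\to\mathbb{C}$, $\alpha\mapsto k_\alpha$, invariant under the group generated by the $r_\alpha$; it is non-negative if all $k_\alpha\ge0$. Its index is $\langle k\rangle=\frac12\sum_{\alpha\in\mathscr{R}}k_\alpha$. $E_x=\sum_j x_j\partial_{x_j}$ is the Euler operator. The weight is $w_{k,0}(x)=|x|^{-2}\prod_{\alpha\in\mathscr{R}}|\langle\alpha,x\rangle|^{k_\alpha}$. Let $\mathcal{D}$ be the complex span of the functions $r\omega\mapsto p(\omega)f(r)$ on $\mathbb{R}^N\setminus\{0\}$ ($r>0$, $\omega\in S^{N-1}$), where $p$ is the restriction to $S^{N-1}$ of a polynomial on $\mathbb{R}^N$ and $f\in C_c^\infty(\mathbb{R}_{>0})$.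 The operator $2E_x+2\langle k\rangle+N-2$ with domain $\mathcal{D}$ is essentially skew-adjoint on $L^2(\mathbb{R}^N,w_{k,0}(x)dx)$; in the claim the symbol denotes its skew-adjoint closure, and $\exp(t(\cdot))$ is the one-parameter unitary group it generates. *)

theory Defs
  imports "HOL-Analysis.Analysis"
begin

section \<open>Root systems and multiplicity functions\<close>

definition root_reflection :: "real^'n \<Rightarrow> real^'n \<Rightarrow> real^'n" where
  "root_reflection a x = x - (2 * (a \<bullet> x) / (a \<bullet> a)) *\<^sub>R a"

definition reduced_root_system :: "(real^'n) set \<Rightarrow> bool" where
  "reduced_root_system R \<longleftrightarrow>
     finite R \<and> 0 \<notin> R \<and>
     (\<forall>a\<in>R. root_reflection a ` R \<subseteq> R) \<and>
     (\<forall>a\<in>R. R \<inter> span {a} = {a, - a})"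

text \<open>The group generated by the reflections. Closing under inverses is not needed, because the
  generators are involutions.\<close>

inductive_set reflection_group :: "(real^'n) set \<Rightarrow> (real^'n \<Rightarrow> real^'n) set"
  for R :: "(real^'n) set" where
  id: "id \<in> reflection_group R"
| refl: "a \<in> R \<Longrightarrow> g \<in> reflection_group R \<Longrightarrow> root_reflection a \<circ> g \<in> reflection_group R"

definition multiplicity_function :: "(real^'n) set \<Rightarrow> (real^'n \<Rightarrow> complex) \<Rightarrow> bool" where
  "multiplicity_function R k \<longleftrightarrow> (\<forall>g\<in>reflection_group R. \<forall>a\<in>R. k (g a) = k a)"

definition nonneg_multiplicity :: "(real^'n) set \<Rightarrow> (real^'n \<Rightarrow> complex) \<Rightarrow> bool" where
  "nonneg_multiplicity R k \<longleftrightarrow> (\<forall>a\<in>R. k a \<in> \<real>\<^sub>\<ge>\<^sub>0)"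

definition multiplicity_index :: "(real^'n) set \<Rightarrow> (real^'n \<Rightarrow> complex) \<Rightarrow> complex" where
  "multiplicity_index R k = (1 / 2) * (\<Sum>a\<in>R. k a)"

text \<open>Only used for non-negative \<open>k\<close>, where taking the real part loses nothing. The conventions
  \<open>1 / 0 = 0\<close> and \<open>0 powr 0 = 0\<close> change the weight only on the origin and on the hyperplanes
  orthogonal to roots, that is, on a Lebesgue null set.\<close>

definition dunkl_weight :: "(real^'n) set \<Rightarrow> (real^'n \<Rightarrow> complex) \<Rightarrow> real^'n \<Rightarrow> real" where
  "dunkl_weight R k x = (1 / (norm x)\<^sup>2) * (\<Prod>a\<in>R. \<bar>a \<bullet> x\<bar> powr Re (k a))"

definition dunkl_measure :: "(real^'n) set \<Rightarrow> (real^'n \<Rightarrow> complex) \<Rightarrow> (real^'n) measure" where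
  "dunkl_measure R k = density lborel (\<lambda>x. ennreal (dunkl_weight R k x))"


section \<open>Operators on \<open>L\<^sup>2\<close>\<close>

text \<open>Elements of \<open>L\<^sup>2(M)\<close> are represented by functions, and equality in \<open>L\<^sup>2(M)\<close> is almost
  everywhere equality. A possibly unbounded operator is represented by its graph, a set of
  pairs of square-integrable functions containing all representatives. An everywhere defined
  operator is represented by a map on functions.\<close>

definition l2_functions :: "'a measure \<Rightarrow> ('a \<Rightarrow> complex) set" where
  "l2_functions M = {F \<in> borel_measurable M. integrable M (\<lambda>x. (norm (F x))\<^sup>2)}"

definition l2_inner :: "'a measure \<Rightarrow> ('a \<Rightarrow> complex) \<Rightarrow> ('a \<Rightarrow> complex) \<Rightarrow> complex" where
  "l2_inner M F G = (LINT x|M. F x * cnj (G x))"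

definition l2_norm :: "'a measure \<Rightarrow> ('a \<Rightarrow> complex) \<Rightarrow> real" where
  "l2_norm M F = sqrt (LINT x|M. (norm (F x))\<^sup>2)"

type_synonym 'a l2_graph = "(('a \<Rightarrow> complex) \<times> ('a \<Rightarrow> complex)) set"

definition l2_operator ::
    "'a measure \<Rightarrow> ('a \<Rightarrow> complex) set \<Rightarrow> (('a \<Rightarrow> complex) \<Rightarrow> ('a \<Rightarrow> complex)) \<Rightarrow> 'a l2_graph" where
  "l2_operator M D T =
     {(F, G). F \<in> l2_functions M \<and> G \<in> l2_functions M \<and>
        (\<exists>F0\<in>D. (AE x in M. F x = F0 x) \<and> (AE x in M. G x = T F0 x))}"

definition l2_densely_defined :: "'a measure \<Rightarrow> 'a l2_graph \<Rightarrow> bool" where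
  "l2_densely_defined M A \<longleftrightarrow>
     (\<forall>F\<in>l2_functions M. \<forall>e>0. \<exists>G\<in>Domain A. l2_norm M (\<lambda>x. F x - G x) < e)"

definition l2_closure :: "'a measure \<Rightarrow> 'a l2_graph \<Rightarrow> 'a l2_graph" where
  "l2_closure M A =
     {(F, G). F \<in> l2_functions M \<and> G \<in> l2_functions M \<and>
        (\<exists>f g. (\<forall>n::nat. (f n, g n) \<in> A) \<and>
               (\<lambda>n. l2_norm M (\<lambda>x. f n x - F x)) \<longlonglongrightarrow> 0 \<and>
               (\<lambda>n. l2_norm M (\<lambda>x. g n x - G x)) \<longlonglongrightarrow> 0)}"

definition l2_adjoint :: "'a measure \<Rightarrow> 'a l2_graph \<Rightarrow> 'a l2_graph" where
  "l2_adjoint M A =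
     {(G, H). G \<in> l2_functions M \<and> H \<in> l2_functions M \<and>
        (\<forall>(F, AF)\<in>A. l2_inner M AF G = l2_inner M F H)}"

text \<open>The adjoint of a densely defined graph is single-valued and linear up to almost everywhere
  equality, so a skew-adjoint graph is automatically the graph of a linear operator.\<close>

definition l2_skew_adjoint :: "'a measure \<Rightarrow> 'a l2_graph \<Rightarrow> bool" where
  "l2_skew_adjoint M A \<longleftrightarrow>
     l2_densely_defined M A \<and> l2_adjoint M A = {(F, \<lambda>x. - G x) | F G. (F, G) \<in> A}"

definition l2_essentially_skew_adjoint :: "'a measure \<Rightarrow> 'a l2_graph \<Rightarrow> bool" where
  "l2_essentially_skew_adjoint M A \<longleftrightarrow>
     l2_densely_defined M A \<and> l2_skew_adjoint M (l2_closure M A)"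

definition l2_unitary :: "'a measure \<Rightarrow> (('a \<Rightarrow> complex) \<Rightarrow> ('a \<Rightarrow> complex)) \<Rightarrow> bool" where
  "l2_unitary M V \<longleftrightarrow>
     (\<forall>F\<in>l2_functions M. V F \<in> l2_functions M) \<and>
     (\<forall>F\<in>l2_functions M. \<forall>G\<in>l2_functions M.
        (AE x in M. F x = G x) \<longrightarrow> (AE x in M. V F x = V G x)) \<and>
     (\<forall>F\<in>l2_functions M. \<forall>G\<in>l2_functions M. \<forall>a b.
        AE x in M. V (\<lambda>y. a * F y + b * G y) x = a * V F x + b * V G x) \<and>
     (\<forall>F\<in>l2_functions M. \<forall>G\<in>l2_functions M. l2_inner M (V F) (V G) = l2_inner M F G) \<and>
     (\<forall>G\<in>l2_functions M. \<exists>F\<in>l2_functions M. AE x in M. V F x = G x)"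

definition l2_unitary_group ::
    "'a measure \<Rightarrow> (real \<Rightarrow> ('a \<Rightarrow> complex) \<Rightarrow> ('a \<Rightarrow> complex)) \<Rightarrow> bool" where
  "l2_unitary_group M U \<longleftrightarrow>
     (\<forall>t. l2_unitary M (U t)) \<and>
     (\<forall>F\<in>l2_functions M. AE x in M. U 0 F x = F x) \<and>
     (\<forall>s t. \<forall>F\<in>l2_functions M. AE x in M. U (s + t) F x = U s (U t F) x) \<and>
     (\<forall>F\<in>l2_functions M. \<forall>t. ((\<lambda>s. l2_norm M (\<lambda>x. U s F x - U t F x)) \<longlongrightarrow> 0) (at t))"

definition l2_generator ::
    "'a measure \<Rightarrow> (real \<Rightarrow> ('a \<Rightarrow> complex) \<Rightarrow> ('a \<Rightarrow> complex)) \<Rightarrow> 'a l2_graph" where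
  "l2_generator M U =
     {(F, G). F \<in> l2_functions M \<and> G \<in> l2_functions M \<and>
        ((\<lambda>h. l2_norm M (\<lambda>x. (U h F x - F x) / of_real h - G x)) \<longlongrightarrow> 0) (at 0)}"

definition l2_generates ::
    "'a measure \<Rightarrow> 'a l2_graph \<Rightarrow> (real \<Rightarrow> ('a \<Rightarrow> complex) \<Rightarrow> ('a \<Rightarrow> complex)) \<Rightarrow> bool" where
  "l2_generates M A U \<longleftrightarrow> l2_unitary_group M U \<and> l2_generator M U = A"

text \<open>\<open>l2_exp M A t\<close> stands for \<open>exp(tA)\<close>. The choice is only between representatives: a
  unitary group is determined by its generator up to almost everywhere equality, and for
  skew-adjoint \<open>A\<close> it exists by Stone's theorem.\<close>

definition l2_exp ::
    "'a measure \<Rightarrow> 'a l2_graph \<Rightarrow> real \<Rightarrow> ('a \<Rightarrow> complex) \<Rightarrow> ('a \<Rightarrow> complex)" where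
  "l2_exp M A = (SOME U. l2_generates M A U)"


section \<open>The shifted Euler operator and its domain\<close>

definition smooth_function :: "(real \<Rightarrow> complex) \<Rightarrow> bool" where
  "smooth_function f \<longleftrightarrow>
     (\<forall>n r. ((\<lambda>g s. vector_derivative g (at s)) ^^ n) f differentiable (at r))"

text \<open>Smooth functions with compact support in the positive half-line, extended by zero
  to all of the real line.\<close>

definition test_functions_pos :: "(real \<Rightarrow> complex) set" where
  "test_functions_pos =
     {f. smooth_function f \<and> (\<exists>K. compact K \<and> K \<subseteq> {0<..} \<and> (\<forall>r. r \<notin> K \<longrightarrow> f r = 0))}"

text \<open>The functions live on the complement of the origin, a null set; they are given the value
  \<open>0\<close> at the origin.\<close>

definition polar_product :: "(real^'n \<Rightarrow> complex) \<Rightarrow> (real \<Rightarrow> complex) \<Rightarrow> real^'n \<Rightarrow> complex" where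
  "polar_product p f x = (if x = 0 then 0 else p (x /\<^sub>R norm x) * f (norm x))"

definition complex_span :: "('a \<Rightarrow> complex) set \<Rightarrow> ('a \<Rightarrow> complex) set" where
  "complex_span B =
     {(\<lambda>x. \<Sum>i<n. c i * g i x) | (n::nat) (c :: nat \<Rightarrow> complex) g. \<forall>i<n. g i \<in> B}"

definition euler_domain :: "(real^'n \<Rightarrow> complex) set" where
  "euler_domain =
     complex_span {polar_product p f | p f. polynomial_function p \<and> f \<in> test_functions_pos}"

definition partial_derivative :: "'n \<Rightarrow> (real^'n \<Rightarrow> complex) \<Rightarrow> real^'n \<Rightarrow> complex" where
  "partial_derivative j F x = vector_derivative (\<lambda>s. F (x + s *\<^sub>R axis j 1)) (at 0)"

definition euler_operator :: "(real^'n \<Rightarrow> complex) \<Rightarrow> real^'n \<Rightarrow> complex" where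
  "euler_operator F x = (\<Sum>j\<in>UNIV. of_real (x $ j) * partial_derivative j F x)"

definition shifted_euler ::
    "(real^'n) set \<Rightarrow> (real^'n \<Rightarrow> complex) \<Rightarrow> (real^'n \<Rightarrow> complex) \<Rightarrow> real^'n \<Rightarrow> complex" where
  "shifted_euler R k F x =
     2 * euler_operator F x + (2 * multiplicity_index R k + of_nat CARD('n) - 2) * F x"

definition shifted_euler_graph ::
    "(real^'n) set \<Rightarrow> (real^'n \<Rightarrow> complex) \<Rightarrow> (real^'n) l2_graph" where
  "shifted_euler_graph R k = l2_operator (dunkl_measure R k) euler_domain (shifted_euler R k)"

definition shifted_euler_closure ::
    "(real^'n) set \<Rightarrow> (real^'n \<Rightarrow> complex) \<Rightarrow> (real^'n) l2_graph" where
  "shifted_euler_closure R k = l2_closure (dunkl_measure R k) (shifted_euler_graph R k)"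

end

(*
  The dilations V t F x = e^(ct) F(e^(2t) x), c = 2<k> + N - 2, are unitary because the weight is
  homogeneous of degree 2<k> - 2, and they are strongly continuous because they are so on the dense
  domain D. Their generator extends the shifted Euler operator A on D. As D is dense and invariant
  under the dilations, it is a core: A* is contained in the negative of the generator (differentiate
  <V s F, G> for F in D), and the range of 1 - A is dense, because truncations of the resolvent
  series of (V h - 1)/h stay in D. A unitary group is determined by its generator.
  Density of D rests on the Stone-Weierstrass theorem on annuli: a monomial times a radial test
  function is a polar product.
*)

theory Submission
  imports Defs
begin

section \<open>Square-integrable functions\<close>

text \<open>\<open>l2_exp\<close> is a Hilbert choice, so the formula has two halves: the closure of
  the operator on D generates the dilations, and two groups with this generator agree. The
  constants: substituting y = e^(2t) x in the integral of |F|^2 w costs e^(-2ct), because w dx has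
  degree (2<k> - 2) + N = c, and the factor e^(ct) compensates; the 2 in 2E is the 2 in e^(2t). The
  obstacle is the origin, where |x|^-2 may fail to be integrable: only annuli are sure to have
  finite measure, so supports are kept away from 0. Another is that (1 - A)^-1 g, the integral of
  e^(-s) V s g over s > 0, in general leaves D; its discretisation by finitely many dilates of g
  does not. Limits are handled weakly: derivatives are taken of the scalar functions <V s F, G>, and
  norms are recovered by testing against a dense set. Skew symmetry gives ||z - Az||^2 = ||z||^2 +
  ||Az||^2, which turns approximation of z - Az into approximation in the graph norm.\<close>

lemma l2_measurable [measurable_dest]: "F \<in> l2_functions M \<Longrightarrow> F \<in> borel_measurable M"
  and l2_integrable: "F \<in> l2_functions M \<Longrightarrow> integrable M (\<lambda>x. (norm (F x))\<^sup>2)"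
  by (auto simp: l2_functions_def)

lemma l2_dominated:
  fixes F :: "'a \<Rightarrow> complex"
  assumes "F \<in> borel_measurable M" "integrable M g" "AE x in M. (norm (F x))\<^sup>2 \<le> g x"
  shows "F \<in> l2_functions M"
proof -
  have "integrable M (\<lambda>x. (norm (F x))\<^sup>2)"
    using assms by (intro Bochner_Integration.integrable_bound[OF assms(2)]) auto
  then show ?thesis using assms(1) by (simp add: l2_functions_def)
qed

lemma norm_add_square_le:
  fixes a b :: "'a::real_normed_vector"
  shows "(norm (a + b))\<^sup>2 \<le> 2 * (norm a)\<^sup>2 + 2 * (norm b)\<^sup>2"
proof -
  have "(norm (a + b))\<^sup>2 \<le> (norm a + norm b)\<^sup>2"
    by (intro power_mono norm_triangle_ineq) auto
  also have "\<dots> \<le> 2 * (norm a)\<^sup>2 + 2 * (norm b)\<^sup>2"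
    using zero_le_power2[of "norm a - norm b"] by (simp add: power2_eq_square algebra_simps)
  finally show ?thesis .
qed

lemma sum_squares_le_square:
  fixes a b c :: real
  assumes "a\<^sup>2 + b\<^sup>2 \<le> c\<^sup>2" "0 \<le> c"
  shows "a \<le> c \<and> b \<le> c"
proof -
  have "a\<^sup>2 \<le> c\<^sup>2" "b\<^sup>2 \<le> c\<^sup>2"
    using assms(1) zero_le_power2[of a] zero_le_power2[of b] by linarith+
  then show ?thesis using assms(2) by (auto intro: power2_le_imp_le)
qed

lemma l2_zero [simp]: "(\<lambda>x. 0) \<in> l2_functions M"
  by (simp add: l2_functions_def)

lemma l2_add [simp]:
  assumes "F \<in> l2_functions M" "G \<in> l2_functions M"
  shows "(\<lambda>x. F x + G x) \<in> l2_functions M"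
  using assms
  by (intro l2_dominated[where g = "\<lambda>x. 2 * (norm (F x))\<^sup>2 + 2 * (norm (G x))\<^sup>2"])
     (auto intro!: norm_add_square_le simp: l2_integrable)

lemma l2_scale [simp]: "F \<in> l2_functions M \<Longrightarrow> (\<lambda>x. c * F x) \<in> l2_functions M"
  by (auto simp: l2_functions_def norm_mult power_mult_distrib)

lemma l2_divide [simp]: "F \<in> l2_functions M \<Longrightarrow> (\<lambda>x. F x / c) \<in> l2_functions M"
  using l2_scale[of F M "1 / c"] by simp

lemma l2_uminus [simp]: "F \<in> l2_functions M \<Longrightarrow> (\<lambda>x. - F x) \<in> l2_functions M"
  using l2_scale[of F M "- 1"] by simp

lemma l2_diff [simp]:
  assumes "F \<in> l2_functions M" "G \<in> l2_functions M"
  shows "(\<lambda>x. F x - G x) \<in> l2_functions M"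
  using l2_add[OF assms(1) l2_uminus[OF assms(2)]] by simp

lemma l2_sum:
  assumes "\<And>i. i \<in> I \<Longrightarrow> F i \<in> l2_functions M"
  shows "(\<lambda>x. \<Sum>i\<in>I. F i x) \<in> l2_functions M"
  using assms by (induction I rule: infinite_finite_induct) auto

lemma l2_integrable_mult:
  assumes "F \<in> l2_functions M" "G \<in> l2_functions M"
  shows "integrable M (\<lambda>x. F x * cnj (G x))"
proof (rule Bochner_Integration.integrable_bound)
  show "integrable M (\<lambda>x. (norm (F x))\<^sup>2 + (norm (G x))\<^sup>2)"
    using assms by (auto simp: l2_integrable)
  have [measurable]: "cnj \<in> borel_measurable borel"
    by (intro borel_measurable_continuous_onI continuous_intros)
  show "(\<lambda>x. F x * cnj (G x)) \<in> borel_measurable M"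
    using assms by measurable
  have "norm (a * cnj b) \<le> norm ((norm a)\<^sup>2 + (norm b)\<^sup>2)" for a b :: complex
    using zero_le_power2[of "norm a - norm b"] mult_nonneg_nonneg[of "norm a" "norm b"]
    by (simp add: norm_mult power2_eq_square algebra_simps del: mult_nonneg_nonneg)
  then show "AE x in M. norm (F x * cnj (G x)) \<le> norm ((norm (F x))\<^sup>2 + (norm (G x))\<^sup>2)"
    by simp
qed

lemma l2_inner_commute: "l2_inner M G F = cnj (l2_inner M F G)"
  unfolding l2_inner_def by (simp add: mult.commute flip: Bochner_Integration.integral_cnj)

lemma l2_inner_add_left:
  assumes "F \<in> l2_functions M" "G \<in> l2_functions M" "H \<in> l2_functions M"
  shows "l2_inner M (\<lambda>x. F x + G x) H = l2_inner M F H + l2_inner M G H"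
  using assms by (simp add: l2_inner_def distrib_right l2_integrable_mult)

lemma l2_inner_scale_left: "l2_inner M (\<lambda>x. c * F x) H = c * l2_inner M F H"
  by (simp add: l2_inner_def mult.assoc)

lemma l2_inner_uminus_left: "l2_inner M (\<lambda>x. - F x) H = - l2_inner M F H"
  by (simp add: l2_inner_def)

lemma l2_inner_divide_left: "l2_inner M (\<lambda>x. F x / c) H = l2_inner M F H / c"
  using l2_inner_scale_left[of M "1 / c"] by simp

lemma l2_inner_diff_left:
  assumes "F \<in> l2_functions M" "G \<in> l2_functions M" "H \<in> l2_functions M"
  shows "l2_inner M (\<lambda>x. F x - G x) H = l2_inner M F H - l2_inner M G H"
  using assms by (simp add: l2_inner_def left_diff_distrib l2_integrable_mult)

lemma l2_inner_add_right:
  assumes "F \<in> l2_functions M" "G \<in> l2_functions M" "H \<in> l2_functions M"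
  shows "l2_inner M H (\<lambda>x. F x + G x) = l2_inner M H F + l2_inner M H G"
  by (subst (1 2 3) l2_inner_commute) (simp add: l2_inner_add_left assms)

lemma l2_inner_diff_right:
  assumes "F \<in> l2_functions M" "G \<in> l2_functions M" "H \<in> l2_functions M"
  shows "l2_inner M H (\<lambda>x. F x - G x) = l2_inner M H F - l2_inner M H G"
  by (subst (1 2 3) l2_inner_commute) (simp add: l2_inner_diff_left assms)

lemma l2_inner_scale_right: "l2_inner M H (\<lambda>x. c * F x) = cnj c * l2_inner M H F"
  by (subst (1 2) l2_inner_commute) (simp add: l2_inner_scale_left)

lemma l2_inner_uminus_right: "l2_inner M H (\<lambda>x. - F x) = - l2_inner M H F"
  by (simp add: l2_inner_def)

lemma l2_inner_divide_right: "l2_inner M H (\<lambda>x. F x / c) = l2_inner M H F / cnj c"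
  using l2_inner_scale_right[of M H "1 / c" F] by simp

lemmas l2_inner_linear = l2_inner_add_left l2_inner_diff_left l2_inner_scale_left
  l2_inner_uminus_left l2_inner_divide_left l2_inner_add_right l2_inner_diff_right
  l2_inner_scale_right l2_inner_uminus_right l2_inner_divide_right

lemma l2_inner_cong_AE:
  assumes "F \<in> l2_functions M" "F' \<in> l2_functions M" "G \<in> l2_functions M" "G' \<in> l2_functions M"
    and "AE x in M. F x = F' x" "AE x in M. G x = G' x"
  shows "l2_inner M F G = l2_inner M F' G'"
  unfolding l2_inner_def
proof (rule integral_cong_AE)
  show "AE x in M. F x * cnj (G x) = F' x * cnj (G' x)" using assms(5,6) by auto
qed (use assms in \<open>auto intro!: borel_measurable_integrable l2_integrable_mult\<close>)

lemma l2_norm_cong_AE: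
  assumes "F \<in> l2_functions M" "G \<in> l2_functions M" "AE x in M. F x = G x"
  shows "l2_norm M F = l2_norm M G"
  unfolding l2_norm_def using assms
  by (intro arg_cong[of _ _ sqrt] integral_cong_AE) (auto simp: borel_measurable_integrable l2_integrable)

lemma l2_norm_nonneg [simp]: "0 \<le> l2_norm M F"
  by (simp add: l2_norm_def)

lemma l2_norm_square: "(l2_norm M F)\<^sup>2 = (LINT x|M. (norm (F x))\<^sup>2)"
  by (simp add: l2_norm_def)

lemma l2_inner_self: "l2_inner M F F = of_real ((l2_norm M F)\<^sup>2)"
  unfolding l2_norm_square l2_inner_def
  by (simp only: integral_complex_of_real[symmetric] complex_norm_square)

lemma l2_norm_eq_0_AE:
  assumes "F \<in> l2_functions M" "l2_norm M F = 0"
  shows "AE x in M. F x = 0"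
  using assms integral_nonneg_eq_0_iff_AE[of M "\<lambda>x. (norm (F x))\<^sup>2"]
  by (simp add: l2_norm_def l2_integrable)

lemma l2_norm_zero [simp]: "l2_norm M (\<lambda>x. 0) = 0"
  by (simp add: l2_norm_def)

lemma l2_norm_scale: "l2_norm M (\<lambda>x. c * F x) = norm c * l2_norm M F"
  by (simp add: l2_norm_def norm_mult power_mult_distrib real_sqrt_mult)

lemma l2_norm_minus_commute: "l2_norm M (\<lambda>x. F x - G x) = l2_norm M (\<lambda>x. G x - F x)"
  by (simp add: l2_norm_def norm_minus_commute)

lemma l2_Cauchy_Schwarz:
  assumes F: "F \<in> l2_functions M" and G: "G \<in> l2_functions M"
  shows "norm (l2_inner M F G) \<le> l2_norm M F * l2_norm M G"
proof (cases "l2_norm M G = 0")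
  case True
  have "l2_inner M F G = l2_inner M F (\<lambda>x. 0)"
    using l2_norm_eq_0_AE[OF G True] F G by (intro l2_inner_cong_AE) auto
  then show ?thesis by (simp add: True l2_inner_def)
next
  case False
  define n where "n = l2_norm M G"
  define c where "c = l2_inner M F G / of_real (n\<^sup>2)"
  have n: "n > 0" using False l2_norm_nonneg[of M G] unfolding n_def by linarith
  \<comment> \<open>This is the component of F orthogonal to G; its squared norm is ||F||^2 -
    |<F,G>|^2 / n^2, and nonnegativity of that is the inequality.\<close>
  define H where "H = (\<lambda>x. F x - c * G x)"
  have "of_real ((l2_norm M H)\<^sup>2) = l2_inner M H H" by (simp add: l2_inner_self)
  also have "\<dots> = l2_inner M F F - cnj c * l2_inner M F G - c * l2_inner M G F
      + c * cnj c * l2_inner M G G"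
    unfolding H_def using F G by (simp add: l2_inner_linear algebra_simps)
  also have "\<dots> = of_real ((l2_norm M F)\<^sup>2) - l2_inner M F G * cnj (l2_inner M F G) / of_real (n\<^sup>2)"
    using n by (simp add: l2_inner_self c_def l2_inner_commute[of M G F] flip: n_def)
      (simp add: field_simps power2_eq_square power4_eq_xxxx)
  also have "\<dots> = of_real ((l2_norm M F)\<^sup>2 - (norm (l2_inner M F G))\<^sup>2 / n\<^sup>2)"
    by (simp only: of_real_diff of_real_divide complex_norm_square)
  finally have "(l2_norm M H)\<^sup>2 = (l2_norm M F)\<^sup>2 - (norm (l2_inner M F G))\<^sup>2 / n\<^sup>2"
    using of_real_eq_iff by blast
  then have "(norm (l2_inner M F G))\<^sup>2 / n\<^sup>2 \<le> (l2_norm M F)\<^sup>2"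
    using zero_le_power2[of "l2_norm M H"] by linarith
  then have "(norm (l2_inner M F G))\<^sup>2 \<le> (l2_norm M F * n)\<^sup>2"
    using n by (simp add: field_simps power_mult_distrib)
  then show ?thesis unfolding n_def by (rule power2_le_imp_le) simp
qed

lemma l2_norm_triangle:
  assumes "F \<in> l2_functions M" "G \<in> l2_functions M"
  shows "l2_norm M (\<lambda>x. F x + G x) \<le> l2_norm M F + l2_norm M G"
proof (rule power2_le_imp_le)
  have "of_real ((l2_norm M (\<lambda>x. F x + G x))\<^sup>2) =
      of_real ((l2_norm M F)\<^sup>2 + (l2_norm M G)\<^sup>2) + (l2_inner M F G + cnj (l2_inner M F G))"
    using assms by (simp add: l2_inner_linear l2_inner_commute[of M G F] del: of_real_power flip: l2_inner_self)
  also have "\<dots> = of_real ((l2_norm M F)\<^sup>2 + (l2_norm M G)\<^sup>2 + 2 * Re (l2_inner M F G))"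
    by (simp add: complex_add_cnj)
  finally have "(l2_norm M (\<lambda>x. F x + G x))\<^sup>2 =
      (l2_norm M F)\<^sup>2 + (l2_norm M G)\<^sup>2 + 2 * Re (l2_inner M F G)"
    using of_real_eq_iff by blast
  moreover have "Re (l2_inner M F G) \<le> l2_norm M F * l2_norm M G"
    using l2_Cauchy_Schwarz[OF assms] complex_Re_le_cmod order_trans by blast
  ultimately show "(l2_norm M (\<lambda>x. F x + G x))\<^sup>2 \<le> (l2_norm M F + l2_norm M G)\<^sup>2"
    by (simp add: power2_eq_square algebra_simps)
qed simp

lemma l2_norm_triangle_diff:
  assumes "F \<in> l2_functions M" "G \<in> l2_functions M" "H \<in> l2_functions M"
  shows "l2_norm M (\<lambda>x. F x - H x) \<le> l2_norm M (\<lambda>x. F x - G x) + l2_norm M (\<lambda>x. G x - H x)"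
  using l2_norm_triangle[OF l2_diff[OF assms(1,2)] l2_diff[OF assms(2,3)]] by simp

lemma tendsto_l2_inner:
  assumes "((\<lambda>i. l2_norm M (\<lambda>x. f i x - F x)) \<longlongrightarrow> 0) \<F>"
    and "((\<lambda>i. l2_norm M (\<lambda>x. g i x - G x)) \<longlongrightarrow> 0) \<F>"
    and "\<And>i. f i \<in> l2_functions M" "\<And>i. g i \<in> l2_functions M"
    and FG: "F \<in> l2_functions M" "G \<in> l2_functions M"
  shows "((\<lambda>i. l2_inner M (f i) (g i)) \<longlongrightarrow> l2_inner M F G) \<F>"
proof -
  let ?f = "\<lambda>i. l2_norm M (\<lambda>x. f i x - F x)" and ?g = "\<lambda>i. l2_norm M (\<lambda>x. g i x - G x)"
  note [simp] = assms(3-6)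
  have "norm (l2_inner M (f i) (g i) - l2_inner M F G) \<le>
      ?f i * ?g i + ?f i * l2_norm M G + l2_norm M F * ?g i" for i
  proof -
    have "l2_inner M (f i) (g i) - l2_inner M F G = l2_inner M (\<lambda>x. f i x - F x) (\<lambda>x. g i x - G x)
        + l2_inner M (\<lambda>x. f i x - F x) G + l2_inner M F (\<lambda>x. g i x - G x)"
      by (simp add: l2_inner_diff_left l2_inner_diff_right)
    moreover have "norm (l2_inner M (\<lambda>x. f i x - F x) (\<lambda>x. g i x - G x)) \<le> ?f i * ?g i"
      "norm (l2_inner M (\<lambda>x. f i x - F x) G) \<le> ?f i * l2_norm M G"
      "norm (l2_inner M F (\<lambda>x. g i x - G x)) \<le> l2_norm M F * ?g i"
      by (rule l2_Cauchy_Schwarz; simp)+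
    ultimately show ?thesis by (simp only:) (intro norm_triangle_le add_mono)
  qed
  then have *: "\<forall>\<^sub>F i in \<F>. norm (l2_inner M (f i) (g i) - l2_inner M F G) \<le>
      ?f i * ?g i + ?f i * l2_norm M G + l2_norm M F * ?g i"
    by (rule always_eventually[OF allI])
  have "((\<lambda>i. ?f i * ?g i + ?f i * l2_norm M G + l2_norm M F * ?g i) \<longlongrightarrow>
      0 * 0 + 0 * l2_norm M G + l2_norm M F * 0) \<F>"
    by (intro tendsto_add tendsto_mult tendsto_const assms(1,2))
  then have "((\<lambda>i. ?f i * ?g i + ?f i * l2_norm M G + l2_norm M F * ?g i) \<longlongrightarrow> 0) \<F>"
    by simp
  with * have "((\<lambda>i. l2_inner M (f i) (g i) - l2_inner M F G) \<longlongrightarrow> 0) \<F>"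
    by (rule Lim_null_comparison)
  then show ?thesis by (rule LIM_zero_cancel)
qed

lemma tendsto_0_bound:
  fixes f g :: "'a \<Rightarrow> real"
  assumes "\<And>i. 0 \<le> f i" "\<And>i. f i \<le> g i" "(g \<longlongrightarrow> c) \<F>" "c = 0"
  shows "(f \<longlongrightarrow> 0) \<F>"
  using assms by (intro tendsto_sandwich[of "\<lambda>_. 0" f \<F> g]) auto

lemma l2_dominated_convergence:
  fixes f :: "nat \<Rightarrow> 'a \<Rightarrow> complex"
  assumes [measurable]: "\<And>n. f n \<in> borel_measurable M" "F \<in> borel_measurable M"
    and w: "integrable M w"
    and lim: "AE x in M. (\<lambda>n. f n x) \<longlonglongrightarrow> F x"
    and bound: "\<And>n. AE x in M. (norm (f n x - F x))\<^sup>2 \<le> w x"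
  shows "(\<lambda>n. l2_norm M (\<lambda>x. f n x - F x)) \<longlonglongrightarrow> 0"
proof -
  have "(\<lambda>n. LINT x|M. (norm (f n x - F x))\<^sup>2) \<longlonglongrightarrow> (LINT x|M. 0)"
  proof (rule integral_dominated_convergence[OF _ _ w])
    show "AE x in M. (\<lambda>n. (norm (f n x - F x))\<^sup>2) \<longlonglongrightarrow> 0"
      using lim
    proof (rule AE_mp, intro AE_I2 impI)
      fix x assume "(\<lambda>n. f n x) \<longlonglongrightarrow> F x"
      then have "(\<lambda>n. (norm (f n x - F x))\<^sup>2) \<longlonglongrightarrow> (norm (F x - F x))\<^sup>2"
        by (intro tendsto_intros)
      then show "(\<lambda>n. (norm (f n x - F x))\<^sup>2) \<longlonglongrightarrow> 0" by simp
    qed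
  qed (use bound in auto)
  then have "(\<lambda>n. sqrt (LINT x|M. (norm (f n x - F x))\<^sup>2)) \<longlonglongrightarrow> sqrt 0"
    by (intro tendsto_real_sqrt) simp
  then show ?thesis by (simp add: l2_norm_def)
qed

lemma l2_norm_mono:
  assumes F: "F \<in> borel_measurable M" and G: "G \<in> l2_functions M" and "0 \<le> c"
    and le: "AE x in M. norm (F x) \<le> c * norm (G x)"
  shows "l2_norm M F \<le> c * l2_norm M G"
proof -
  have le2: "AE x in M. (norm (F x))\<^sup>2 \<le> (norm (of_real c * G x))\<^sup>2"
    using le \<open>0 \<le> c\<close> by (auto elim!: AE_mp intro!: AE_I2 power_mono simp: norm_mult)
  have cG: "(\<lambda>x. of_real c * G x) \<in> l2_functions M" using G by simp
  have "F \<in> l2_functions M"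
    by (rule l2_dominated[OF F l2_integrable[OF cG] le2])
  then have "l2_norm M F \<le> l2_norm M (\<lambda>x. of_real c * G x)"
    unfolding l2_norm_def using le2 cG
    by (intro real_sqrt_le_mono integral_mono_AE l2_integrable)
  then show ?thesis using \<open>0 \<le> c\<close> by (simp add: l2_norm_scale)
qed

lemma l2_norm_sum:
  assumes "\<And>i. i \<in> I \<Longrightarrow> F i \<in> l2_functions M"
  shows "l2_norm M (\<lambda>x. \<Sum>i\<in>I. F i x) \<le> (\<Sum>i\<in>I. l2_norm M (F i))"
  using assms
proof (induction I rule: infinite_finite_induct)
  case (insert i I)
  have "l2_norm M (\<lambda>x. F i x + (\<Sum>i\<in>I. F i x)) \<le> l2_norm M (F i) + l2_norm M (\<lambda>x. \<Sum>i\<in>I. F i x)"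
    using insert.prems by (intro l2_norm_triangle l2_sum) auto
  then show ?case using insert by force
qed auto

text \<open>Duality: take F in D close to W itself and split <W,W> = <W - F,W> + <F,W>. The first
  term is small and the second is about c ||W||. This is how weak estimates on the domain become
  norm estimates.\<close>

lemma l2_norm_le_dense:
  assumes W: "W \<in> l2_functions M" and "0 \<le> c" and D: "D \<subseteq> l2_functions M"
    and dense: "\<And>e. e > 0 \<Longrightarrow> \<exists>F\<in>D. l2_norm M (\<lambda>x. W x - F x) < e"
    and le: "\<And>F. F \<in> D \<Longrightarrow> norm (l2_inner M F W) \<le> c * l2_norm M F"
  shows "l2_norm M W \<le> c"
proof (cases "l2_norm M W = 0")
  case False
  then have W0: "l2_norm M W > 0" using l2_norm_nonneg[of M W] by linarith
  have "(l2_norm M W)\<^sup>2 \<le> c * l2_norm M W + e * (l2_norm M W + c)" if e: "e > 0" for e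
  proof -
    obtain F where F: "F \<in> D" "l2_norm M (\<lambda>x. W x - F x) < e" using dense[OF e] by blast
    then have FL: "F \<in> l2_functions M" using D by blast
    have "l2_norm M F \<le> l2_norm M W + l2_norm M (\<lambda>x. F x - W x)"
      using l2_norm_triangle[OF W l2_diff[OF FL W]] by simp
    then have F': "l2_norm M F \<le> l2_norm M W + e"
      using F(2) by (simp add: l2_norm_minus_commute[of M F])
    have "(l2_norm M W)\<^sup>2 = norm (l2_inner M W W)" by (simp add: l2_inner_self norm_power)
    also have "l2_inner M W W = l2_inner M (\<lambda>x. W x - F x) W + l2_inner M F W"
      using W FL by (simp add: l2_inner_linear)
    also have "norm \<dots> \<le> l2_norm M (\<lambda>x. W x - F x) * l2_norm M W + c * l2_norm M F"
      using W FL by (intro norm_triangle_le add_mono l2_Cauchy_Schwarz le F(1)) auto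
    also have "\<dots> \<le> e * l2_norm M W + c * (l2_norm M W + e)"
      using F(2) F' \<open>0 \<le> c\<close> e by (intro add_mono mult_mono) auto
    finally show ?thesis by (simp add: algebra_simps)
  qed
  note le' = this
  \<comment> \<open>For e = d / (||W|| + c) the error term of the previous bound is exactly
    d.\<close>
  have "l2_norm M W * l2_norm M W \<le> c * l2_norm M W + d" if "d > 0" for d
    using le'[of "d / (l2_norm M W + c)"] W0 \<open>0 \<le> c\<close> that by (simp add: power2_eq_square)
  then have "l2_norm M W * l2_norm M W \<le> c * l2_norm M W"
    by (rule field_le_epsilon)
  then show ?thesis using W0 by (simp add: power2_eq_square)
qed (use assms in auto)

section \<open>Unitary groups and their generators\<close>

lemma l2_generatorD:
  assumes "(F, G) \<in> l2_generator M V"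
  shows "F \<in> l2_functions M" "G \<in> l2_functions M"
    "((\<lambda>h. l2_norm M (\<lambda>x. (V h F x - F x) / of_real h - G x)) \<longlongrightarrow> 0) (at 0)"
  using assms by (auto simp: l2_generator_def)

text \<open>Generators are limits of difference quotients; in this form they feed the mean value
  inequality and the theorem that a zero derivative forces a constant.\<close>

lemma has_vector_derivative_at_iff_quotient:
  fixes f :: "real \<Rightarrow> 'a::real_normed_vector"
  shows "(f has_vector_derivative D) (at t) \<longleftrightarrow> ((\<lambda>h. (f (t + h) - f t) /\<^sub>R h) \<longlongrightarrow> D) (at 0)"
proof -
  have "norm ((f (t + h) - f t) /\<^sub>R h - D) = norm (f (t + h) - f t - h *\<^sub>R D) / norm h"
    if "h \<noteq> 0" for h
  proof -
    have "(f (t + h) - f t) /\<^sub>R h - D = (f (t + h) - f t - h *\<^sub>R D) /\<^sub>R h"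
      using that by (simp add: scaleR_diff_right)
    then show ?thesis by (simp add: divide_inverse mult.commute)
  qed
  then have "\<forall>\<^sub>F h in at 0. norm ((f (t + h) - f t) /\<^sub>R h - D) =
      norm (f (t + h) - f t - h *\<^sub>R D) / norm h"
    unfolding eventually_at_filter by (auto intro!: always_eventually)
  from tendsto_cong[OF this, of 0] show ?thesis
    by (simp add: has_vector_derivative_def has_derivative_at bounded_linear_scaleR_left
        tendsto_norm_zero_iff LIM_zero_iff)
qed

context
  fixes M :: "'a measure" and V :: "real \<Rightarrow> ('a \<Rightarrow> complex) \<Rightarrow> 'a \<Rightarrow> complex"
  assumes group: "l2_unitary_group M V"
begin

lemma unitary_l2 [simp]: "F \<in> l2_functions M \<Longrightarrow> V t F \<in> l2_functions M"
  using group by (auto simp: l2_unitary_group_def l2_unitary_def)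

lemma unitary_linear:
  assumes "F \<in> l2_functions M" "G \<in> l2_functions M"
  shows "AE x in M. V t (\<lambda>y. a * F y + b * G y) x = a * V t F x + b * V t G x"
proof -
  have "l2_unitary M (V t)" using group by (simp add: l2_unitary_group_def)
  then show ?thesis using assms unfolding l2_unitary_def by blast
qed

text \<open>Three terms because (V h F - F) / h - G is a combination of V h F, F and G.\<close>

lemma unitary_linear3:
  assumes "F \<in> l2_functions M" "G \<in> l2_functions M" "H \<in> l2_functions M"
  shows "AE x in M. V t (\<lambda>y. a * F y + b * G y + c * H y) x = a * V t F x + b * V t G x + c * V t H x"
proof -
  have "AE x in M. V t (\<lambda>y. 1 * (a * F y + b * G y) + c * H y) x =
      1 * V t (\<lambda>y. a * F y + b * G y) x + c * V t H x"
    using assms by (intro unitary_linear) auto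
  with unitary_linear[OF assms(1,2), of t a b] show ?thesis by (auto elim: AE_mp)
qed

lemma unitary_inner [simp]:
  assumes "F \<in> l2_functions M" "G \<in> l2_functions M"
  shows "l2_inner M (V t F) (V t G) = l2_inner M F G"
  using group assms by (auto simp: l2_unitary_group_def l2_unitary_def)

lemma unitary_norm [simp]: "F \<in> l2_functions M \<Longrightarrow> l2_norm M (V t F) = l2_norm M F"
proof -
  assume "F \<in> l2_functions M"
  then have "complex_of_real ((l2_norm M (V t F))\<^sup>2) = of_real ((l2_norm M F)\<^sup>2)"
    by (simp only: l2_inner_self[symmetric] unitary_inner)
  then have "(l2_norm M (V t F))\<^sup>2 = (l2_norm M F)\<^sup>2" using of_real_eq_iff by blast
  then show ?thesis by simp
qed

lemma unitary_zero: "F \<in> l2_functions M \<Longrightarrow> AE x in M. V 0 F x = F x"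
  using group by (auto simp: l2_unitary_group_def)

lemma unitary_add: "F \<in> l2_functions M \<Longrightarrow> AE x in M. V (s + t) F x = V s (V t F) x"
  using group by (auto simp: l2_unitary_group_def)

lemma unitary_cont:
  "F \<in> l2_functions M \<Longrightarrow> ((\<lambda>s. l2_norm M (\<lambda>x. V s F x - V t F x)) \<longlongrightarrow> 0) (at t)"
  using group by (auto simp: l2_unitary_group_def)

lemma unitary_inner_adjoint:
  assumes "F \<in> l2_functions M" "G \<in> l2_functions M"
  shows "l2_inner M (V t F) G = l2_inner M F (V (- t) G)"
proof -
  have "l2_inner M (V t F) G = l2_inner M (V (- t) (V t F)) (V (- t) G)"
    using assms by simp
  also have "\<dots> = l2_inner M F (V (- t) G)"
    using assms unitary_add[of F "- t" t] unitary_zero[of F]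
    by (intro l2_inner_cong_AE) (auto elim: AE_mp)
  finally show ?thesis .
qed

lemma unitary_norm_linear3:
  assumes "F \<in> l2_functions M" "G \<in> l2_functions M" "H \<in> l2_functions M"
  shows "l2_norm M (\<lambda>x. a * V t F x + b * V t G x + c * V t H x) =
    l2_norm M (\<lambda>x. a * F x + b * G x + c * H x)"
proof -
  have "l2_norm M (\<lambda>x. a * V t F x + b * V t G x + c * V t H x) =
      l2_norm M (V t (\<lambda>x. a * F x + b * G x + c * H x))"
    using assms unitary_linear3[OF assms, of t a b c] by (intro l2_norm_cong_AE) (auto elim: AE_mp)
  then show ?thesis using assms by simp
qed

lemma unitary_cont_0:
  assumes "F \<in> l2_functions M"
  shows "((\<lambda>s. l2_norm M (\<lambda>x. V s F x - F x)) \<longlongrightarrow> 0) (at 0)"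
proof -
  have "l2_norm M (\<lambda>x. V s F x - V 0 F x) = l2_norm M (\<lambda>x. V s F x - F x)" for s
    using assms unitary_zero[OF assms] by (intro l2_norm_cong_AE) (auto elim: AE_mp)
  then show ?thesis using unitary_cont[OF assms, of 0] by simp
qed

text \<open>The adjoint of V h is V (- h), so moving the quotient with step h to the other slot
  yields minus the quotient with step - h; both tend to the generator.\<close>

lemma generator_skew_symmetric:
  assumes 1: "(F, F') \<in> l2_generator M V" and 2: "(G, G') \<in> l2_generator M V"
  shows "l2_inner M F' G = - l2_inner M F G'"
proof -
  note [simp] = l2_generatorD(1,2)[OF 1] l2_generatorD(1,2)[OF 2]
  have "((\<lambda>h. l2_inner M (\<lambda>x. (V h F x - F x) / of_real h) G) \<longlongrightarrow> l2_inner M F' G) (at 0)"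
    by (rule tendsto_l2_inner) (use l2_generatorD(3)[OF 1] in auto)
  moreover have "l2_inner M (\<lambda>x. (V h F x - F x) / of_real h) G
      = - l2_inner M F (\<lambda>x. (V (- h) G x - G x) / of_real (- h))" for h
    by (simp add: l2_inner_linear unitary_inner_adjoint diff_divide_distrib)
  moreover have "((\<lambda>h. - l2_inner M F (\<lambda>x. (V (- h) G x - G x) / of_real (- h))) \<longlongrightarrow> - l2_inner M F G') (at 0)"
  proof (rule tendsto_minus, rule tendsto_l2_inner)
    have "filterlim uminus (at (0::real)) (at 0)"
      unfolding filterlim_at by (auto intro!: tendsto_eq_intros simp: eventually_at_filter)
    from filterlim_compose[OF l2_generatorD(3)[OF 2] this]
    show "((\<lambda>h. l2_norm M (\<lambda>x. (V (- h) G x - G x) / of_real (- h) - G' x)) \<longlongrightarrow> 0) (at 0)" by simp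
  qed auto
  ultimately show ?thesis
    using tendsto_unique[of "at (0::real)"] by simp
qed

text \<open>V t commutes with V h and is isometric, so the error of the difference quotient at V t F
  has the same norm as the one at F.\<close>

lemma generator_invariant:
  assumes 1: "(F, G) \<in> l2_generator M V"
  shows "(V t F, V t G) \<in> l2_generator M V"
proof -
  note [simp] = l2_generatorD(1,2)[OF 1]
  have "l2_norm M (\<lambda>x. (V h (V t F) x - V t F x) / of_real h - V t G x) =
      l2_norm M (\<lambda>x. (V h F x - F x) / of_real h - G x)" for h
  proof -
    have "AE x in M. V h (V t F) x = V t (V h F) x"
      using unitary_add[of F h t] unitary_add[of F t h] by (auto elim: AE_mp simp: add.commute)
    then have "l2_norm M (\<lambda>x. (V h (V t F) x - V t F x) / of_real h - V t G x) =
        l2_norm M (\<lambda>x. (1 / of_real h) * V t (V h F) x + (- 1 / of_real h) * V t F x + (- 1) * V t G x)"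
      by (intro l2_norm_cong_AE) (auto elim!: AE_mp simp: diff_divide_distrib)
    also have "\<dots> = l2_norm M (\<lambda>x. (1 / of_real h) * V h F x + (- 1 / of_real h) * F x + (- 1) * G x)"
      by (rule unitary_norm_linear3) auto
    finally show ?thesis by (simp add: diff_divide_distrib)
  qed
  then show ?thesis using l2_generatorD(3)[OF 1] by (simp add: l2_generator_def)
qed

text \<open>By the group law, the derivative of the orbit at t is the derivative at 0 of the orbit
  of V t F.\<close>

lemma has_vector_derivative_inner_orbit:
  assumes 1: "(V t F, H) \<in> l2_generator M V" and [simp]: "F \<in> l2_functions M" "G \<in> l2_functions M"
  shows "((\<lambda>s. l2_inner M (V s F) G) has_vector_derivative l2_inner M H G) (at t)"
proof -
  note [simp] = l2_generatorD(1,2)[OF 1]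
  have "((\<lambda>h. l2_inner M (\<lambda>x. (V h (V t F) x - V t F x) / of_real h) G) \<longlongrightarrow> l2_inner M H G) (at 0)"
    by (rule tendsto_l2_inner) (use l2_generatorD(3)[OF 1] in auto)
  moreover have "l2_inner M (\<lambda>x. (V h (V t F) x - V t F x) / of_real h) G =
      (l2_inner M (V (t + h) F) G - l2_inner M (V t F) G) /\<^sub>R h" for h
  proof -
    have "l2_inner M (V h (V t F)) G = l2_inner M (V (t + h) F) G"
      using unitary_add[of F h t] by (intro l2_inner_cong_AE) (auto elim: AE_mp simp: add.commute)
    then have "l2_inner M (\<lambda>x. (V h (V t F) x - V t F x) / of_real h) G =
        (l2_inner M (V (t + h) F) G - l2_inner M (V t F) G) / of_real h"
      by (simp add: l2_inner_linear)
    then show ?thesis by (simp add: scaleR_conv_of_real divide_inverse mult.commute)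
  qed
  ultimately have "((\<lambda>h. (l2_inner M (V (t + h) F) G - l2_inner M (V t F) G) /\<^sub>R h) \<longlongrightarrow>
      l2_inner M H G) (at 0)" by simp
  then show ?thesis by (simp only: has_vector_derivative_at_iff_quotient)
qed

end

section \<open>Dense invariant subgraphs of a generator are cores\<close>

lemma l2_adjointD:
  assumes "(G, H) \<in> l2_adjoint M A"
  shows "G \<in> l2_functions M" "H \<in> l2_functions M"
    "(F, F') \<in> A \<Longrightarrow> l2_inner M F' G = l2_inner M F H"
  using assms by (auto simp: l2_adjoint_def)

context
  fixes M :: "'a measure" and V :: "real \<Rightarrow> ('a \<Rightarrow> complex) \<Rightarrow> 'a \<Rightarrow> complex"
    and A :: "'a l2_graph"
  assumes group: "l2_unitary_group M V"
    and sub: "A \<subseteq> l2_generator M V"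
    and dense: "l2_densely_defined M A"
    and lin: "\<And>F F' G G' a b. (F, F') \<in> A \<Longrightarrow> (G, G') \<in> A \<Longrightarrow>
      ((\<lambda>x. a * F x + b * G x), (\<lambda>x. a * F' x + b * G' x)) \<in> A"
    and inv: "\<And>F F' t. (F, F') \<in> A \<Longrightarrow> (V t F, V t F') \<in> A"
begin

text \<open>For (F, F') in A, invariance lets the adjoint relation be used at every V s F: the
  derivative of <V s F, G> is <V s F', G> = <V s F, H>. Thus <F, (V h G - G) / h + H> is at most
  ||F|| times the oscillation of V s H near s = 0, uniformly in F, and
  \<open>l2_norm_le_dense\<close> concludes.\<close>

lemma adjoint_subset_generator:
  assumes GH: "(G, H) \<in> l2_adjoint M A"
  shows "(G, \<lambda>x. - H x) \<in> l2_generator M V"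
proof -
  note [simp] = l2_adjointD(1,2)[OF GH] unitary_l2[OF group]
  have "\<forall>\<^sub>F h in at 0. l2_norm M (\<lambda>x. (V h G x - G x) / of_real h + H x) \<le> e" if e: "e > 0" for e
  proof -
    have "\<forall>\<^sub>F s in at 0. l2_norm M (\<lambda>x. V s H x - H x) < e"
      using order_tendstoD(2)[OF unitary_cont_0[OF group, of H] e] by simp
    then obtain d where d: "d > 0" "\<And>s. s \<noteq> 0 \<Longrightarrow> \<bar>s\<bar> < d \<Longrightarrow> l2_norm M (\<lambda>x. V s H x - H x) < e"
      by (auto simp: eventually_at dist_real_def)
    \<comment> \<open>The limit at 0 says nothing about s = 0 itself, but the derivative bound below
      is needed on the whole ball.\<close>
    have "l2_norm M (\<lambda>x. V 0 H x - H x) = l2_norm M (\<lambda>x. 0)"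
      using unitary_zero[OF group, of H] by (intro l2_norm_cong_AE) auto
    then have d': "l2_norm M (\<lambda>x. V s H x - H x) \<le> e" if "\<bar>s\<bar> < d" for s
      using d(2)[of s] that e by (cases "s = 0") auto
    have "l2_norm M (\<lambda>x. (V h G x - G x) / of_real h + H x) \<le> e" if h: "h \<noteq> 0" "\<bar>h\<bar> < d" for h
    proof (rule l2_norm_le_dense[where D = "Domain A"])
      show "Domain A \<subseteq> l2_functions M" using sub l2_generatorD(1) by fast
      fix F assume "F \<in> Domain A"
      then obtain F' where F': "(F, F') \<in> A" by blast
      then have [simp]: "F \<in> l2_functions M" using sub l2_generatorD(1) by fast
      \<comment> \<open>The linear term is subtracted so that the derivative is <F, V (- s) H - H>,
        which is small. The increment is taken from 0 to - h because V h in the second slot is V (-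
        h) in the first.\<close>
      define \<psi> where "\<psi> = (\<lambda>s. l2_inner M (V s F) G - of_real s * l2_inner M F H)"
      have deriv: "(\<psi> has_vector_derivative (l2_inner M (V s F) H - l2_inner M F H)) (at s)" for s
      proof -
        have "((\<lambda>s. l2_inner M (V s F) G) has_vector_derivative l2_inner M (V s F') G) (at s)"
          using inv[OF F'] sub by (intro has_vector_derivative_inner_orbit[OF group]) auto
        moreover have "l2_inner M (V s F') G = l2_inner M (V s F) H"
          by (rule l2_adjointD(3)[OF GH inv[OF F']])
        ultimately show ?thesis
          unfolding \<psi>_def by (auto intro!: derivative_eq_intros)
      qed
      have "norm (\<psi> (- h) - \<psi> 0) \<le> (l2_norm M F * e) * norm (- h - 0)"
      proof (rule differentiable_bound)
        show "convex (ball (0::real) d)" "- h \<in> ball 0 d" "0 \<in> ball (0::real) d" using h d(1) by auto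
        fix s assume "s \<in> ball (0::real) d"
        then have s: "\<bar>s\<bar> < d" by simp
        show "(\<psi> has_derivative (\<lambda>x. x *\<^sub>R (l2_inner M (V s F) H - l2_inner M F H))) (at s within ball 0 d)"
          using deriv[of s] by (simp add: has_vector_derivative_def has_derivative_at_withinI)
        have "l2_inner M (V s F) H - l2_inner M F H = l2_inner M F (\<lambda>x. V (- s) H x - H x)"
          by (simp add: l2_inner_linear unitary_inner_adjoint[OF group])
        then have "norm (l2_inner M (V s F) H - l2_inner M F H) \<le> l2_norm M F * l2_norm M (\<lambda>x. V (- s) H x - H x)"
          by (simp add: l2_Cauchy_Schwarz)
        also have "\<dots> \<le> l2_norm M F * e" using d'[of "- s"] s by (intro mult_left_mono) auto
        finally show "onorm (\<lambda>x. x *\<^sub>R (l2_inner M (V s F) H - l2_inner M F H)) \<le> l2_norm M F * e"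
          by (simp add: onorm_scaleR_left onorm_id bounded_linear_ident)
      qed
      moreover have "l2_inner M F (\<lambda>x. (V h G x - G x) / of_real h + H x) = (\<psi> (- h) - \<psi> 0) / of_real h"
      proof -
        have "l2_inner M (V 0 F) G = l2_inner M F G"
          using unitary_zero[OF group, of F] by (intro l2_inner_cong_AE) auto
        then have "(\<psi> (- h) - \<psi> 0) / of_real h =
            (l2_inner M F (V h G) - l2_inner M F G) / of_real h + l2_inner M F H"
          using h by (simp add: \<psi>_def unitary_inner_adjoint[OF group] field_simps)
        then show ?thesis by (simp add: l2_inner_linear)
      qed
      ultimately show "norm (l2_inner M F (\<lambda>x. (V h G x - G x) / of_real h + H x)) \<le> e * l2_norm M F"
        using h by (simp only:) (simp add: norm_divide field_simps)
    qed (use e dense in \<open>auto simp: l2_densely_defined_def\<close>)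
    then show ?thesis using d(1) by (auto simp: eventually_at dist_real_def)
  qed
  note bound = this
  have "((\<lambda>h. l2_norm M (\<lambda>x. (V h G x - G x) / of_real h + H x)) \<longlongrightarrow> 0) (at 0)"
  proof (rule tendstoI)
    fix e :: real assume "e > 0"
    then show "\<forall>\<^sub>F h in at 0. dist (l2_norm M (\<lambda>x. (V h G x - G x) / of_real h + H x)) 0 < e"
      using bound[of "e / 2"] by (auto elim!: eventually_mono)
  qed
  then show ?thesis by (simp add: l2_generator_def)
qed

text \<open>Since \<open>A\<close> is dissipative, it suffices that \<open>1 - A\<close> has dense range. An approximate
  preimage of \<open>g\<close> is a truncation of the resolvent series
  \<open>h * (\<Sum>j. (1 + h) ^ - (j + 1) * V (j * h) g)\<close> of the difference quotient \<open>(V h - 1) / h\<close>.\<close>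

lemma dense_range_resolvent_series:
  assumes g: "(g, g') \<in> A" and h: "h > 0"
  defines "q \<equiv> 1 / (1 + h)"
  shows "\<exists>(u, u')\<in>A. l2_norm M (\<lambda>x. u x - u' x - g x + of_real (q ^ n) * V (real n * h) g x)
    \<le> (1 - q ^ n) * l2_norm M (\<lambda>x. (V h g x - g x) / of_real h - g' x)"
proof (induction n)
  have [simp]: "g \<in> l2_functions M" "g' \<in> l2_functions M" using g sub l2_generatorD by fast+
  note [simp] = unitary_l2[OF group]
  let ?d = "l2_norm M (\<lambda>x. (V h g x - g x) / of_real h - g' x)"
  {
    case 0
    have "((\<lambda>x. 0), (\<lambda>x. 0)) \<in> A" using lin[OF g g, of 0 0] by simp
    moreover have "l2_norm M (\<lambda>x. 0 - 0 - g x + of_real (q ^ 0) * V (real 0 * h) g x) = l2_norm M (\<lambda>x. 0)"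
      using unitary_zero[OF group, of g] by (intro l2_norm_cong_AE) auto
    ultimately show ?case by (intro bexI[of _ "(\<lambda>x. 0, \<lambda>x. 0)"]) auto
  next
    case (Suc n)
    then obtain u u' where u: "(u, u') \<in> A"
      and le: "l2_norm M (\<lambda>x. u x - u' x - g x + of_real (q ^ n) * V (real n * h) g x) \<le> (1 - q ^ n) * ?d"
      by blast
    have [simp]: "u \<in> l2_functions M" "u' \<in> l2_functions M" using u sub l2_generatorD by fast+
    define t where "t = real n * h"
    define r where "r = complex_of_real (q ^ Suc n)"
    have q: "q > 0" "q ^ n = (1 + h) * q ^ Suc n" using h by (auto simp: q_def)
    \<comment> \<open>The next term of the series is added. As q^n = (1 + h) q^(n+1), the old
      remainder term splits so that the residual changes only by r h V t applied to (V h g - g) / h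
      - g', of norm q^(n+1) h \<open>?d\<close>.\<close>
    define w where "w = (\<lambda>x. 1 * u x + (r * of_real h) * V t g x)"
    define w' where "w' = (\<lambda>x. 1 * u' x + (r * of_real h) * V t g' x)"
    have w: "(w, w') \<in> A" unfolding w_def w'_def by (intro lin u inv g)
    have [simp]: "w \<in> l2_functions M" "w' \<in> l2_functions M" using w sub l2_generatorD by fast+
    have "AE x in M. V (real (Suc n) * h) g x = V t (V h g) x"
      using unitary_add[OF group, of g t h] by (simp add: t_def algebra_simps)
    then have "l2_norm M (\<lambda>x. w x - w' x - g x + of_real (q ^ Suc n) * V (real (Suc n) * h) g x) =
        l2_norm M (\<lambda>x. (u x - u' x - g x + of_real (q ^ n) * V t g x) +
          (r * V t (V h g) x + (- r) * V t g x + (- r * of_real h) * V t g' x))"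
      by (intro l2_norm_cong_AE)
        (auto elim!: AE_mp simp: w_def w'_def q(2) algebra_simps simp flip: r_def simp del: power_Suc of_real_power)
    also have "\<dots> \<le> (1 - q ^ n) * ?d +
        l2_norm M (\<lambda>x. r * V t (V h g) x + (- r) * V t g x + (- r * of_real h) * V t g' x)"
      by (rule order_trans[OF l2_norm_triangle add_mono[OF le[folded t_def] order_refl]]) auto
    also have "l2_norm M (\<lambda>x. r * V t (V h g) x + (- r) * V t g x + (- r * of_real h) * V t g' x) =
        l2_norm M (\<lambda>x. r * V h g x + (- r) * g x + (- r * of_real h) * g' x)"
      by (rule unitary_norm_linear3[OF group]) auto
    also have "\<dots> = l2_norm M (\<lambda>x. (r * of_real h) * ((V h g x - g x) / of_real h - g' x))"
      using h by (intro arg_cong[of _ _ "l2_norm M"] ext) (simp add: field_simps)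
    also have "\<dots> = q ^ Suc n * h * ?d"
      using h q(1) by (simp add: l2_norm_scale norm_mult r_def norm_power del: power_Suc)
    \<comment> \<open>The errors telescope to 1 - q^(n+1), so they stay below \<open>?d\<close>
      however many terms are taken.\<close>
    also have "(1 - q ^ n) * ?d + q ^ Suc n * h * ?d = (1 - q ^ Suc n) * ?d"
      by (simp add: q(2) algebra_simps del: power_Suc)
    finally show ?case using w by blast
  }
qed

text \<open>Three errors, each below e/3: replacing G by g in the domain, replacing the generator by
  its quotient with step h, and truncating the series. The second bound is uniform in n, so h is
  fixed first and n chosen afterwards.\<close>

lemma dense_range:
  assumes G: "G \<in> l2_functions M" and e: "e > 0"
  shows "\<exists>(u, u')\<in>A. l2_norm M (\<lambda>x. u x - u' x - G x) < e"
proof -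
  note [simp] = unitary_l2[OF group] G
  obtain g g' where g: "(g, g') \<in> A" and gG: "l2_norm M (\<lambda>x. G x - g x) < e / 3"
    using dense e G unfolding l2_densely_defined_def by (meson DomainE divide_pos_pos zero_less_numeral)
  have [simp]: "g \<in> l2_functions M" "g' \<in> l2_functions M" using g sub l2_generatorD by fast+
  have "((\<lambda>h. l2_norm M (\<lambda>x. (V h g x - g x) / of_real h - g' x)) \<longlongrightarrow> 0) (at_right 0)"
    using g sub l2_generatorD(3) by (blast intro: filterlim_mono at_le)
  then have "\<forall>\<^sub>F h in at_right 0. l2_norm M (\<lambda>x. (V h g x - g x) / of_real h - g' x) < e / 3"
    using e by (intro order_tendstoD(2)) auto
  from eventually_happens'[OF _ eventually_conj[OF eventually_at_right_less[of 0] this]]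
  obtain h where h: "h > 0" "l2_norm M (\<lambda>x. (V h g x - g x) / of_real h - g' x) < e / 3"
    by auto
  define q where "q = 1 / (1 + h)"
  have q: "0 < q" "q < 1" using h by (auto simp: q_def)
  then have "(\<lambda>n. q ^ n * l2_norm M g) \<longlonglongrightarrow> 0 * l2_norm M g"
    by (intro tendsto_mult LIMSEQ_realpow_zero tendsto_const) auto
  then have "\<forall>\<^sub>F n in sequentially. q ^ n * l2_norm M g < e / 3"
    using e by (intro order_tendstoD(2)) auto
  then obtain n where n: "q ^ n * l2_norm M g < e / 3" by (auto simp: eventually_sequentially)
  obtain u u' where u: "(u, u') \<in> A"
    and le: "l2_norm M (\<lambda>x. u x - u' x - g x + of_real (q ^ n) * V (real n * h) g x)
      \<le> (1 - q ^ n) * l2_norm M (\<lambda>x. (V h g x - g x) / of_real h - g' x)"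
    using dense_range_resolvent_series[OF g h(1), of n] unfolding q_def by blast
  have [simp]: "u \<in> l2_functions M" "u' \<in> l2_functions M" using u sub l2_generatorD by fast+
  let ?v = "\<lambda>x. of_real (q ^ n) * V (real n * h) g x"
  have "l2_norm M (\<lambda>x. u x - u' x - G x) =
      l2_norm M (\<lambda>x. (u x - u' x - g x + ?v x) + ((- 1) * ?v x + (- 1) * (G x - g x)))"
    by (intro arg_cong[of _ _ "l2_norm M"] ext) (simp add: algebra_simps)
  also have "\<dots> \<le> l2_norm M (\<lambda>x. u x - u' x - g x + ?v x) +
      (l2_norm M (\<lambda>x. (- 1) * ?v x) + l2_norm M (\<lambda>x. (- 1) * (G x - g x)))"
    by (rule order_trans[OF l2_norm_triangle add_mono[OF order_refl l2_norm_triangle]]) auto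
  also have "l2_norm M (\<lambda>x. (- 1) * ?v x) = q ^ n * l2_norm M g"
    using q by (subst l2_norm_scale, subst l2_norm_scale) (simp add: unitary_norm[OF group] norm_power)
  also have "l2_norm M (\<lambda>x. (- 1) * (G x - g x)) = l2_norm M (\<lambda>x. G x - g x)"
    by (subst l2_norm_scale) simp
  finally have "l2_norm M (\<lambda>x. u x - u' x - G x) \<le> l2_norm M (\<lambda>x. u x - u' x - g x + ?v x) +
      (q ^ n * l2_norm M g + l2_norm M (\<lambda>x. G x - g x))" .
  moreover have "(1 - q ^ n) * l2_norm M (\<lambda>x. (V h g x - g x) / of_real h - g' x)
      \<le> 1 * l2_norm M (\<lambda>x. (V h g x - g x) / of_real h - g' x)"
    using q by (intro mult_right_mono) auto
  ultimately have "l2_norm M (\<lambda>x. u x - u' x - G x) < e"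
    using le n h(2) gG by linarith
  then show ?thesis using u by blast
qed

text \<open>For a skew-symmetric operator the cross terms in the square of z - Bz cancel, here with
  z = F - G. Convergence of z - Bz therefore forces convergence of z and of Bz separately.\<close>

lemma graph_norm_skew:
  assumes 1: "(F, F') \<in> l2_generator M V" and 2: "(G, G') \<in> l2_generator M V"
  shows "(l2_norm M (\<lambda>x. F x - G x))\<^sup>2 + (l2_norm M (\<lambda>x. F' x - G' x))\<^sup>2 =
    (l2_norm M (\<lambda>x. (F x - F' x) - (G x - G' x)))\<^sup>2"
proof -
  note [simp] = l2_generatorD(1,2)[OF 1] l2_generatorD(1,2)[OF 2]
  note skew = generator_skew_symmetric[OF group]
  have "complex_of_real ((l2_norm M (\<lambda>x. (F x - F' x) - (G x - G' x)))\<^sup>2) =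
      of_real ((l2_norm M (\<lambda>x. F x - G x))\<^sup>2 + (l2_norm M (\<lambda>x. F' x - G' x))\<^sup>2)"
    unfolding of_real_add l2_inner_self[symmetric]
    by (simp add: l2_inner_linear skew[OF 1 1] skew[OF 1 2] skew[OF 2 1] skew[OF 2 2])
  then show ?thesis by (metis of_real_eq_iff)
qed

text \<open>Dense range supplies pairs in A whose differences u - u' approach F - G; by
  \<open>graph_norm_skew\<close> both components then converge.\<close>

lemma generator_subset_closure: "l2_generator M V \<subseteq> l2_closure M A"
proof (clarify)
  fix F G assume FG: "(F, G) \<in> l2_generator M V"
  note [simp] = l2_generatorD(1,2)[OF FG]
  have "\<exists>p\<in>A. l2_norm M (\<lambda>x. fst p x - snd p x - (F x - G x)) < inverse (real (Suc n))" for n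
    using dense_range[of "\<lambda>x. F x - G x" "inverse (real (Suc n))"] by (auto simp: split_def)
  then obtain p where p: "\<And>n. p n \<in> A"
    "\<And>n. l2_norm M (\<lambda>x. fst (p n) x - snd (p n) x - (F x - G x)) < inverse (real (Suc n))"
    by metis
  have le: "l2_norm M (\<lambda>x. fst (p n) x - F x) \<le> inverse (real (Suc n)) \<and>
      l2_norm M (\<lambda>x. snd (p n) x - G x) \<le> inverse (real (Suc n))" for n
  proof -
    have "(fst (p n), snd (p n)) \<in> l2_generator M V" using p(1) sub by auto
    from graph_norm_skew[OF this FG]
    have eq: "(l2_norm M (\<lambda>x. fst (p n) x - F x))\<^sup>2 + (l2_norm M (\<lambda>x. snd (p n) x - G x))\<^sup>2 =
      (l2_norm M (\<lambda>x. fst (p n) x - snd (p n) x - (F x - G x)))\<^sup>2" .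
    have "(l2_norm M (\<lambda>x. fst (p n) x - snd (p n) x - (F x - G x)))\<^sup>2 \<le> (inverse (real (Suc n)))\<^sup>2"
      using p(2)[of n] by (intro power_mono) auto
    then show ?thesis unfolding eq[symmetric] by (intro sum_squares_le_square) auto
  qed
  have "(\<lambda>n. l2_norm M (\<lambda>x. fst (p n) x - F x)) \<longlonglongrightarrow> 0" "(\<lambda>n. l2_norm M (\<lambda>x. snd (p n) x - G x)) \<longlonglongrightarrow> 0"
    using le by (intro Lim_null_comparison[OF _ LIMSEQ_inverse_real_of_nat] always_eventually allI; simp)+
  then show "(F, G) \<in> l2_closure M A"
    unfolding l2_closure_def
    by (intro CollectI case_prodI conjI exI[of _ "\<lambda>n. fst (p n)"] exI[of _ "\<lambda>n. snd (p n)"])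
      (simp_all add: p(1))
qed

text \<open>The skew symmetry of A against A passes to the limit in the second slot.\<close>

lemma minus_closure_subset_adjoint:
  assumes "(F, G) \<in> l2_closure M A"
  shows "(F, \<lambda>x. - G x) \<in> l2_adjoint M A"
proof -
  obtain f g where fg: "\<And>n. (f n, g n) \<in> A" "(\<lambda>n. l2_norm M (\<lambda>x. f n x - F x)) \<longlonglongrightarrow> 0"
      "(\<lambda>n. l2_norm M (\<lambda>x. g n x - G x)) \<longlonglongrightarrow> 0"
    and [simp]: "F \<in> l2_functions M" "G \<in> l2_functions M"
    using assms by (auto simp: l2_closure_def)
  have [simp]: "f n \<in> l2_functions M" "g n \<in> l2_functions M" for n
    using fg(1) sub l2_generatorD by fast+
  have "l2_inner M K' F = l2_inner M K (\<lambda>x. - G x)" if K: "(K, K') \<in> A" for K K'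
  proof -
    have [simp]: "K \<in> l2_functions M" "K' \<in> l2_functions M" using K sub l2_generatorD by fast+
    have "(\<lambda>n. l2_inner M K' (f n)) \<longlonglongrightarrow> l2_inner M K' F"
      by (rule tendsto_l2_inner) (use fg(2) in auto)
    moreover have "(\<lambda>n. - l2_inner M K (g n)) \<longlonglongrightarrow> - l2_inner M K G"
      by (rule tendsto_minus, rule tendsto_l2_inner) (use fg(3) in auto)
    moreover have "l2_inner M K' (f n) = - l2_inner M K (g n)" for n
      using K fg(1) sub by (intro generator_skew_symmetric[OF group]) auto
    ultimately show ?thesis using LIMSEQ_unique by (simp add: l2_inner_linear)
  qed
  then show ?thesis by (auto simp: l2_adjoint_def)
qed

text \<open>The first inclusion passes through the adjoint: the closure lies in minus A*, and A* in
  minus the generator, so the signs cancel.\<close>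

lemma closure_eq_generator: "l2_closure M A = l2_generator M V"
proof
  show "l2_closure M A \<subseteq> l2_generator M V"
    using adjoint_subset_generator[OF minus_closure_subset_adjoint] by auto
qed (rule generator_subset_closure)

text \<open>Adjoints reverse inclusions, so the adjoint of the generator lies in A*, hence in minus
  the generator; the converse is skew symmetry.\<close>

lemma essentially_skew_adjoint: "l2_essentially_skew_adjoint M A"
proof -
  have "A \<subseteq> l2_generator M V" by (rule sub)
  then have dense': "l2_densely_defined M (l2_generator M V)"
    using dense unfolding l2_densely_defined_def by (meson Domain_mono subsetD)
  have "l2_adjoint M (l2_generator M V) = {(F, \<lambda>x. - G x) | F G. (F, G) \<in> l2_generator M V}"
  proof (intro equalityI subsetI)
    fix p assume p: "p \<in> l2_adjoint M (l2_generator M V)"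
    obtain G H where [simp]: "p = (G, H)" by fastforce
    have "(G, H) \<in> l2_adjoint M A" using p sub by (auto simp: l2_adjoint_def)
    from adjoint_subset_generator[OF this]
    show "p \<in> {(F, \<lambda>x. - G x) | F G. (F, G) \<in> l2_generator M V}"
      by (auto intro!: exI[of _ "\<lambda>x. - H x"])
  next
    fix p assume "p \<in> {(F, \<lambda>x. - G x) | F G. (F, G) \<in> l2_generator M V}"
    then obtain F G where [simp]: "p = (F, \<lambda>x. - G x)" and FG: "(F, G) \<in> l2_generator M V" by auto
    show "p \<in> l2_adjoint M (l2_generator M V)"
      using l2_generatorD(1,2)[OF FG] generator_skew_symmetric[OF group _ FG]
      by (auto simp: l2_adjoint_def l2_inner_linear)
  qed
  with dense dense' show ?thesis
    by (simp add: l2_essentially_skew_adjoint_def l2_skew_adjoint_def closure_eq_generator)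
qed

end

text \<open>On the common domain <U t f, V t f> has zero derivative, so it equals ||f||^2; with both
  groups isometric, expanding ||U t f - V t f||^2 gives 0. Density and isometry extend this to every
  F.\<close>

lemma unitary_group_unique:
  assumes U: "l2_unitary_group M U" and V: "l2_unitary_group M V"
    and eq: "l2_generator M U = l2_generator M V"
    and dense: "l2_densely_defined M (l2_generator M V)"
    and F: "F \<in> l2_functions M"
  shows "AE x in M. U t F x = V t F x"
proof -
  note [simp] = unitary_l2[OF U] unitary_l2[OF V] F
  have on_domain: "l2_norm M (\<lambda>x. U t f x - V t f x) = 0" if f: "(f, g) \<in> l2_generator M V" for f g
  proof -
    note [simp] = l2_generatorD(1,2)[OF f]
    define \<phi> where "\<phi> = (\<lambda>t. l2_inner M (U t f) (V t f))"
    have "(\<phi> has_vector_derivative 0) (at s)" for s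
      unfolding has_vector_derivative_at_iff_quotient
    proof -
      have 1: "(U s f, U s g) \<in> l2_generator M U" using f by (intro generator_invariant[OF U]) (simp add: eq)
      have 2: "(V s f, V s g) \<in> l2_generator M V" using f by (intro generator_invariant[OF V])
      have cont: "((\<lambda>h. l2_norm M (\<lambda>x. V h (V s f) x - V s f x)) \<longlongrightarrow> 0) (at 0)"
        by (rule unitary_cont_0[OF V]) simp
      \<comment> \<open>Product rule for the pairing: the first quotient is tested against the
        already moved vector V h (V s f), hence the appeal to strong continuity.\<close>
      have "((\<lambda>h. l2_inner M (\<lambda>x. (U h (U s f) x - U s f x) / of_real h) (V h (V s f)) +
            l2_inner M (U s f) (\<lambda>x. (V h (V s f) x - V s f x) / of_real h)) \<longlongrightarrow>
          l2_inner M (U s g) (V s f) + l2_inner M (U s f) (V s g)) (at 0)"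
        by (intro tendsto_add tendsto_l2_inner l2_generatorD(3)[OF 1] l2_generatorD(3)[OF 2] cont) auto
      \<comment> \<open>U s f lies in the generator of U, which is that of V, so skew symmetry
        applies across the two groups.\<close>
      moreover have "l2_inner M (U s g) (V s f) + l2_inner M (U s f) (V s g) = 0"
        using generator_skew_symmetric[OF V _ 2, of "U s f" "U s g"] 1 by (simp add: eq)
      moreover have "l2_inner M (\<lambda>x. (U h (U s f) x - U s f x) / of_real h) (V h (V s f)) +
            l2_inner M (U s f) (\<lambda>x. (V h (V s f) x - V s f x) / of_real h) = (\<phi> (s + h) - \<phi> s) /\<^sub>R h" for h
      proof -
        have "\<phi> (s + h) = l2_inner M (U h (U s f)) (V h (V s f))"
          unfolding \<phi>_def using unitary_add[OF U, of f h s] unitary_add[OF V, of f h s]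
          by (intro l2_inner_cong_AE) (auto simp: add.commute)
        then show ?thesis
          by (simp add: \<phi>_def l2_inner_linear scaleR_conv_of_real divide_inverse algebra_simps)
      qed
      ultimately show "((\<lambda>h. (\<phi> (s + h) - \<phi> s) /\<^sub>R h) \<longlongrightarrow> 0) (at 0)" by simp
    qed
    then have "\<phi> t = \<phi> 0"
      by (intro has_derivative_zero_unique[of UNIV \<phi>]) (auto simp: has_vector_derivative_def)
    also have "\<phi> 0 = l2_inner M f f"
      unfolding \<phi>_def using unitary_zero[OF U, of f] unitary_zero[OF V, of f] by (intro l2_inner_cong_AE) auto
    finally have \<phi>: "l2_inner M (U t f) (V t f) = l2_inner M f f" by (simp add: \<phi>_def)
    moreover have "l2_inner M (V t f) (U t f) = l2_inner M f f"
      using \<phi> l2_inner_commute[of M "V t f" "U t f"] l2_inner_commute[of M f f] by simp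
    ultimately have "l2_inner M (\<lambda>x. U t f x - V t f x) (\<lambda>x. U t f x - V t f x) = 0"
      by (simp add: l2_inner_linear unitary_inner[OF U] unitary_inner[OF V])
    then show ?thesis by (simp add: l2_inner_self)
  qed
  have "l2_norm M (\<lambda>x. U t F x - V t F x) \<le> 0 + e" if e: "e > 0" for e
  proof -
    obtain f where f: "f \<in> Domain (l2_generator M V)" "l2_norm M (\<lambda>x. F x - f x) < e / 2"
      using dense F e unfolding l2_densely_defined_def by (meson half_gt_zero)
    then have [simp]: "f \<in> l2_functions M" using l2_generatorD(1) by fast
    have isom: "l2_norm M (\<lambda>x. W t F x - W t f x) = l2_norm M (\<lambda>x. F x - f x)"
      if W: "l2_unitary_group M W" for W
      using unitary_norm_linear3[OF W, of F f f 1 t "- 1" 0] by simp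
    have "l2_norm M (\<lambda>x. U t F x - V t F x) \<le> l2_norm M (\<lambda>x. U t F x - U t f x) +
        l2_norm M (\<lambda>x. U t f x - V t F x)"
      by (rule l2_norm_triangle_diff) auto
    also have "l2_norm M (\<lambda>x. U t f x - V t F x) \<le> l2_norm M (\<lambda>x. U t f x - V t f x) +
        l2_norm M (\<lambda>x. V t f x - V t F x)"
      by (rule l2_norm_triangle_diff) auto
    finally show ?thesis
      using f on_domain by (auto simp: isom[OF U] isom[OF V] l2_norm_minus_commute[of M "V t f"])
  qed
  then have "l2_norm M (\<lambda>x. U t F x - V t F x) \<le> 0" by (rule field_le_epsilon)
  then have "l2_norm M (\<lambda>x. U t F x - V t F x) = 0"
    using l2_norm_nonneg[of M "\<lambda>x. U t F x - V t F x"] by linarith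
  then show ?thesis using l2_norm_eq_0_AE[of "\<lambda>x. U t F x - V t F x" M] by auto
qed

section \<open>Smooth functions on the line\<close>

text \<open>A coinduction principle: S acts as an invariant preserved by differentiation, so all
  iterated derivatives stay in S and are differentiable.\<close>

lemma smooth_functionI:
  assumes "f \<in> S"
    and "\<And>g r. g \<in> S \<Longrightarrow> g differentiable (at r)"
    and "\<And>g. g \<in> S \<Longrightarrow> (\<lambda>s. vector_derivative g (at s)) \<in> S"
  shows "smooth_function f"
proof -
  have "((\<lambda>g s. vector_derivative g (at s)) ^^ n) f \<in> S" for n
    by (induction n) (use assms in auto)
  then show ?thesis using assms(2) by (auto simp: smooth_function_def)
qed

lemma smooth_differentiable: "smooth_function f \<Longrightarrow> f differentiable (at r)"
  unfolding smooth_function_def by (metis funpow_0)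

lemma smooth_has_vector_derivative:
  "smooth_function f \<Longrightarrow> (f has_vector_derivative vector_derivative f (at r)) (at r)"
  using smooth_differentiable vector_derivative_works by blast

lemma smooth_vector_derivative: "smooth_function f \<Longrightarrow> smooth_function (\<lambda>s. vector_derivative f (at s))"
  unfolding smooth_function_def by (metis funpow_Suc_right o_apply)

lemma smooth_continuous: "smooth_function f \<Longrightarrow> continuous_on S f"
  by (meson continuous_at_imp_continuous_on differentiable_imp_continuous_within smooth_differentiable)

text \<open>The functions \<open>poly p (1 / x) * exp (- 1 / x)\<close> form a class closed under differentiation.\<close>

definition flat_function :: "real poly \<Rightarrow> real \<Rightarrow> real" where
  "flat_function p x = (if x > 0 then poly p (1 / x) * exp (- (1 / x)) else 0)"

lemma poly_times_exp_minus_tendsto_0: "((\<lambda>y::real. poly p y * exp (- y)) \<longlongrightarrow> 0) at_top"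
proof -
  have "((\<lambda>y::real. \<Sum>i\<le>degree p. coeff p i * (y ^ i / exp y)) \<longlongrightarrow> (\<Sum>i\<le>degree p. coeff p i * 0)) at_top"
    by (intro tendsto_sum tendsto_mult tendsto_const tendsto_power_div_exp_0)
  moreover have "(\<lambda>y::real. poly p y * exp (- y)) = (\<lambda>y. \<Sum>i\<le>degree p. coeff p i * (y ^ i / exp y))"
    by (simp add: poly_altdef sum_distrib_right exp_minus divide_inverse mult.assoc)
  ultimately show ?thesis by simp
qed

text \<open>The polynomial is X^2 (p - p'), from the chain rule with y = 1/x and dy/dx = - y^2. At 0
  the right-hand quotient is y p(y) e^(-y) as y tends to infinity, which vanishes in the
  limit.\<close>

lemma flat_function_has_derivative:
  "(flat_function p has_real_derivative flat_function (pCons 0 (pCons 0 (p - pderiv p))) x) (at x)"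
proof -
  consider "x > 0" | "x < 0" | "x = 0" by linarith
  then show ?thesis
  proof cases
    case 1
    have "((\<lambda>x. poly p (1 / x) * exp (- (1 / x))) has_real_derivative
        flat_function (pCons 0 (pCons 0 (p - pderiv p))) x) (at x)"
      using 1 by (auto intro!: derivative_eq_intros DERIV_chain'[OF _ poly_DERIV]
          simp: flat_function_def field_simps power2_eq_square)
    then show ?thesis
      by (rule has_field_derivative_transform_within_open[where S = "{0<..}"])
        (use 1 in \<open>auto simp: flat_function_def\<close>)
  next
    case 2
    have "((\<lambda>x. 0) has_real_derivative flat_function (pCons 0 (pCons 0 (p - pderiv p))) x) (at x)"
      using 2 by (simp add: flat_function_def)
    then show ?thesis
      by (rule has_field_derivative_transform_within_open[where S = "{..<0}"])
        (use 2 in \<open>auto simp: flat_function_def\<close>)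
  next
    case 3
    have "((\<lambda>h. flat_function p h / h) \<longlongrightarrow> 0) (at_left 0)"
      by (rule Lim_transform_eventually[OF tendsto_const])
        (auto simp: flat_function_def eventually_at_filter)
    moreover have "((\<lambda>h. flat_function p h / h) \<longlongrightarrow> 0) (at_right 0)"
    proof (rule Lim_transform_eventually)
      show "((\<lambda>h. poly (pCons 0 p) (inverse h) * exp (- inverse h)) \<longlongrightarrow> 0) (at_right (0::real))"
        by (rule filterlim_compose[OF poly_times_exp_minus_tendsto_0 filterlim_inverse_at_top_right])
    qed (auto simp: flat_function_def eventually_at_filter divide_inverse mult_ac)
    ultimately have "((\<lambda>h. flat_function p h / h) \<longlongrightarrow> 0) (at 0)"
      by (simp add: filterlim_at_split)
    then show ?thesis by (simp add: 3 DERIV_def flat_function_def)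
  qed
qed

text \<open>Differentiation maps each constructor back into the class, so by coinduction every
  member is smooth. All closure properties of smooth functions then come at once, without formulas
  for higher derivatives.\<close>

inductive_set smooth_algebra :: "(real \<Rightarrow> complex) set" where
  smooth: "smooth_function f \<Longrightarrow> f \<in> smooth_algebra"
| flat: "(\<lambda>x. of_real (flat_function p x)) \<in> smooth_algebra"
| const: "(\<lambda>x. c) \<in> smooth_algebra"
| ident: "of_real \<in> smooth_algebra"
| add: "f \<in> smooth_algebra \<Longrightarrow> g \<in> smooth_algebra \<Longrightarrow> (\<lambda>x. f x + g x) \<in> smooth_algebra"
| mult: "f \<in> smooth_algebra \<Longrightarrow> g \<in> smooth_algebra \<Longrightarrow> (\<lambda>x. f x * g x) \<in> smooth_algebra"
| affine: "f \<in> smooth_algebra \<Longrightarrow> (\<lambda>x. f (a * x + b)) \<in> smooth_algebra"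

lemma smooth_algebra_derivative:
  assumes "f \<in> smooth_algebra"
  shows "\<exists>f'\<in>smooth_algebra. \<forall>x. (f has_vector_derivative f' x) (at x)"
  using assms
proof induction
  case (smooth f)
  show ?case
    by (intro bexI[OF _ smooth_algebra.smooth[OF smooth_vector_derivative[OF smooth]]] allI
        smooth_has_vector_derivative[OF smooth])
next
  case (flat p)
  show ?case
    by (intro bexI[OF _ smooth_algebra.flat[of "pCons 0 (pCons 0 (p - pderiv p))"]] allI
        has_vector_derivative_of_real flat_function_has_derivative)
next
  case (const c)
  show ?case by (intro bexI[OF _ smooth_algebra.const[of 0]]) auto
next
  case ident
  show ?case
    using has_vector_derivative_of_real[OF DERIV_ident] by (intro bexI[OF _ smooth_algebra.const[of 1]]) auto
next
  case (add f g)
  then obtain f' g' where "f' \<in> smooth_algebra" "\<forall>x. (f has_vector_derivative f' x) (at x)"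
    "g' \<in> smooth_algebra" "\<forall>x. (g has_vector_derivative g' x) (at x)" by blast
  then show ?case
    by (intro bexI[of _ "\<lambda>x. f' x + g' x"])
      (auto intro!: smooth_algebra.add has_vector_derivative_add)
next
  case (mult f g)
  then obtain f' g' where "f' \<in> smooth_algebra" "\<forall>x. (f has_vector_derivative f' x) (at x)"
    "g' \<in> smooth_algebra" "\<forall>x. (g has_vector_derivative g' x) (at x)" by blast
  with mult.hyps show ?case
    by (intro bexI[of _ "\<lambda>x. f x * g' x + f' x * g x"])
      (auto intro!: smooth_algebra.add smooth_algebra.mult has_vector_derivative_mult)
next
  case (affine f a b)
  then obtain f' where f': "f' \<in> smooth_algebra" "\<And>x. (f has_vector_derivative f' x) (at x)" by blast
  have "((\<lambda>x. f (a * x + b)) has_vector_derivative of_real a * f' (a * x + b)) (at x)" for x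
  proof -
    have "((\<lambda>x. a * x + b) has_vector_derivative a) (at x)"
      by (auto intro!: derivative_eq_intros)
    from vector_diff_chain_at[OF this f'(2)] show ?thesis
      by (simp add: o_def scaleR_conv_of_real)
  qed
  then show ?case
    using f'(1) by (intro bexI[of _ "\<lambda>x. of_real a * f' (a * x + b)"]) (auto intro!: smooth_algebra.mult smooth_algebra.const smooth_algebra.affine)
qed

lemma smooth_algebra_iff [simp]: "f \<in> smooth_algebra \<longleftrightarrow> smooth_function f"
proof
  assume "f \<in> smooth_algebra"
  then show "smooth_function f"
  proof (rule smooth_functionI)
    fix g :: "real \<Rightarrow> complex" and r assume "g \<in> smooth_algebra"
    then obtain g' where g': "g' \<in> smooth_algebra" "\<And>x. (g has_vector_derivative g' x) (at x)"
      using smooth_algebra_derivative by blast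
    then show "g differentiable (at r)" by (auto intro: differentiableI_vector)
    have "(\<lambda>s. vector_derivative g (at s)) = g'" using g'(2) vector_derivative_at by blast
    then show "(\<lambda>s. vector_derivative g (at s)) \<in> smooth_algebra" using g'(1) by simp
  qed
qed (rule smooth_algebra.smooth)

text \<open>The first rule would become circular and is dropped, so the numbering is: 1 flat
  functions, 2 constants, 3 identity, 4 sums, 5 products, 6 affine substitution.\<close>

lemmas smooth_intros = smooth_algebra.intros(2-)[unfolded smooth_algebra_iff]

text \<open>Trades the compact set for an interval, whose end points behave explicitly under sums
  and dilations. The margins put both end points in the zero set.\<close>

lemma test_functions_posD:
  assumes "f \<in> test_functions_pos"
  shows "smooth_function f" "\<exists>a b. 0 < a \<and> a < b \<and> (\<forall>r. r \<le> a \<or> b \<le> r \<longrightarrow> f r = 0)"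
proof -
  obtain K where K: "smooth_function f" "compact K" "K \<subseteq> {0<..}" "\<And>r. r \<notin> K \<Longrightarrow> f r = 0"
    using assms by (auto simp: test_functions_pos_def)
  show "smooth_function f" by (rule K(1))
  show "\<exists>a b. 0 < a \<and> a < b \<and> (\<forall>r. r \<le> a \<or> b \<le> r \<longrightarrow> f r = 0)"
  proof (cases "K = {}")
    case True
    then show ?thesis using K(4) by (intro exI[of _ 1] exI[of _ 2]) auto
  next
    case False
    obtain m where m: "m \<in> K" "\<And>x. x \<in> K \<Longrightarrow> m \<le> x" using compact_attains_inf[OF K(2) False] by blast
    obtain n where n: "n \<in> K" "\<And>x. x \<in> K \<Longrightarrow> x \<le> n" using compact_attains_sup[OF K(2) False] by blast
    have "m > 0" using m(1) K(3) by auto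
    moreover have "f r = 0" if "r \<le> m / 2 \<or> n + 1 \<le> r" for r
      using K(4)[of r] m(2)[of r] n(2)[of r] \<open>m > 0\<close> that by force
    moreover have "m / 2 < n + 1" using m(2)[OF n(1)] \<open>m > 0\<close> by simp
    ultimately show ?thesis by (intro exI[of _ "m / 2"] exI[of _ "n + 1"]) auto
  qed
qed

lemma test_functions_posI:
  assumes "smooth_function f" "0 < a" "\<And>r. r \<le> a \<or> b \<le> r \<Longrightarrow> f r = 0"
  shows "f \<in> test_functions_pos"
  unfolding test_functions_pos_def using assms
  by (auto intro!: exI[of _ "{a..b}"])

lemma test_functions_pos_add:
  assumes "f \<in> test_functions_pos" "g \<in> test_functions_pos"
  shows "(\<lambda>r. f r + g r) \<in> test_functions_pos"
proof -
  obtain a b where 1: "0 < a" "\<forall>r. r \<le> a \<or> b \<le> r \<longrightarrow> f r = 0" using test_functions_posD[OF assms(1)] by blast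
  obtain c d where 2: "0 < c" "\<forall>r. r \<le> c \<or> d \<le> r \<longrightarrow> g r = 0" using test_functions_posD[OF assms(2)] by blast
  show ?thesis using 1 2 assms[THEN test_functions_posD(1)]
    by (intro test_functions_posI[where a = "min a c" and b = "max b d"] smooth_intros) auto
qed

lemma test_functions_pos_mult:
  assumes "f \<in> test_functions_pos" "smooth_function g"
  shows "(\<lambda>r. g r * f r) \<in> test_functions_pos"
proof -
  obtain a b where 1: "0 < a" "\<forall>r. r \<le> a \<or> b \<le> r \<longrightarrow> f r = 0" using test_functions_posD[OF assms(1)] by blast
  then show ?thesis using assms(2) test_functions_posD(1)[OF assms(1)]
    by (intro test_functions_posI[where a = a and b = b] smooth_intros) auto
qed

lemma test_functions_pos_vector_derivative:
  assumes "f \<in> test_functions_pos"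
  shows "(\<lambda>r. vector_derivative f (at r)) \<in> test_functions_pos"
proof -
  obtain a b where 1: "0 < a" "\<forall>r. r \<le> a \<or> b \<le> r \<longrightarrow> f r = 0" using test_functions_posD[OF assms(1)] by blast
  \<comment> \<open>The interval is widened so that f vanishes on a whole neighbourhood of each such
    r.\<close>
  have "vector_derivative f (at r) = 0" if "r \<le> a / 2 \<or> b + 1 \<le> r" for r
  proof -
    have "((\<lambda>x. 0) has_vector_derivative 0) (at r)" by simp
    then have "(f has_vector_derivative 0) (at r)"
      by (rule has_vector_derivative_transform_within_open[where S = "{..<a} \<union> {b<..}"])
        (use that 1 in auto)
    then show ?thesis by (rule vector_derivative_at)
  qed
  then show ?thesis using 1(1) smooth_vector_derivative test_functions_posD(1)[OF assms]
    by (intro test_functions_posI[where a = "a / 2" and b = "b + 1"]) auto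
qed

lemma test_functions_pos_dilate:
  assumes "f \<in> test_functions_pos" "s > 0"
  shows "(\<lambda>r. f (s * r)) \<in> test_functions_pos"
proof -
  obtain a b where 1: "0 < a" "\<forall>r. r \<le> a \<or> b \<le> r \<longrightarrow> f r = 0" using test_functions_posD[OF assms(1)] by blast
  have "smooth_function (\<lambda>r. f (s * r + 0))"
    by (intro smooth_intros test_functions_posD(1)[OF assms(1)])
  then show ?thesis using 1 assms(2)
    by (intro test_functions_posI[where a = "a / s" and b = "b / s"]) (auto simp: field_simps)
qed

lemma bump_function_exists:
  fixes a b :: real
  assumes "0 < a" "a < b"
  obtains \<beta> :: "real \<Rightarrow> real" where "(\<lambda>r. complex_of_real (\<beta> r)) \<in> test_functions_pos"
    "\<And>r. a < r \<Longrightarrow> r < b \<Longrightarrow> 0 < \<beta> r" "\<And>r. 0 \<le> \<beta> r" "\<And>r. r \<le> a \<or> b \<le> r \<Longrightarrow> \<beta> r = 0"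
proof
  \<comment> \<open>The classical bump exp(-1/(r - a)) exp(-1/(b - r)), with arguments written in
    the shape of the affine substitution rule.\<close>
  define \<beta> where "\<beta> = (\<lambda>r. flat_function 1 (1 * r + (- a)) * flat_function 1 ((- 1) * r + b))"
  show "0 < \<beta> r" if "a < r" "r < b" for r using that by (simp add: \<beta>_def flat_function_def)
  show "0 \<le> \<beta> r" for r by (simp add: \<beta>_def flat_function_def)
  show "\<beta> r = 0" if "r \<le> a \<or> b \<le> r" for r using that by (auto simp: \<beta>_def flat_function_def)
  moreover have "smooth_function (\<lambda>r. complex_of_real (flat_function 1 (1 * r + (- a))) *
      complex_of_real (flat_function 1 ((- 1) * r + b)))"
    by (intro smooth_intros(4-) smooth_intros(6)[where f = "\<lambda>x. of_real (flat_function 1 x)"] smooth_intros(1))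
  ultimately show "(\<lambda>r. complex_of_real (\<beta> r)) \<in> test_functions_pos"
    using assms by (intro test_functions_posI[where a = a and b = b]) (auto simp: \<beta>_def)
qed

section \<open>Polar products and the Euler operator\<close>

lemma differentiable_normalize:
  fixes x :: "'a::real_inner"
  assumes "x \<noteq> 0"
  shows "(\<lambda>x. x /\<^sub>R norm x) differentiable (at x)"
  using assms by (intro differentiable_scaleR differentiable_inverse differentiable_norm_at differentiable_ident) auto

lemma polar_product_scaleR:
  assumes "s > 0"
  shows "polar_product p f (s *\<^sub>R x) = polar_product p (\<lambda>r. f (s * r)) x"
proof -
  have "(s *\<^sub>R x) /\<^sub>R norm (s *\<^sub>R x) = x /\<^sub>R norm x" using assms by simp
  then show ?thesis using assms unfolding polar_product_def by (simp only:) simp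
qed

lemma polar_product_differentiable:
  fixes x :: "real^'n"
  assumes p: "polynomial_function p" and f: "f \<in> test_functions_pos" and x: "x \<noteq> 0"
  shows "polar_product p f differentiable (at x)"
proof -
  have "(\<lambda>x. p (x /\<^sub>R norm x) * f (norm x)) differentiable (at x)"
  proof (rule differentiable_mult)
    show "(\<lambda>x. p (x /\<^sub>R norm x)) differentiable (at x)"
      using differentiable_chain_at[OF differentiable_normalize[OF x] differentiable_at_polynomial_function[OF p]]
      by (simp add: o_def)
    show "(\<lambda>x. f (norm x)) differentiable (at x)"
      using differentiable_chain_at[OF differentiable_norm_at[OF x] smooth_differentiable[OF test_functions_posD(1)[OF f]]]
      by (simp add: o_def)
  qed
  then obtain D where "((\<lambda>x. p (x /\<^sub>R norm x) * f (norm x)) has_derivative D) (at x)"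
    by (auto simp: differentiable_def)
  then have "(polar_product p f has_derivative D) (at x)"
    by (rule has_derivative_transform_within_open[where s = "- {0}"])
      (use x in \<open>auto simp: polar_product_def\<close>)
  then show ?thesis by (auto simp: differentiable_def)
qed

text \<open>The partial derivatives are D applied to the unit vectors, and x is the sum of its
  coordinates times these, so linearity removes the coordinates.\<close>

lemma euler_operator_eq_derivative:
  fixes F :: "real^'n \<Rightarrow> complex"
  assumes "(F has_derivative D) (at x)"
  shows "euler_operator F x = D x"
proof -
  interpret D: linear D using assms has_derivative_linear by blast
  have dir: "((\<lambda>s. F (x + s *\<^sub>R v)) has_vector_derivative D v) (at 0)" for v
  proof -
    have "((\<lambda>s. x + s *\<^sub>R v) has_derivative (\<lambda>s. s *\<^sub>R v)) (at 0)"
      by (auto intro!: derivative_eq_intros)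
    then have "((\<lambda>s. F (x + s *\<^sub>R v)) has_derivative (\<lambda>s. D (s *\<^sub>R v))) (at 0)"
      using assms by (intro has_derivative_compose[of "\<lambda>s. x + s *\<^sub>R v" "\<lambda>s. s *\<^sub>R v" 0 UNIV F D]) simp_all
    then show ?thesis by (simp add: has_vector_derivative_def D.scaleR)
  qed
  have "euler_operator F x = (\<Sum>j\<in>UNIV. (x $ j) *\<^sub>R D (axis j 1))"
    unfolding euler_operator_def partial_derivative_def vector_derivative_at[OF dir]
    by (simp add: scaleR_conv_of_real)
  also have "\<dots> = D (\<Sum>j\<in>UNIV. (x $ j) *\<^sub>R axis j 1)"
    by (simp add: D.sum D.scaleR)
  also have "(\<Sum>j\<in>UNIV. (x $ j) *\<^sub>R axis j 1) = x"
    using basis_expansion[of x] by (simp add: scalar_mult_eq_scaleR)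
  finally show ?thesis .
qed

lemma euler_operator_zero: "euler_operator F 0 = 0"
  by (simp add: euler_operator_def)

lemma euler_operator_lincomb:
  fixes F :: "'i \<Rightarrow> real^'n \<Rightarrow> complex"
  assumes "\<And>i. i \<in> I \<Longrightarrow> F i differentiable (at x)"
  shows "euler_operator (\<lambda>x. \<Sum>i\<in>I. c i * F i x) x = (\<Sum>i\<in>I. c i * euler_operator (F i) x)"
proof -
  from assms obtain D where D: "\<And>i. i \<in> I \<Longrightarrow> (F i has_derivative D i) (at x)"
    unfolding differentiable_def by metis
  then have "((\<lambda>x. \<Sum>i\<in>I. c i * F i x) has_derivative (\<lambda>y. \<Sum>i\<in>I. c i * D i y)) (at x)"
    by (intro has_derivative_sum has_derivative_mult_right)
  from euler_operator_eq_derivative[OF this] show ?thesis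
    using euler_operator_eq_derivative[OF D] by simp
qed

text \<open>The Euler derivative is the derivative along the ray through \<open>x\<close>, on which \<open>p\<close> is constant.\<close>

lemma euler_operator_polar_product:
  assumes p: "polynomial_function p" and f: "f \<in> test_functions_pos"
  shows "euler_operator (polar_product p f) x =
    polar_product p (\<lambda>r. of_real r * vector_derivative f (at r)) x"
proof (cases "x = 0")
  case False
  obtain D where D: "(polar_product p f has_derivative D) (at x)"
    using polar_product_differentiable[OF p f False] by (auto simp: differentiable_def)
  have "((\<lambda>s. x + s *\<^sub>R x) has_derivative (\<lambda>s. s *\<^sub>R x)) (at 0)"
    by (auto intro!: derivative_eq_intros)
  then have "((\<lambda>s. polar_product p f (x + s *\<^sub>R x)) has_derivative (\<lambda>s. D (s *\<^sub>R x))) (at 0)"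
    using D by (intro has_derivative_compose[of "\<lambda>s. x + s *\<^sub>R x" "\<lambda>s. s *\<^sub>R x" 0 UNIV _ D]) simp_all
  then have 1: "((\<lambda>s. polar_product p f (x + s *\<^sub>R x)) has_vector_derivative D x) (at 0)"
    using linear_scale[OF has_derivative_linear[OF D]] by (simp add: has_vector_derivative_def)
  have "((\<lambda>s. norm x + s * norm x) has_vector_derivative norm x) (at 0)"
    by (auto intro!: derivative_eq_intros)
  then have "((\<lambda>s. f (norm x + s * norm x)) has_vector_derivative norm x *\<^sub>R vector_derivative f (at (norm x))) (at 0)"
    using vector_diff_chain_at[of "\<lambda>s. norm x + s * norm x" "norm x" 0 f]
      smooth_has_vector_derivative[OF test_functions_posD(1)[OF f]] by (simp add: o_def)
  then have "((\<lambda>s. p (x /\<^sub>R norm x) * f (norm x + s * norm x)) has_vector_derivative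
      p (x /\<^sub>R norm x) * (norm x *\<^sub>R vector_derivative f (at (norm x)))) (at 0)"
    by (rule has_vector_derivative_mult_right)
  \<comment> \<open>For s > -1 the point x + s x = (1 + s) x stays on the open ray through x; this
    neighbourhood of 0 suffices for the derivative.\<close>
  moreover have "p (x /\<^sub>R norm x) * f (norm x + s * norm x) = polar_product p f (x + s *\<^sub>R x)"
    if "s > - 1" for s
  proof -
    have "x + s *\<^sub>R x = (1 + s) *\<^sub>R x" by (simp add: scaleR_left_distrib)
    then show ?thesis
      using that False by (simp only: polar_product_scaleR) (simp add: polar_product_def distrib_right)
  qed
  ultimately have "((\<lambda>s. polar_product p f (x + s *\<^sub>R x)) has_vector_derivative
      p (x /\<^sub>R norm x) * (norm x *\<^sub>R vector_derivative f (at (norm x)))) (at 0)"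
    by - (erule has_vector_derivative_transform_within_open[where S = "{-1<..}"], auto)
  with 1 have "D x = p (x /\<^sub>R norm x) * (norm x *\<^sub>R vector_derivative f (at (norm x)))"
    by (rule vector_derivative_unique_at)
  then show ?thesis
    using euler_operator_eq_derivative[OF D] False by (simp add: polar_product_def scaleR_conv_of_real)
qed (simp add: euler_operator_zero polar_product_def)

lemma euler_domainE:
  assumes "F \<in> euler_domain"
  obtains n c p f where "F = (\<lambda>x. \<Sum>i<n::nat. c i * polar_product (p i) (f i) x)"
    "\<And>i. i < n \<Longrightarrow> polynomial_function (p i)" "\<And>i. i < n \<Longrightarrow> f i \<in> test_functions_pos"
proof -
  obtain n c g where F: "F = (\<lambda>x. \<Sum>i<n::nat. c i * g i x)"
    and "\<forall>i<n. g i \<in> {polar_product p f | p f. polynomial_function p \<and> f \<in> test_functions_pos}"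
    using assms unfolding euler_domain_def complex_span_def by blast
  then have "\<forall>i<n. \<exists>p f. g i = polar_product p f \<and> polynomial_function p \<and> f \<in> test_functions_pos" by blast
  then obtain p f where "\<And>i. i < n \<Longrightarrow> g i = polar_product (p i) (f i) \<and> polynomial_function (p i) \<and> f i \<in> test_functions_pos"
    by metis
  then show ?thesis using that[where n = n and c = c and p = p and f = f] F by auto
qed

lemma euler_domainI:
  assumes "\<And>i. i < n \<Longrightarrow> polynomial_function (p i)" "\<And>i. i < n \<Longrightarrow> f i \<in> test_functions_pos"
  shows "(\<lambda>x. \<Sum>i<n::nat. c i * polar_product (p i) (f i) x) \<in> euler_domain"
  unfolding euler_domain_def complex_span_def using assms
  by (auto intro!: exI[of _ n] exI[of _ c] exI[of _ "\<lambda>i. polar_product (p i) (f i)"])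

lemma complex_span_lincomb:
  assumes "F \<in> complex_span B" "G \<in> complex_span B"
  shows "(\<lambda>x. a * F x + b * G x) \<in> complex_span B"
proof -
  obtain n c g where F: "F = (\<lambda>x. \<Sum>i<n::nat. c i * g i x)" "\<forall>i<n. g i \<in> B"
    using assms(1) by (auto simp: complex_span_def)
  obtain m d h where G: "G = (\<lambda>x. \<Sum>i<m::nat. d i * h i x)" "\<forall>i<m. h i \<in> B"
    using assms(2) by (auto simp: complex_span_def)
  let ?c = "\<lambda>i. if i < n then a * c i else b * d (i - n)"
  let ?g = "\<lambda>i. if i < n then g i else h (i - n)"
  have "(\<Sum>i<n+m. ?c i * ?g i x) = a * F x + b * G x" for x
  proof -
    have "(\<Sum>i<n+m. u i) = (\<Sum>i<n. u i) + (\<Sum>i<m. u (n + i))" for u :: "nat \<Rightarrow> complex"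
      by (induction m) auto
    then show ?thesis by (simp add: F G sum_distrib_left mult.assoc)
  qed
  then have "(\<lambda>x. a * F x + b * G x) = (\<lambda>x. \<Sum>i<n+m. ?c i * ?g i x)" by simp
  moreover have "\<forall>i<n+m. ?g i \<in> B" using F(2) G(2) by auto
  ultimately show ?thesis
    unfolding complex_span_def
    by (intro CollectI exI[of _ "n + m"] exI[of _ ?c] exI[of _ ?g] conjI)
qed

lemma euler_domain_lincomb:
  "F \<in> euler_domain \<Longrightarrow> G \<in> euler_domain \<Longrightarrow> (\<lambda>x. a * F x + b * G x) \<in> euler_domain"
  unfolding euler_domain_def by (rule complex_span_lincomb)

lemma euler_domain_differentiable:
  assumes "F \<in> euler_domain" "x \<noteq> 0"
  shows "F differentiable (at x)"
  using assms(1)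
proof (rule euler_domainE)
  fix n c p f assume "F = (\<lambda>x. \<Sum>i<n::nat. c i * polar_product (p i) (f i) x)"
    "\<And>i. i < n \<Longrightarrow> polynomial_function (p i)" "\<And>i. i < n \<Longrightarrow> f i \<in> test_functions_pos"
  then show ?thesis using assms(2)
    by (auto intro!: differentiable_sum differentiable_mult polar_product_differentiable)
qed

lemma euler_operator_euler_domain_lincomb:
  assumes "F \<in> euler_domain" "G \<in> euler_domain"
  shows "euler_operator (\<lambda>x. a * F x + b * G x) x = a * euler_operator F x + b * euler_operator G x"
proof (cases "x = 0")
  case False
  \<comment> \<open>The two-term combination is written as a sum over \<open>bool\<close>, to which
    the rule for finite sums applies.\<close>
  have "euler_operator (\<lambda>x. \<Sum>i\<in>(UNIV::bool set). (if i then a else b) * (if i then F else G) x) x =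
     (\<Sum>i\<in>(UNIV::bool set). (if i then a else b) * euler_operator (if i then F else G) x)"
    by (rule euler_operator_lincomb) (use assms False euler_domain_differentiable in auto)
  then show ?thesis by (simp add: UNIV_bool add.commute)
qed (simp add: euler_operator_zero)

text \<open>What 2E + \<gamma> does to the radial factor of a polar product; \<gamma> is the real
  value of 2<k> + N - 2.\<close>

definition radial_euler :: "real \<Rightarrow> (real \<Rightarrow> complex) \<Rightarrow> real \<Rightarrow> complex" where
  "radial_euler \<gamma> f r = 2 * of_real r * vector_derivative f (at r) + of_real \<gamma> * f r"

lemma radial_euler_test:
  assumes "f \<in> test_functions_pos"
  shows "radial_euler \<gamma> f \<in> test_functions_pos"
proof -
  have "(\<lambda>r. (2 * of_real r) * vector_derivative f (at r) + of_real \<gamma> * f r) \<in> test_functions_pos"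
    by (intro test_functions_pos_add test_functions_pos_mult test_functions_pos_vector_derivative assms
        smooth_intros)
  then show ?thesis by (simp add: radial_euler_def[abs_def])
qed

text \<open>Polymorphic so that one symbol acts on functions on the whole space and on their radial
  factors on the line.\<close>

definition dilation :: "real \<Rightarrow> real \<Rightarrow> ('a::real_vector \<Rightarrow> complex) \<Rightarrow> 'a \<Rightarrow> complex" where
  "dilation \<gamma> t F x = of_real (exp (\<gamma> * t)) * F (exp (2 * t) *\<^sub>R x)"

lemma dilation_0 [simp]: "dilation \<gamma> 0 F = F"
  by (simp add: dilation_def fun_eq_iff)

lemma dilation_add: "dilation \<gamma> (s + t) F = dilation \<gamma> s (dilation \<gamma> t F)"
  by (simp add: dilation_def fun_eq_iff distrib_left exp_add mult_ac)

lemma dilation_polar_product: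
  "dilation \<gamma> t (polar_product p f) = polar_product p (dilation \<gamma> t f)"
  by (simp add: dilation_def polar_product_scaleR fun_eq_iff)
    (simp add: polar_product_def dilation_def)

lemma dilation_test:
  assumes "f \<in> test_functions_pos"
  shows "dilation \<gamma> t f \<in> test_functions_pos"
  using test_functions_pos_mult[OF test_functions_pos_dilate[OF assms] smooth_intros(2)]
  by (simp add: dilation_def[abs_def])

text \<open>Stated at every t and not only at 0, because the mean value inequality needs the
  derivative along the whole segment.\<close>

lemma dilation_has_vector_derivative:
  assumes f: "f \<in> test_functions_pos"
  shows "((\<lambda>t. dilation \<gamma> t f r) has_vector_derivative dilation \<gamma> t (radial_euler \<gamma> f) r) (at t)"
proof -
  let ?s = "exp (2 * t) * r"
  have "((\<lambda>t. exp (2 * t) * r) has_vector_derivative 2 * ?s) (at t)"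
    unfolding has_real_derivative_iff_has_vector_derivative[symmetric] by (auto intro!: derivative_eq_intros)
  from vector_diff_chain_at[OF this smooth_has_vector_derivative[OF test_functions_posD(1)[OF f]]]
  have 1: "((\<lambda>t. f (exp (2 * t) * r)) has_vector_derivative
      (2 * ?s) *\<^sub>R vector_derivative f (at ?s)) (at t)" by (simp add: o_def)
  have "((\<lambda>t. exp (\<gamma> * t)) has_real_derivative \<gamma> * exp (\<gamma> * t)) (at t)"
    by (auto intro!: derivative_eq_intros)
  from has_vector_derivative_scaleR[OF this 1]
  show ?thesis
    by (simp add: dilation_def radial_euler_def scaleR_conv_of_real algebra_simps)
qed

text \<open>The derivation r d/dr is scale invariant. From this the graph on D inherits its
  invariance under the group.\<close>

lemma dilation_radial_euler:
  assumes f: "f \<in> test_functions_pos"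
  shows "radial_euler \<gamma> (dilation \<gamma> t f) = dilation \<gamma> t (radial_euler \<gamma> f)"
proof
  fix r
  let ?s = "exp (2 * t)"
  have "((\<lambda>r. ?s * r) has_vector_derivative ?s) (at r)"
    unfolding has_real_derivative_iff_has_vector_derivative[symmetric] by (auto intro!: derivative_eq_intros)
  from vector_diff_chain_at[OF this smooth_has_vector_derivative[OF test_functions_posD(1)[OF f]]]
  have "((\<lambda>r. f (?s * r)) has_vector_derivative ?s *\<^sub>R vector_derivative f (at (?s * r))) (at r)"
    by (simp add: o_def)
  from has_vector_derivative_mult_right[OF this, of "of_real (exp (\<gamma> * t))"]
  have "vector_derivative (dilation \<gamma> t f) (at r) =
      of_real (exp (\<gamma> * t)) * (?s *\<^sub>R vector_derivative f (at (?s * r)))"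
    by (intro vector_derivative_at) (simp add: dilation_def[abs_def])
  then show "radial_euler \<gamma> (dilation \<gamma> t f) r = dilation \<gamma> t (radial_euler \<gamma> f) r"
    by (simp add: radial_euler_def dilation_def scaleR_conv_of_real algebra_simps)
qed

section \<open>Bounds, measurability and algebraic stability of the domain\<close>

lemma test_functions_pos_bounded:
  assumes "f \<in> test_functions_pos"
  obtains B where "0 \<le> B" "\<And>r. norm (f r) \<le> B"
proof -
  obtain a b where ab: "0 < a" "a < b" "\<And>r. r \<le> a \<or> b \<le> r \<Longrightarrow> f r = 0"
    using test_functions_posD(2)[OF assms] by blast
  have "compact (f ` {a..b})"
    by (intro compact_continuous_image smooth_continuous test_functions_posD(1)[OF assms]) auto
  then obtain B where B: "\<And>y. y \<in> f ` {a..b} \<Longrightarrow> norm y \<le> B"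
    using compact_imp_bounded bounded_iff by metis
  then have "norm (f r) \<le> \<bar>B\<bar>" for r
    using ab(3)[of r] B[of "f r"] by (cases "r \<in> {a..b}") force+
  then show ?thesis using that[of "\<bar>B\<bar>"] by auto
qed

lemma polynomial_bounded_on_sphere:
  fixes p :: "'a::euclidean_space \<Rightarrow> complex"
  assumes "polynomial_function p"
  obtains B where "0 \<le> B" "\<And>x. x \<noteq> 0 \<Longrightarrow> norm (p (x /\<^sub>R norm x)) \<le> B"
proof -
  have "compact (p ` sphere 0 1)"
    by (intro compact_continuous_image continuous_on_polymonial_function assms compact_sphere)
  then obtain B where B: "\<And>y. y \<in> p ` sphere 0 1 \<Longrightarrow> norm y \<le> B"
    using compact_imp_bounded bounded_iff by metis
  have "norm (p (x /\<^sub>R norm x)) \<le> \<bar>B\<bar>" if "x \<noteq> 0" for x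
    using B[of "p (x /\<^sub>R norm x)"] that by force
  then show ?thesis using that[of "\<bar>B\<bar>"] by auto
qed

lemma polar_product_measurable [measurable]:
  fixes p :: "real^'n \<Rightarrow> complex"
  assumes "polynomial_function p" "f \<in> borel_measurable borel"
  shows "polar_product p f \<in> borel_measurable borel"
proof -
  have [measurable]: "p \<in> borel_measurable borel"
    by (intro borel_measurable_continuous_onI continuous_on_polymonial_function assms(1))
  note [measurable] = assms(2)
  show ?thesis unfolding polar_product_def[abs_def] by measurable
qed

lemma test_functions_pos_measurable [measurable_dest]:
  "f \<in> test_functions_pos \<Longrightarrow> f \<in> borel_measurable borel"
  by (intro borel_measurable_continuous_onI smooth_continuous test_functions_posD(1))

lemma euler_domain_sum:
  "(\<And>i. i \<in> I \<Longrightarrow> F i \<in> euler_domain) \<Longrightarrow> (\<lambda>x. \<Sum>i\<in>I. c i * F i x) \<in> euler_domain"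
proof (induction I rule: infinite_finite_induct)
  case (insert i I)
  then have "(\<lambda>x. c i * F i x + 1 * (\<Sum>i\<in>I. c i * F i x)) \<in> euler_domain"
    by (intro euler_domain_lincomb) auto
  with insert.hyps show ?case by simp
qed (use euler_domainI[of 0] in auto)

lemma polar_product_in_euler_domain:
  assumes "polynomial_function p" "f \<in> test_functions_pos"
  shows "polar_product p f \<in> euler_domain"
  using euler_domainI[of 1 "\<lambda>_. p" "\<lambda>_. f" "\<lambda>_. 1"] assms by simp

text \<open>A linear form satisfies h(x) = |x| h(x / |x|), so its factor |x| moves into the radial
  part. In a product the inner factor already yields a sum of new polar products, hence the
  generalisation over p and f.\<close>

lemma polynomial_times_polar_product:
  assumes "real_polynomial_function q" "polynomial_function p" "f \<in> test_functions_pos"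
  shows "(\<lambda>x. of_real (q x) * polar_product p f x) \<in> euler_domain"
  using assms
proof (induction arbitrary: p f)
  case (linear h)
  have "(\<lambda>x. of_real (h x) * polar_product p f x) =
      polar_product (\<lambda>x. h x *\<^sub>R p x) (\<lambda>r. of_real r * f r)"
    by (auto simp: polar_product_def fun_eq_iff linear_scale[OF bounded_linear.linear[OF linear(1)]]
        scaleR_conv_of_real[where 'a = complex])
  moreover have "polynomial_function (\<lambda>x. h x *\<^sub>R p x)"
    using linear by (intro polynomial_function_mult polynomial_function_bounded_linear[of h])
  moreover have "(\<lambda>r. of_real r * f r) \<in> test_functions_pos"
    by (intro test_functions_pos_mult linear smooth_intros)
  ultimately show ?case by (simp add: polar_product_in_euler_domain)
next
  case (const c)
  then show ?case
    using euler_domain_lincomb[OF polar_product_in_euler_domain polar_product_in_euler_domain, of p f p f "of_real c" 0]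
    by simp
next
  case (add q1 q2)
  then show ?case
    using euler_domain_lincomb[OF add.IH, of p f p f 1 1] by (simp add: distrib_right)
next
  case (mult q1 q2)
  have "(\<lambda>x. of_real (q2 x) * polar_product p f x) \<in> euler_domain" by (rule mult.IH(2)[OF mult.prems])
  then show ?case
  proof (rule euler_domainE)
    fix n c p' f'
    assume eq: "(\<lambda>x. of_real (q2 x) * polar_product p f x) = (\<lambda>x. \<Sum>i<n::nat. c i * polar_product (p' i) (f' i) x)"
      and *: "\<And>i. i < n \<Longrightarrow> polynomial_function (p' i)" "\<And>i. i < n \<Longrightarrow> f' i \<in> test_functions_pos"
    have "(\<lambda>x. of_real (q1 x * q2 x) * polar_product p f x) =
        (\<lambda>x. of_real (q1 x) * (of_real (q2 x) * polar_product p f x))" by (simp add: mult.assoc)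
    also have "\<dots> = (\<lambda>x. \<Sum>i<n. c i * (of_real (q1 x) * polar_product (p' i) (f' i) x))"
      unfolding fun_cong[OF eq] by (simp add: sum_distrib_left mult_ac)
    also have "\<dots> \<in> euler_domain" by (intro euler_domain_sum mult.IH(1) *) auto
    finally show ?thesis .
  qed
qed

text \<open>The angular parts are untouched and only radial factors change; invariance of the domain
  under the operator and commutation with dilations are read off from this form.\<close>

lemma shifted_euler_polar_sum:
  assumes "\<And>i. i < n \<Longrightarrow> polynomial_function (p i)" "\<And>i. i < n \<Longrightarrow> f i \<in> test_functions_pos"
    and F: "F = (\<lambda>x. \<Sum>i<n::nat. c i * polar_product (p i) (f i) x)"
  shows "2 * euler_operator F x + of_real \<gamma> * F x =
    (\<Sum>i<n. c i * polar_product (p i) (radial_euler \<gamma> (f i)) x)"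
proof (cases "x = 0")
  case False
  have "euler_operator F x = (\<Sum>i<n. c i * euler_operator (polar_product (p i) (f i)) x)"
    unfolding F using assms(1,2) False by (intro euler_operator_lincomb polar_product_differentiable) auto
  also have "\<dots> = (\<Sum>i<n. c i * polar_product (p i) (\<lambda>r. of_real r * vector_derivative (f i) (at r)) x)"
    using assms(1,2) by (intro sum.cong) (auto simp: euler_operator_polar_product)
  moreover have "polar_product (p i) (radial_euler \<gamma> (f i)) x =
      2 * polar_product (p i) (\<lambda>r. of_real r * vector_derivative (f i) (at r)) x +
      of_real \<gamma> * polar_product (p i) (f i) x" for i
    by (simp add: polar_product_def radial_euler_def algebra_simps)
  ultimately show ?thesis
    by (simp add: F sum_distrib_left distrib_left sum.distrib mult_ac)
qed (simp add: F euler_operator_zero polar_product_def)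

lemma shifted_euler_euler_domain:
  assumes "F \<in> euler_domain"
  shows "(\<lambda>x. 2 * euler_operator F x + of_real \<gamma> * F x) \<in> euler_domain"
  using assms
proof (rule euler_domainE)
  fix n c p f assume F: "F = (\<lambda>x. \<Sum>i<n::nat. c i * polar_product (p i) (f i) x)"
    and *: "\<And>i. i < n \<Longrightarrow> polynomial_function (p i)" "\<And>i. i < n \<Longrightarrow> f i \<in> test_functions_pos"
  have T: "2 * euler_operator F x + of_real \<gamma> * F x =
      (\<Sum>i<n. c i * polar_product (p i) (radial_euler \<gamma> (f i)) x)" for x
    by (rule shifted_euler_polar_sum[OF _ _ F]) (use * in auto)
  show ?thesis
    unfolding T using * by (intro euler_domainI radial_euler_test)
qed

lemma dilation_euler_domain:
  assumes "F \<in> euler_domain"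
  shows "dilation \<gamma> t F \<in> euler_domain"
    and "2 * euler_operator (dilation \<gamma> t F) x + of_real \<gamma> * dilation \<gamma> t F x =
      dilation \<gamma> t (\<lambda>x. 2 * euler_operator F x + of_real \<gamma> * F x) x"
proof -
  obtain n c p f where F: "F = (\<lambda>x. \<Sum>i<n::nat. c i * polar_product (p i) (f i) x)"
    and *: "\<And>i. i < n \<Longrightarrow> polynomial_function (p i)" "\<And>i. i < n \<Longrightarrow> f i \<in> test_functions_pos"
    using assms by (rule euler_domainE) blast
  have T: "2 * euler_operator F x + of_real \<gamma> * F x =
      (\<Sum>i<n. c i * polar_product (p i) (radial_euler \<gamma> (f i)) x)" for x
    by (rule shifted_euler_polar_sum[OF _ _ F]) (use * in auto)
  have dil: "dilation \<gamma> t (\<lambda>x. \<Sum>i<n. c i * polar_product (p i) (g i) x) =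
      (\<lambda>x. \<Sum>i<n. c i * polar_product (p i) (dilation \<gamma> t (g i)) x)" for g
    by (simp only: dilation_polar_product[symmetric])
      (simp add: dilation_def fun_eq_iff sum_distrib_left mult_ac)
  have test: "\<And>i. i < n \<Longrightarrow> dilation \<gamma> t (f i) \<in> test_functions_pos"
    using * by (simp add: dilation_test)
  show "dilation \<gamma> t F \<in> euler_domain"
    unfolding F dil by (intro euler_domainI *(1) test)
  have "2 * euler_operator (dilation \<gamma> t F) x + of_real \<gamma> * dilation \<gamma> t F x =
      (\<Sum>i<n. c i * polar_product (p i) (radial_euler \<gamma> (dilation \<gamma> t (f i))) x)"
    by (rule shifted_euler_polar_sum[OF *(1) test]) (simp_all add: F dil)
  also have "\<dots> = (\<Sum>i<n. c i * polar_product (p i) (dilation \<gamma> t (radial_euler \<gamma> (f i))) x)"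
    using * by (intro sum.cong) (auto simp: dilation_radial_euler)
  also have "\<dots> = dilation \<gamma> t (\<lambda>x. 2 * euler_operator F x + of_real \<gamma> * F x) x"
    unfolding T dil by simp
  finally show "2 * euler_operator (dilation \<gamma> t F) x + of_real \<gamma> * dilation \<gamma> t F x =
      dilation \<gamma> t (\<lambda>x. 2 * euler_operator F x + of_real \<gamma> * F x) x" .
qed

text \<open>For a > 0 these compact sets stay away from the origin, where the weight may be
  singular.\<close>

definition annulus :: "real \<Rightarrow> real \<Rightarrow> 'a::real_normed_vector set" where
  "annulus a b = {x. a \<le> norm x \<and> norm x \<le> b}"

lemma compact_annulus: "compact (annulus a b :: 'a::euclidean_space set)"
proof -
  have "annulus a b = cball 0 b \<inter> (norm -` {a..} :: 'a set)" by (auto simp: annulus_def)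
  moreover have "closed (norm -` {a..} :: 'a set)"
    by (intro closed_vimage continuous_intros)
  ultimately show ?thesis by (simp add: compact_Int_closed)
qed

lemma annulus_borel [measurable]: "annulus a b \<in> sets (borel :: 'a::euclidean_space measure)"
  by (intro borel_closed compact_imp_closed compact_annulus)

section \<open>Homogeneous measures\<close>

text \<open>Collects what the argument uses of the weighted measure. \<open>scaling\<close> says
  that the measure has homogeneity degree \<gamma>, which for w dx is the degree of w plus N.
  Finiteness is asked on annuli, not on balls, since |x|^-2 may have infinite mass at 0.\<close>

locale homogeneous_measure =
  fixes M :: "(real^'n) measure" and \<gamma> :: real
  assumes sets_M [measurable_cong]: "sets M = sets borel"
    and scaling: "\<And>s. s > 0 \<Longrightarrow> distr M M ((*\<^sub>R) s) = density M (\<lambda>_. ennreal (s powr - \<gamma>))"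
    and annulus_finite: "\<And>a b. 0 < a \<Longrightarrow> emeasure M (annulus a b) < \<infinity>"
    and AE_nonzero: "AE x in M. x \<noteq> 0"
begin

lemma space_M [simp]: "space M = UNIV"
  using sets_eq_imp_space_eq[OF sets_M] by simp

lemma l2_annulus_bounded:
  fixes F :: "real^'n \<Rightarrow> complex"
  assumes "0 < a" and [measurable]: "F \<in> borel_measurable borel"
    and "\<And>x. norm (F x) \<le> B" "\<And>x. x \<notin> annulus a b \<Longrightarrow> F x = 0"
  shows "F \<in> l2_functions M"
proof (rule l2_dominated)
  show "integrable M (\<lambda>x. B\<^sup>2 * indicator (annulus a b) x :: real)"
    using annulus_finite[OF assms(1)] by (intro integrable_mult_right integrable_real_indicator) auto
  have "(norm (F x))\<^sup>2 \<le> B\<^sup>2 * indicator (annulus a b) x" for x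
    using assms(3)[of x] assms(4)[of x] by (auto simp: indicator_def intro!: power_mono)
  then show "AE x in M. (norm (F x))\<^sup>2 \<le> B\<^sup>2 * indicator (annulus a b) x" by simp
qed measurable

lemma polar_product_l2:
  assumes p: "polynomial_function p" and f: "f \<in> test_functions_pos"
  shows "polar_product p f \<in> l2_functions M"
proof -
  obtain a b where ab: "0 < a" "\<And>r. r \<le> a \<or> b \<le> r \<Longrightarrow> f r = 0"
    using test_functions_posD(2)[OF f] by blast
  obtain B where B: "0 \<le> B" "\<And>r. norm (f r) \<le> B" using test_functions_pos_bounded[OF f] by blast
  obtain C where C: "0 \<le> C" "\<And>x. x \<noteq> 0 \<Longrightarrow> norm (p (x /\<^sub>R norm x)) \<le> C"
    using polynomial_bounded_on_sphere[OF p] by blast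
  show ?thesis
  proof (rule l2_annulus_bounded[OF ab(1)])
    show "norm (polar_product p f x) \<le> C * B" for x
      using B C by (auto simp: polar_product_def norm_mult intro!: mult_mono)
    show "polar_product p f x = 0" if "x \<notin> annulus a b" for x
      using ab(2)[of "norm x"] that by (auto simp: polar_product_def annulus_def)
  qed (use p f in measurable)
qed

lemma euler_domain_l2: "F \<in> euler_domain \<Longrightarrow> F \<in> l2_functions M"
  by (erule euler_domainE) (auto intro!: l2_sum l2_scale polar_product_l2)

text \<open>The image of M under scaling is a constant multiple of M, so null sets are preserved.
  This makes dilations well defined on almost everywhere classes.\<close>

lemma dilate_AE:
  assumes "AE x in M. P x" "s > 0"
  shows "AE x in M. P (s *\<^sub>R x)"
proof (rule AE_distrD[where M' = M and f = "(*\<^sub>R) s"])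
  show "AE x in distr M M ((*\<^sub>R) s). P x"
    unfolding scaling[OF assms(2)] using assms(1) by (auto simp: AE_density elim: AE_mp)
qed measurable

lemma dilate_integral:
  fixes g :: "real^'n \<Rightarrow> 'b::{banach, second_countable_topology}"
  assumes g: "integrable M g" and s: "s > 0"
  shows "integrable M (\<lambda>x. g (s *\<^sub>R x))"
    and "(LINT x|M. g (s *\<^sub>R x)) = s powr - \<gamma> *\<^sub>R (LINT x|M. g x)"
proof -
  have [measurable]: "g \<in> borel_measurable M" "g \<in> borel_measurable borel"
    using g by (auto cong: measurable_cong_sets simp: sets_M)
  have "integrable (distr M M ((*\<^sub>R) s)) g"
    unfolding scaling[OF s] using g s by (subst integrable_density) auto
  then show "integrable M (\<lambda>x. g (s *\<^sub>R x))" by (subst (asm) integrable_distr_eq) auto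
  have "(LINT x|M. g (s *\<^sub>R x)) = (LINT x|distr M M ((*\<^sub>R) s). g x)"
    by (subst integral_distr) auto
  also have "\<dots> = s powr - \<gamma> *\<^sub>R (LINT x|M. g x)"
    unfolding scaling[OF s] by (subst integral_density) auto
  finally show "(LINT x|M. g (s *\<^sub>R x)) = s powr - \<gamma> *\<^sub>R (LINT x|M. g x)" .
qed

lemma dilation_l2 [simp]:
  assumes "F \<in> l2_functions M"
  shows "dilation \<gamma> t F \<in> l2_functions M"
proof -
  have [measurable]: "F \<in> borel_measurable M" "F \<in> borel_measurable borel"
    using l2_measurable[OF assms] by (auto cong: measurable_cong_sets simp: sets_M)
  have "(\<lambda>x. F (exp (2 * t) *\<^sub>R x)) \<in> l2_functions M"
    using dilate_integral(1)[OF l2_integrable[OF assms], of "exp (2 * t)"] by (simp add: l2_functions_def)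
  then show ?thesis unfolding dilation_def[abs_def] by simp
qed

lemma dilation_AE:
  assumes "AE x in M. F x = G x"
  shows "AE x in M. dilation \<gamma> t F x = dilation \<gamma> t G x"
  using dilate_AE[OF assms, of "exp (2 * t)"] by (auto simp: dilation_def)

lemma dilation_inner:
  assumes "F \<in> l2_functions M" "G \<in> l2_functions M"
  shows "l2_inner M (dilation \<gamma> t F) (dilation \<gamma> t G) = l2_inner M F G"
proof -
  have "l2_inner M (dilation \<gamma> t F) (dilation \<gamma> t G) =
      of_real (exp (\<gamma> * t)) * of_real (exp (\<gamma> * t)) *
      (LINT x|M. F (exp (2 * t) *\<^sub>R x) * cnj (G (exp (2 * t) *\<^sub>R x)))"
    by (simp add: l2_inner_def dilation_def mult_ac flip: integral_mult_right_zero)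
  also have "\<dots> = (exp (\<gamma> * t) * exp (\<gamma> * t) * exp (2 * t) powr - \<gamma>) *\<^sub>R l2_inner M F G"
    using dilate_integral(2)[OF l2_integrable_mult[OF assms], of "exp (2 * t)"]
    by (simp add: l2_inner_def scaleR_conv_of_real mult_ac)
  \<comment> \<open>The square of the prefactor exactly cancels the Jacobian of x to e^(2t) x; this
    fixes the exponent of the prefactor.\<close>
  also have "exp (\<gamma> * t) * exp (\<gamma> * t) * exp (2 * t) powr - \<gamma> = 1"
    by (simp add: powr_def flip: exp_add)
  finally show ?thesis by simp
qed

lemma dilation_norm:
  assumes "F \<in> l2_functions M"
  shows "l2_norm M (dilation \<gamma> t F) = l2_norm M F"
proof -
  have "complex_of_real ((l2_norm M (dilation \<gamma> t F))\<^sup>2) = of_real ((l2_norm M F)\<^sup>2)"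
    unfolding l2_inner_self[symmetric] by (rule dilation_inner[OF assms assms])
  then have "(l2_norm M (dilation \<gamma> t F))\<^sup>2 = (l2_norm M F)\<^sup>2" using of_real_eq_iff by blast
  then show ?thesis by simp
qed

lemma dilation_unitary: "l2_unitary M (dilation \<gamma> t)"
  unfolding l2_unitary_def
proof (intro conjI ballI allI impI)
  fix G assume "G \<in> l2_functions M"
  then show "\<exists>F\<in>l2_functions M. AE x in M. dilation \<gamma> t F x = G x"
    by (intro bexI[of _ "dilation \<gamma> (- t) G"]) (auto simp flip: dilation_add)
qed (auto simp: dilation_inner dilation_AE, auto simp: dilation_def algebra_simps)

text \<open>Dominated convergence: the radial quotients converge pointwise, are bounded by the mean
  value inequality, and for |h| <= 1 live on one annulus of finite measure.\<close>

lemma polar_product_quotient: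
  assumes p: "polynomial_function p" and f: "f \<in> test_functions_pos"
  shows "((\<lambda>h. l2_norm M (\<lambda>x. (dilation \<gamma> h (polar_product p f) x - polar_product p f x) / of_real h
    - polar_product p (radial_euler \<gamma> f) x)) \<longlongrightarrow> 0) (at 0)"
    (is "((\<lambda>h. l2_norm M (\<lambda>x. ?q h x - ?Q x)) \<longlongrightarrow> 0) (at 0)")
proof -
  obtain a b where ab: "0 < a" "a < b" "\<And>r. r \<le> a \<or> b \<le> r \<Longrightarrow> f r = 0"
    using test_functions_posD(2)[OF f] by blast
  \<comment> \<open>The dilate with parameter h is supported in radii between a e^(-2h) and b
    e^(-2h), so the factor e^2 covers all |h| <= 1.\<close>
  define a' b' where "a' = min a (a / exp 2)" and "b' = max b (b * exp 2)"
  note g = radial_euler_test[OF f, of \<gamma>]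
  obtain a1 b1 where ab1: "0 < a1" "\<And>r. r \<le> a1 \<or> b1 \<le> r \<Longrightarrow> radial_euler \<gamma> f r = 0"
    using test_functions_posD(2)[OF g] by blast
  obtain B where B: "0 \<le> B" "\<And>r. norm (radial_euler \<gamma> f r) \<le> B" using test_functions_pos_bounded[OF g] by blast
  obtain C where C: "0 \<le> C" "\<And>x. x \<noteq> 0 \<Longrightarrow> norm (p (x /\<^sub>R norm x)) \<le> C"
    using polynomial_bounded_on_sphere[OF p] by blast
  \<comment> \<open>First summand: a bound for the quotient, with e^|\<gamma>| bounding the
    prefactor for |h| <= 1. Second summand: a bound for the limit.\<close>
  define A where "A = C * (exp \<bar>\<gamma>\<bar> * B) + C * B"
  define a2 b2 where "a2 = min a' a1" and "b2 = max b' b1"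
  have a2: "a2 > 0" using ab(1) ab1(1) by (auto simp: a2_def a'_def)
  have q_eq: "?q h x = polar_product p (\<lambda>r. (dilation \<gamma> h f r - f r) / of_real h) x" for h x
    unfolding dilation_polar_product by (simp add: polar_product_def diff_divide_distrib right_diff_distrib)
  have deriv: "((\<lambda>h. (dilation \<gamma> h f r - f r) / of_real h) \<longlongrightarrow> radial_euler \<gamma> f r) (at 0)" for r
  proof -
    have "((\<lambda>h. (dilation \<gamma> h f r - dilation \<gamma> 0 f r) /\<^sub>R h) \<longlongrightarrow> radial_euler \<gamma> f r) (at 0)"
      using dilation_has_vector_derivative[OF f, of \<gamma> r 0]
      unfolding has_vector_derivative_at_iff_quotient by simp
    then show ?thesis by (simp add: scaleR_conv_of_real divide_inverse mult.commute)
  qed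
  have bound: "norm ((dilation \<gamma> h f r - f r) / of_real h) \<le> exp \<bar>\<gamma>\<bar> * B" if h: "h \<noteq> 0" "\<bar>h\<bar> \<le> 1" for h r
  proof -
    have "norm (dilation \<gamma> h f r - dilation \<gamma> 0 f r) \<le> (exp \<bar>\<gamma>\<bar> * B) * norm (h - 0)"
    proof (rule differentiable_bound[where S = "cball 0 1"])
      fix s :: real assume s: "s \<in> cball 0 1"
      show "((\<lambda>t. dilation \<gamma> t f r) has_derivative (\<lambda>y. y *\<^sub>R dilation \<gamma> s (radial_euler \<gamma> f) r)) (at s within cball 0 1)"
        using dilation_has_vector_derivative[OF f, of \<gamma> r s]
        by (simp add: has_vector_derivative_def has_derivative_at_withinI)
      have "\<bar>\<gamma>\<bar> * \<bar>s\<bar> \<le> \<bar>\<gamma>\<bar> * 1"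
        using s by (intro mult_left_mono) auto
      then have "\<gamma> * s \<le> \<bar>\<gamma>\<bar>"
        using abs_ge_self[of "\<gamma> * s"] by (simp add: abs_mult)
      then have "norm (dilation \<gamma> s (radial_euler \<gamma> f) r) \<le> exp \<bar>\<gamma>\<bar> * B"
        using B by (auto simp: dilation_def norm_mult intro!: mult_mono)
      then show "onorm (\<lambda>y. y *\<^sub>R dilation \<gamma> s (radial_euler \<gamma> f) r) \<le> exp \<bar>\<gamma>\<bar> * B"
        by (simp add: onorm_scaleR_left onorm_id bounded_linear_ident)
    qed (use h in auto)
    then show ?thesis using h by (simp add: norm_divide divide_le_eq)
  qed
  have support: "dilation \<gamma> h f r = 0 \<and> f r = 0 \<and> radial_euler \<gamma> f r = 0" if "\<bar>h\<bar> \<le> 1" "r < a2 \<or> b2 < r" for h r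
  proof -
    have e: "exp (2 * h) \<le> exp 2" "exp (- 2) \<le> exp (2 * h)" using that(1) by auto
    have "f (exp (2 * h) * r) = 0"
    proof (cases "r \<le> 0")
      case True
      then show ?thesis using ab by (simp add: mult_nonneg_nonpos order_trans[of _ 0 a])
    next
      case False
      show ?thesis
      proof (cases "r < a2")
        case True
        then have "r < a / exp 2" by (simp add: a2_def a'_def)
        then have "exp 2 * r \<le> a" by (simp add: field_simps)
        moreover have "exp (2 * h) * r \<le> exp 2 * r" using e False by (intro mult_right_mono) auto
        ultimately show ?thesis using ab(3) by auto
      next
        case F: False
        then have "b * exp 2 < r" using that(2) by (simp add: b2_def b'_def)
        then have "b \<le> exp (- 2) * r" by (simp add: exp_minus field_simps)
        moreover have "exp (- 2) * r \<le> exp (2 * h) * r" using e False by (intro mult_right_mono) auto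
        ultimately show ?thesis using ab(3) by auto
      qed
    qed
    moreover have "f r = 0" "radial_euler \<gamma> f r = 0"
      using that(2) ab(3)[of r] ab1(2)[of r] by (auto simp: a2_def b2_def a'_def b'_def)
    ultimately show ?thesis by (simp add: dilation_def)
  qed
  have le: "(norm (?q h x - ?Q x))\<^sup>2 \<le> A\<^sup>2 * indicator (annulus a2 b2) x" if h: "h \<noteq> 0" "\<bar>h\<bar> \<le> 1" for h x
  proof (cases "x \<in> annulus a2 b2 \<and> x \<noteq> 0")
    case True
    have "norm (?q h x - ?Q x) \<le> norm (?q h x) + norm (?Q x)" by (rule norm_triangle_ineq4)
    also have "\<dots> \<le> A"
      unfolding A_def q_eq using True B C bound[OF h]
      by (auto simp: polar_product_def norm_mult simp del: times_divide_eq_right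
          intro!: add_mono mult_mono)
    finally show ?thesis using True by (simp add: power_mono)
  next
    case False
    then have "?q h x - ?Q x = 0"
      using support[OF h(2), of "norm x"] by (auto simp: dilation_polar_product polar_product_def annulus_def)
    then show ?thesis by simp
  qed
  have meas: "?q h \<in> borel_measurable M" for h
    using polar_product_l2[OF p f] by (intro l2_measurable) simp
  show ?thesis
    unfolding tendsto_at_iff_sequentially o_def
  proof (intro allI impI)
    fix X :: "nat \<Rightarrow> real" assume X: "\<forall>i. X i \<in> UNIV - {0}" "X \<longlonglongrightarrow> 0"
    have "\<forall>\<^sub>F n in sequentially. \<bar>X n\<bar> < 1" using order_tendstoD(2)[OF tendsto_rabs_zero[OF X(2)]] by simp
    then obtain N where N: "\<And>n. n \<ge> N \<Longrightarrow> \<bar>X n\<bar> < 1" by (auto simp: eventually_sequentially)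
    \<comment> \<open>The tail from N on has |h| <= 1, where the domination holds.\<close>
    have "(\<lambda>n. l2_norm M (\<lambda>x. ?q (X (n + N)) x - ?Q x)) \<longlonglongrightarrow> 0"
    proof (rule l2_dominated_convergence)
      show "integrable M (\<lambda>x. A\<^sup>2 * indicator (annulus a2 b2) x :: real)"
        using annulus_finite[OF a2] by (intro integrable_mult_right integrable_real_indicator) auto
      show "?Q \<in> borel_measurable M"
        by (rule l2_measurable[OF polar_product_l2[OF p g]])
      show "AE x in M. (norm (?q (X (n + N)) x - ?Q x))\<^sup>2 \<le> A\<^sup>2 * indicator (annulus a2 b2) x" for n
        using le[of "X (n + N)"] X(1) N[of "n + N"] by (intro AE_I2) auto
      have "(\<lambda>n. ?q (X (n + N)) x) \<longlonglongrightarrow> ?Q x" for x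
      proof (cases "x = 0")
        case False
        have lim: "filterlim (\<lambda>n. X (n + N)) (at 0) sequentially"
          using X LIMSEQ_ignore_initial_segment[OF X(2), of N] by (auto simp: filterlim_at)
        have "(\<lambda>n. p (x /\<^sub>R norm x) * ((dilation \<gamma> (X (n + N)) f (norm x) - f (norm x)) / of_real (X (n + N))))
            \<longlonglongrightarrow> p (x /\<^sub>R norm x) * radial_euler \<gamma> f (norm x)"
          by (intro tendsto_mult tendsto_const filterlim_compose[OF deriv lim])
        then show ?thesis unfolding q_eq using False by (simp add: polar_product_def)
      qed (simp add: dilation_polar_product polar_product_def)
      then show "AE x in M. (\<lambda>n. ?q (X (n + N)) x) \<longlonglongrightarrow> ?Q x" by simp
    qed (rule meas)
    then show "(\<lambda>n. l2_norm M (\<lambda>x. ?q (X n) x - ?Q x)) \<longlonglongrightarrow> 0"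
      by (rule LIMSEQ_offset)
  qed
qed

lemma euler_domain_subset_generator:
  assumes "F \<in> euler_domain"
  shows "(F, \<lambda>x. 2 * euler_operator F x + of_real \<gamma> * F x) \<in> l2_generator M (dilation \<gamma>)"
proof -
  obtain n c p f where F: "F = (\<lambda>x. \<Sum>i<n::nat. c i * polar_product (p i) (f i) x)"
    and *: "\<And>i. i < n \<Longrightarrow> polynomial_function (p i)" "\<And>i. i < n \<Longrightarrow> f i \<in> test_functions_pos"
    using assms by (rule euler_domainE) blast
  let ?P = "\<lambda>i. polar_product (p i) (f i)" and ?Q = "\<lambda>i. polar_product (p i) (radial_euler \<gamma> (f i))"
  let ?d = "\<lambda>i h x. (dilation \<gamma> h (?P i) x - ?P i x) / of_real h - ?Q i x"
  have PQ: "?P i \<in> l2_functions M" "?Q i \<in> l2_functions M" if "i < n" for i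
    using * that by (auto intro!: polar_product_l2 radial_euler_test)
  have T: "2 * euler_operator F x + of_real \<gamma> * F x =
      (\<Sum>i<n. c i * polar_product (p i) (radial_euler \<gamma> (f i)) x)" for x
    by (rule shifted_euler_polar_sum[OF _ _ F]) (use * in auto)
  have eq: "(\<lambda>x. (dilation \<gamma> h F x - F x) / of_real h - (2 * euler_operator F x + of_real \<gamma> * F x)) =
      (\<lambda>x. \<Sum>i<n. c i * ?d i h x)" for h
  proof
    fix x
    have "dilation \<gamma> h F x = (\<Sum>i<n. c i * dilation \<gamma> h (?P i) x)"
      by (simp add: F dilation_def sum_distrib_left mult_ac)
    moreover have "F x = (\<Sum>i<n. c i * ?P i x)" by (simp add: F)
    ultimately show "(dilation \<gamma> h F x - F x) / of_real h - (2 * euler_operator F x + of_real \<gamma> * F x) =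
        (\<Sum>i<n. c i * ?d i h x)"
      unfolding T
      by (simp add: sum_divide_distrib right_diff_distrib diff_divide_distrib flip: sum_subtractf)
  qed
  have "l2_norm M (\<lambda>x. \<Sum>i<n. c i * ?d i h x) \<le> (\<Sum>i<n. norm (c i) * l2_norm M (?d i h))" for h
    by (rule order_trans[OF l2_norm_sum]) (auto simp: l2_norm_scale PQ)
  moreover have "((\<lambda>h. \<Sum>i<n. norm (c i) * l2_norm M (?d i h)) \<longlongrightarrow> (\<Sum>i<n. norm (c i) * 0)) (at 0)"
    by (intro tendsto_sum tendsto_mult tendsto_const polar_product_quotient *) auto
  ultimately have "((\<lambda>h. l2_norm M (\<lambda>x. \<Sum>i<n. c i * ?d i h x)) \<longlongrightarrow> 0) (at 0)"
    by (rule tendsto_0_bound[OF l2_norm_nonneg]) simp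
  then show ?thesis
    unfolding l2_generator_def using assms shifted_euler_euler_domain[OF assms]
    by (simp add: euler_domain_l2 eq)
qed

text \<open>F moves by h times its quotient, and the quotient stays bounded. It provides strong
  continuity on the domain before the dilations are known to be a unitary group.\<close>

lemma generator_cont_0:
  assumes FG: "(F, G) \<in> l2_generator M (dilation \<gamma>)"
  shows "((\<lambda>h. l2_norm M (\<lambda>x. dilation \<gamma> h F x - F x)) \<longlongrightarrow> 0) (at 0)"
proof -
  note [simp] = l2_generatorD(1,2)[OF FG]
  let ?d = "\<lambda>h. l2_norm M (\<lambda>x. (dilation \<gamma> h F x - F x) / of_real h - G x)"
  have "l2_norm M (\<lambda>x. dilation \<gamma> h F x - F x) \<le> \<bar>h\<bar> * (?d h + l2_norm M G)" for h
  proof (cases "h = 0")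
    case False
    have "l2_norm M (\<lambda>x. dilation \<gamma> h F x - F x) =
        l2_norm M (\<lambda>x. of_real h * (((dilation \<gamma> h F x - F x) / of_real h - G x) + G x))"
      using False by (intro arg_cong[of _ _ "l2_norm M"] ext) simp
    also have "\<dots> \<le> \<bar>h\<bar> * (?d h + l2_norm M G)"
      unfolding l2_norm_scale norm_of_real by (intro mult_left_mono l2_norm_triangle) auto
    finally show ?thesis .
  qed simp
  moreover have "((\<lambda>h. \<bar>h\<bar> * (?d h + l2_norm M G)) \<longlongrightarrow> \<bar>0\<bar> * (0 + l2_norm M G)) (at 0)"
    by (intro tendsto_intros l2_generatorD(3)[OF FG])
  ultimately show ?thesis
    by (rule tendsto_0_bound[OF l2_norm_nonneg]) simp
qed

section \<open>Density of the domain in the L2 space\<close>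

definition approximable :: "((real^'n) \<Rightarrow> complex) \<Rightarrow> bool" where
  "approximable F \<longleftrightarrow> F \<in> l2_functions M \<and> (\<forall>e>0. \<exists>G\<in>euler_domain. l2_norm M (\<lambda>x. F x - G x) < e)"

lemma approximable_domain: "F \<in> euler_domain \<Longrightarrow> approximable F"
  unfolding approximable_def by (auto simp: euler_domain_l2 intro!: bexI[of _ F])

lemma approximable_closed:
  assumes F: "F \<in> l2_functions M"
    and approx: "\<And>e. e > 0 \<Longrightarrow> \<exists>G. approximable G \<and> l2_norm M (\<lambda>x. F x - G x) < e"
  shows "approximable F"
  unfolding approximable_def
proof (intro conjI allI impI)
  fix e :: real assume e: "e > 0"
  obtain G where G: "approximable G" "l2_norm M (\<lambda>x. F x - G x) < e / 2" using approx[of "e / 2"] e by auto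
  then obtain H where H: "H \<in> euler_domain" "l2_norm M (\<lambda>x. G x - H x) < e / 2"
    using e unfolding approximable_def by (meson half_gt_zero)
  have "l2_norm M (\<lambda>x. F x - H x) \<le> l2_norm M (\<lambda>x. F x - G x) + l2_norm M (\<lambda>x. G x - H x)"
    using F G(1) euler_domain_l2[OF H(1)] by (intro l2_norm_triangle_diff) (auto simp: approximable_def)
  with G(2) H show "\<exists>G\<in>euler_domain. l2_norm M (\<lambda>x. F x - G x) < e" by force
qed (rule F)

lemma approximable_limit:
  assumes F: "F \<in> l2_functions M" and f: "\<And>n::nat. approximable (f n)"
    and lim: "(\<lambda>n. l2_norm M (\<lambda>x. f n x - F x)) \<longlonglongrightarrow> 0"
  shows "approximable F"
proof (rule approximable_closed[OF F])
  fix e :: real assume "e > 0"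
  then have "\<forall>\<^sub>F n in sequentially. l2_norm M (\<lambda>x. f n x - F x) < e" by (intro order_tendstoD(2)[OF lim])
  then obtain n where "l2_norm M (\<lambda>x. f n x - F x) < e" by (auto simp: eventually_sequentially)
  then show "\<exists>G. approximable G \<and> l2_norm M (\<lambda>x. F x - G x) < e"
    using f by (auto simp: l2_norm_minus_commute[of M F])
qed

lemma approximable_add_scale:
  assumes F: "approximable F" and G: "approximable G"
  shows "approximable (\<lambda>x. F x + c * G x)"
  unfolding approximable_def
proof (intro conjI allI impI)
  show "(\<lambda>x. F x + c * G x) \<in> l2_functions M" using F G by (simp add: approximable_def)
  fix e :: real assume e: "e > 0"
  \<comment> \<open>Adding 1 to |c| keeps the division sound for c = 0.\<close>
  define d where "d = e / 2 / (norm c + 1)"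
  have c: "norm c + 1 > 0" using norm_ge_zero[of c] by linarith
  then have d: "d > 0" using e by (simp add: d_def)
  obtain F' where F': "F' \<in> euler_domain" "l2_norm M (\<lambda>x. F x - F' x) < e / 2"
    using F e unfolding approximable_def by (meson half_gt_zero)
  obtain G' where G': "G' \<in> euler_domain" "l2_norm M (\<lambda>x. G x - G' x) < d"
    using G d unfolding approximable_def by blast
  have "l2_norm M (\<lambda>x. (F x + c * G x) - (1 * F' x + c * G' x)) =
      l2_norm M (\<lambda>x. (F x - F' x) + c * (G x - G' x))" by (simp add: algebra_simps)
  also have "\<dots> \<le> l2_norm M (\<lambda>x. F x - F' x) + l2_norm M (\<lambda>x. c * (G x - G' x))"
    using F G euler_domain_l2[OF F'(1)] euler_domain_l2[OF G'(1)]
    by (intro l2_norm_triangle) (auto simp: approximable_def)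
  also have "l2_norm M (\<lambda>x. c * (G x - G' x)) = norm c * l2_norm M (\<lambda>x. G x - G' x)" by (rule l2_norm_scale)
  also have "\<dots> \<le> (norm c + 1) * d" using G'(2) d by (intro mult_mono) auto
  also have "(norm c + 1) * d = e / 2" unfolding d_def using c by (intro nonzero_mult_div_cancel_left[THEN trans[OF times_divide_eq_right]]) simp
  finally show "\<exists>H\<in>euler_domain. l2_norm M (\<lambda>x. (F x + c * G x) - H x) < e"
    using F' euler_domain_lincomb[OF F'(1) G'(1), of 1 c] by (intro bexI[of _ "\<lambda>x. 1 * F' x + c * G' x"]) auto
qed

lemma approximable_sum:
  assumes "\<And>i. i \<in> I \<Longrightarrow> approximable (F i)"
  shows "approximable (\<lambda>x. \<Sum>i\<in>I. c i * F i x)"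
  using assms
proof (induction I rule: infinite_finite_induct)
  case (insert i I)
  then have "approximable (\<lambda>x. (\<Sum>i\<in>I. c i * F i x) + c i * F i x)"
    by (intro approximable_add_scale) auto
  with insert.hyps show ?case by (simp add: add.commute)
qed (use approximable_domain[OF euler_domainI[of 0]] in auto)

text \<open>By the Stone--Weierstrass theorem the factor \<open>v\<close> is a uniform limit of polynomials on the
  annulus, and a polynomial times a radial function is a sum of polar products.\<close>

lemma approximable_continuous_times_bump:
  fixes v :: "real^'n \<Rightarrow> real"
  assumes ab: "0 < a" and v: "continuous_on (annulus a b) v"
    and b: "(\<lambda>r. complex_of_real (\<beta> r)) \<in> test_functions_pos" "\<And>r. r < a \<or> b < r \<Longrightarrow> \<beta> r = 0"
    and l2: "(\<lambda>x. complex_of_real (v x * \<beta> (norm x))) \<in> l2_functions M"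
  shows "approximable (\<lambda>x. complex_of_real (v x * \<beta> (norm x)))"
  unfolding approximable_def
proof (intro conjI allI impI l2)
  fix e :: real assume e: "e > 0"
  let ?P = "polar_product (\<lambda>_. 1) (\<lambda>r. complex_of_real (\<beta> r)) :: real^'n \<Rightarrow> complex"
  \<comment> \<open>A uniform error d in the factor q costs at most d ||\<open>?P\<close>|| in norm;
    the extra 1 covers \<open>?P\<close> of norm 0.\<close>
  define d where "d = e / (l2_norm M ?P + 1)"
  have P1: "l2_norm M ?P + 1 > 0" using l2_norm_nonneg[of M ?P] by linarith
  then have d: "d > 0" using e by (simp add: d_def)
  obtain q where q: "polynomial_function q" "\<And>x. x \<in> annulus a b \<Longrightarrow> norm (v x - q x) < d"
    using Stone_Weierstrass_polynomial_function[OF compact_annulus v d] by blast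
  define G where "G = (\<lambda>x. complex_of_real (q x) * ?P x)"
  have G: "G \<in> euler_domain"
    unfolding G_def using q(1) b(1)
    by (intro polynomial_times_polar_product) (auto simp: real_polynomial_function_eq)
  have P: "?P \<in> l2_functions M" using b(1) by (intro polar_product_l2) auto
  have "norm (complex_of_real (v x * \<beta> (norm x)) - G x) \<le> d * norm (?P x)" for x
  proof (cases "x \<in> annulus a b")
    case True
    then have "x \<noteq> 0" using ab by (auto simp: annulus_def)
    then have "complex_of_real (v x * \<beta> (norm x)) - G x = of_real (v x - q x) * ?P x"
      by (simp add: G_def polar_product_def algebra_simps)
    then show ?thesis using q(2)[OF True] by (simp add: norm_mult mult_right_mono del: of_real_diff)
  next
    case False
    then have "\<beta> (norm x) = 0" using b(2) by (auto simp: annulus_def)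
    then show ?thesis by (simp add: G_def polar_product_def)
  qed
  then have "l2_norm M (\<lambda>x. complex_of_real (v x * \<beta> (norm x)) - G x) \<le> d * l2_norm M ?P"
    using P d by (intro l2_norm_mono l2_measurable[OF l2_diff[OF l2 euler_domain_l2[OF G]]]) auto
  also have "\<dots> < d * (l2_norm M ?P + 1)" using d by simp
  also have "\<dots> = e" unfolding d_def using P1 by (intro nonzero_mult_div_cancel_right[THEN trans[OF times_divide_eq_left]]) simp
  finally show "\<exists>G\<in>euler_domain. l2_norm M (\<lambda>x. complex_of_real (v x * \<beta> (norm x)) - G x) < e"
    using G by blast
qed

text \<open>The tents max(0, 1 - n dist(x, K)), multiplied by a radial cutoff equal to 1 on K,
  decrease to the indicator; each has the form of a continuous factor times a bump.\<close>

lemma approximable_compact: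
  assumes K: "compact K" "0 \<notin> K"
  shows "approximable (indicator K)"
proof (cases "K = {}")
  case True
  then show ?thesis using approximable_sum[of "{}"] by (simp add: indicator_def[abs_def])
next
  case False
  have cont_norm: "continuous_on K norm" by (intro continuous_intros)
  obtain x0 where x0: "x0 \<in> K" "\<And>x. x \<in> K \<Longrightarrow> norm x0 \<le> norm x"
    using continuous_attains_inf[OF K(1) False cont_norm] by blast
  obtain x1 where x1: "x1 \<in> K" "\<And>x. x \<in> K \<Longrightarrow> norm x \<le> norm x1"
    using continuous_attains_sup[OF K(1) False cont_norm] by blast
  \<comment> \<open>The margins put K strictly inside the annulus, where the bump is positive and
    hence bounded below on K by some m > 0.\<close>
  define a b where "a = norm x0 / 2" and "b = norm x1 + 1"
  have pos: "0 < norm x0" using x0(1) K(2) by auto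
  have inside: "a < norm x \<and> norm x < b" if "x \<in> K" for x
    using pos x0(2)[OF that] x1(2)[OF that] unfolding a_def b_def by linarith
  have "0 < a" using pos by (simp add: a_def)
  moreover have "a < b" using inside[OF x0(1)] by linarith
  ultimately have ab: "0 < a" "a < b" "\<And>x. x \<in> K \<Longrightarrow> a < norm x \<and> norm x < b"
    using inside by auto
  obtain \<beta> :: "real \<Rightarrow> real" where \<beta>: "(\<lambda>r. complex_of_real (\<beta> r)) \<in> test_functions_pos"
    "\<And>r. a < r \<Longrightarrow> r < b \<Longrightarrow> 0 < \<beta> r" "\<And>r. 0 \<le> \<beta> r" "\<And>r. r \<le> a \<or> b \<le> r \<Longrightarrow> \<beta> r = 0"
    using bump_function_exists[OF ab(1,2)] by blast
  have "continuous_on UNIV (\<lambda>r. Re (complex_of_real (\<beta> r)))"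
    by (intro continuous_on_Re smooth_continuous test_functions_posD(1)[OF \<beta>(1)])
  then have cont\<beta>: "continuous_on UNIV \<beta>" by simp
  have cont\<beta>': "continuous_on S (\<lambda>x. \<beta> (norm x))" for S :: "(real^'n) set"
    by (rule continuous_on_compose2[OF cont\<beta>]) (auto intro!: continuous_intros)
  obtain z where z: "z \<in> K" "\<And>x. x \<in> K \<Longrightarrow> \<beta> (norm z) \<le> \<beta> (norm x)"
    using continuous_attains_inf[OF K(1) False cont\<beta>'] by blast
  define m where "m = \<beta> (norm z)"
  have m: "m > 0" using z(1) ab(3) \<beta>(2) by (auto simp: m_def)
  \<comment> \<open>Dividing by max(m, \<beta>) instead of \<beta> keeps \<open>v\<close> continuous
    where \<beta> vanishes, while on K, where \<beta> >= m, the product with \<beta> is exactly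
    1.\<close>
  define v where "v = (\<lambda>n::nat. \<lambda>x. max 0 (1 - real n * infdist x K) / max m (\<beta> (norm x)))"
  have v_cont: "continuous_on S (v n)" for S n
    unfolding v_def using m by (intro continuous_intros cont\<beta>') (auto simp: max_def)
  have bound: "0 \<le> v n x * \<beta> (norm x) \<and> v n x * \<beta> (norm x) \<le> 1" for n x
  proof -
    have "0 \<le> \<beta> (norm x) / max m (\<beta> (norm x))" "\<beta> (norm x) / max m (\<beta> (norm x)) \<le> 1"
      using \<beta>(3)[of "norm x"] m by (auto simp: max_def)
    moreover have "0 \<le> max 0 (1 - real n * infdist x K)" "max 0 (1 - real n * infdist x K) \<le> 1"
      using infdist_nonneg[of x K] by auto
    moreover have "v n x * \<beta> (norm x) =
        max 0 (1 - real n * infdist x K) * (\<beta> (norm x) / max m (\<beta> (norm x)))" by (simp add: v_def)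
    ultimately show ?thesis by (simp only: mult_nonneg_nonneg mult_le_one simp_thms)
  qed
  have supp: "\<beta> (norm x) = 0" if "x \<notin> annulus a b" for x
    using that \<beta>(4)[of "norm x"] by (auto simp: annulus_def)
  have Kann: "K \<subseteq> annulus a b" using ab(3) by (auto simp: annulus_def less_imp_le)
  have [measurable]: "K \<in> sets borel" using K(1) by (intro borel_closed compact_imp_closed)
  have [measurable]: "(\<lambda>x. complex_of_real (v n x * \<beta> (norm x))) \<in> borel_measurable borel" for n
    by (intro borel_measurable_continuous_onI continuous_intros v_cont cont\<beta>')
  have l2: "(\<lambda>x. complex_of_real (v n x * \<beta> (norm x))) \<in> l2_functions M" for n
    by (rule l2_annulus_bounded[OF ab(1), where B = 1 and b = b])
      (use bound supp in \<open>auto simp: abs_le_iff simp del: of_real_mult\<close>)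
  have ind: "indicator K \<in> l2_functions M"
    by (rule l2_annulus_bounded[OF ab(1), where B = 1 and b = b])
      (use Kann in \<open>auto simp: indicator_def\<close>)
  show ?thesis
  proof (rule approximable_limit[OF ind])
    show "approximable (\<lambda>x. complex_of_real (v n x * \<beta> (norm x)))" for n
      by (rule approximable_continuous_times_bump[OF ab(1) v_cont \<beta>(1) _ l2, where b = b])
        (use \<beta>(4) in auto)
    show "(\<lambda>n. l2_norm M (\<lambda>x. complex_of_real (v n x * \<beta> (norm x)) - indicator K x)) \<longlonglongrightarrow> 0"
    proof (rule l2_dominated_convergence)
      show "integrable M (indicator (annulus a b) :: _ \<Rightarrow> real)"
        using annulus_finite[OF ab(1)] by (intro integrable_real_indicator) auto
      have "(norm (complex_of_real (v n x * \<beta> (norm x)) - indicator K x))\<^sup>2 \<le> indicator (annulus a b) x" for n x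
      proof (cases "x \<in> annulus a b")
        case True
        have "complex_of_real (v n x * \<beta> (norm x)) - indicator K x = of_real (v n x * \<beta> (norm x) - indicator K x)"
          by (simp add: indicator_def)
        moreover have "\<bar>v n x * \<beta> (norm x) - indicator K x\<bar> \<le> 1"
          using bound[of n x] by (auto simp: indicator_def abs_le_iff)
        ultimately show ?thesis using True
          by (simp only: norm_of_real abs_square_le_1 power2_abs) (simp add: abs_square_le_1)
      next
        case False
        then have "x \<notin> K" using Kann by blast
        then show ?thesis using supp[OF False] False by simp
      qed
      then show "AE x in M. (norm (complex_of_real (v n x * \<beta> (norm x)) - indicator K x))\<^sup>2 \<le> indicator (annulus a b) x" for n
        by simp
      have "(\<lambda>n. complex_of_real (v n x * \<beta> (norm x))) \<longlonglongrightarrow> indicator K x" for x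
      proof (cases "x \<in> K")
        case True
        then have "infdist x K = 0" "m \<le> \<beta> (norm x)" using z(2) by (auto simp: m_def)
        then show ?thesis using True m by (simp add: v_def max_def)
      next
        case False
        then have dist: "infdist x K > 0"
          using in_closed_iff_infdist_zero[OF compact_imp_closed[OF K(1)] \<open>K \<noteq> {}\<close>, of x] infdist_nonneg[of x K]
          by linarith
        obtain N :: nat where N: "1 / infdist x K \<le> real N" using real_arch_simple by blast
        have "v n x = 0" if "n \<ge> N" for n
        proof -
          have "1 / infdist x K \<le> real n" using N that by linarith
          then have "1 \<le> real n * infdist x K" using dist by (simp add: field_simps)
          then show ?thesis by (simp add: v_def)
        qed
        then have "\<forall>\<^sub>F n in sequentially. 0 = complex_of_real (v n x * \<beta> (norm x))"
          by (auto simp: eventually_sequentially intro!: exI[of _ N])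
        then show ?thesis using False by (simp add: Lim_transform_eventually[OF tendsto_const])
      qed
      then show "AE x in M. (\<lambda>n. complex_of_real (v n x * \<beta> (norm x))) \<longlonglongrightarrow> indicator K x" by simp
    qed measurable
  qed
qed

lemma approximable_borel:
  assumes a: "0 < a" and B [measurable]: "B \<in> sets borel" and sub: "B \<subseteq> annulus a b"
  shows "approximable (indicator B)"
proof (rule approximable_closed)
  have ind: "indicator C \<in> l2_functions M" if "C \<in> sets borel" "C \<subseteq> annulus a b" for C
    by (rule l2_annulus_bounded[OF a, where B = 1 and b = b])
      (use that in \<open>auto simp: indicator_def\<close>)
  show "indicator B \<in> l2_functions M" by (intro ind B sub)
  fix e :: real assume e: "e > 0"
  \<comment> \<open>Inner regularity is applied to a finite measure, so M is restricted to the
    annulus; both measures agree on its Borel subsets.\<close>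
  define N where "N = density M (indicator (annulus a b))"
  have N: "emeasure N C = emeasure M C" if "C \<in> sets borel" "C \<subseteq> annulus a b" for C
  proof -
    have "emeasure N C = (\<integral>\<^sup>+x. indicator (annulus a b) x * indicator C x \<partial>M)"
      unfolding N_def using that(1) by (intro emeasure_density) (auto simp: sets_M)
    also have "\<dots> = (\<integral>\<^sup>+x. indicator (annulus a b \<inter> C) x \<partial>M)"
      by (simp only: indicator_inter_arith)
    finally show ?thesis using that by (simp add: Int_absorb1 sets_M)
  qed
  have finite: "emeasure M C \<noteq> \<infinity>" if "C \<in> sets borel" "C \<subseteq> annulus a b" for C
    using annulus_finite[OF a, of b] emeasure_mono[OF that(2), of M] by (auto simp: sets_M top_unique)
  have "emeasure N (space N) = emeasure M (annulus a b)"
    unfolding N_def by (subst emeasure_density) auto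
  then have finN: "emeasure N (space N) \<noteq> \<infinity>" using finite[of "annulus a b"] by simp
  have "emeasure N B = (SUP K\<in>{K. K \<subseteq> B \<and> compact K}. emeasure N K)"
    by (rule inner_regular[OF _ finN]) (simp_all add: B N_def sets_M)
  then have SUP: "emeasure M B = (SUP K\<in>{K. K \<subseteq> B \<and> compact K}. emeasure N K)"
    using N[OF B sub] by simp
  \<comment> \<open>The tolerance is e^2 because the squared norm of the difference of indicators is
    the difference of measures. The null case is separate: \<open>ennreal\<close> truncates a
    negative left side to 0, so strictness needs positive measure.\<close>
  have "\<exists>K. K \<subseteq> B \<and> compact K \<and> measure M B - measure M K < e\<^sup>2"
  proof (cases "measure M B = 0")
    case True
    then show ?thesis using e by (intro exI[of _ "{}"]) auto
  next
    case False
    then have "ennreal (measure M B - e\<^sup>2) < ennreal (measure M B)"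
      using e by (intro ennreal_lessI) (auto simp: zero_less_measure_iff)
    also have "\<dots> = emeasure M B" using finite[OF B sub] by (simp add: emeasure_eq_ennreal_measure)
    finally obtain K where K: "K \<subseteq> B" "compact K" "ennreal (measure M B - e\<^sup>2) < emeasure N K"
      unfolding SUP less_SUP_iff by blast
    then have K': "K \<in> sets borel" "K \<subseteq> annulus a b" using sub by (auto intro: borel_closed compact_imp_closed)
    then have "ennreal (measure M B - e\<^sup>2) < ennreal (measure M K)"
      using K(3) N[OF K'] finite[OF K'] by (simp add: emeasure_eq_ennreal_measure)
    then have "measure M B - e\<^sup>2 < measure M K"
      by (metis ennreal_leI not_le)
    then show ?thesis using K by auto
  qed
  then obtain K where K: "K \<subseteq> B" "compact K" "measure M B - measure M K < e\<^sup>2" by blast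
  have K': "K \<in> sets borel" "K \<subseteq> annulus a b" using sub K by (auto intro: borel_closed compact_imp_closed)
  have "(l2_norm M (\<lambda>x. indicator B x - indicator K x))\<^sup>2 = (LINT x|M. indicator (B - K) x)"
    unfolding l2_norm_square using K(1)
    by (intro Bochner_Integration.integral_cong) (auto simp: indicator_def)
  also have "\<dots> = measure M (B - K)" using K' by (simp add: sets_M)
  also have "\<dots> = measure M B - measure M K"
    using K' K(1) finite[OF B sub] by (intro measure_Diff) (auto simp: sets_M)
  finally have "l2_norm M (\<lambda>x. indicator B x - indicator K x) < e"
    using K(3) e by (intro power2_less_imp_less[of _ e]) auto
  moreover have "0 \<notin> K" using K'(2) a by (auto simp: annulus_def)
  ultimately show "\<exists>G. approximable G \<and> l2_norm M (\<lambda>x. indicator B x - G x) < e"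
    using approximable_compact[OF K(2)] by blast
qed

text \<open>Simple functions dominated by 2|F| are cut off to annuli exhausting the complement of
  the origin, a set of full measure; each is then a finite combination of indicators of Borel
  subsets of an annulus.\<close>

lemma approximable_l2:
  assumes F: "F \<in> l2_functions M"
  shows "approximable F"
proof -
  note [measurable] = l2_measurable[OF F]
  obtain s where s: "\<And>i. simple_function M (s i)" "\<And>x. x \<in> space M \<Longrightarrow> (\<lambda>i. s i x) \<longlonglongrightarrow> F x"
    "\<And>i x. x \<in> space M \<Longrightarrow> dist (s i x) 0 \<le> 2 * dist (F x) 0"
    using borel_measurable_implies_sequence_metric[of F M 0] by auto
  define ann :: "nat \<Rightarrow> (real^'n) set" where "ann = (\<lambda>n. annulus (1 / real (Suc n)) (real n))"
  define f where "f = (\<lambda>n x. \<Sum>y\<in>range (s n). y * indicator (s n -` {y} \<inter> ann n) x)"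
  have f_eq: "f n x = s n x * indicator (ann n) x" for n x
  proof -
    have "finite (range (s n))" using simple_functionD(1)[OF s(1)[of n]] by simp
    then have "f n x = (\<Sum>y\<in>{s n x}. y * indicator (s n -` {y} \<inter> ann n) x)"
      unfolding f_def by (intro sum.mono_neutral_right) (auto simp: indicator_def)
    then show ?thesis by (simp add: indicator_def)
  qed
  have meas: "f n \<in> borel_measurable M" for n
  proof -
    have [measurable]: "s n \<in> borel_measurable M" by (rule borel_measurable_simple_function[OF s(1)])
    have "(\<lambda>x. s n x * indicator (ann n) x) \<in> borel_measurable M" unfolding ann_def by measurable
    then show ?thesis by (simp add: f_eq[abs_def])
  qed
  show ?thesis
  proof (rule approximable_limit[OF F])
    fix n
    show "approximable (f n)"
      unfolding f_def
    proof (intro approximable_sum approximable_borel)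
      fix y
      have "s n -` {y} \<inter> space M \<in> sets M" by (rule simple_functionD(2)[OF s(1)])
      then show "s n -` {y} \<inter> ann n \<in> sets borel" by (auto simp: ann_def sets_M)
    qed (auto simp: ann_def)
  next
    show "(\<lambda>n. l2_norm M (\<lambda>x. f n x - F x)) \<longlonglongrightarrow> 0"
    proof (rule l2_dominated_convergence)
      \<comment> \<open>The difference is at most (2 + 1)|F|, whose square gives the 9.\<close>
      show "integrable M (\<lambda>x. 9 * (norm (F x))\<^sup>2)" using F by (simp add: l2_integrable)
      have "(norm (f n x - F x))\<^sup>2 \<le> 9 * (norm (F x))\<^sup>2" for n x
      proof -
        have "norm (f n x) \<le> 2 * norm (F x)" using s(3)[of x n] by (simp add: f_eq indicator_def)
        then have "norm (f n x - F x) \<le> 3 * norm (F x)" using norm_triangle_ineq4[of "f n x" "F x"] by linarith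
        then have "(norm (f n x - F x))\<^sup>2 \<le> (3 * norm (F x))\<^sup>2" by (intro power_mono) auto
        then show ?thesis by (simp add: power_mult_distrib)
      qed
      then show "AE x in M. (norm (f n x - F x))\<^sup>2 \<le> 9 * (norm (F x))\<^sup>2" for n by simp
      have "(\<lambda>n. f n x) \<longlonglongrightarrow> F x" if x: "x \<noteq> 0" for x
      proof (rule Lim_transform_eventually)
        show "(\<lambda>n. s n x) \<longlonglongrightarrow> F x" using s(2) by simp
        obtain N1 :: nat where N1: "norm x \<le> real N1" using real_arch_simple by blast
        obtain N2 :: nat where N2: "1 / norm x \<le> real N2" using real_arch_simple by blast
        have "x \<in> ann n" if "n \<ge> max N1 N2" for n
        proof -
          have "1 / norm x \<le> real (Suc n)" "norm x \<le> real n" using that N1 N2 by auto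
          then show ?thesis using x by (simp add: ann_def annulus_def field_simps)
        qed
        then show "\<forall>\<^sub>F n in sequentially. s n x = f n x"
          by (auto simp: eventually_sequentially f_eq intro!: exI[of _ "max N1 N2"])
      qed
      with AE_nonzero show "AE x in M. (\<lambda>n. f n x) \<longlonglongrightarrow> F x" by (auto elim: AE_mp)
    qed (use meas in auto)
  qed
qed

text \<open>Since dilations are isometric, replacing F by a nearby element of the domain costs the
  same small amount for every h.\<close>

lemma dilation_cont_0:
  assumes F: "F \<in> l2_functions M"
  shows "((\<lambda>h. l2_norm M (\<lambda>x. dilation \<gamma> h F x - F x)) \<longlongrightarrow> 0) (at 0)"
proof (rule tendstoI)
  fix e :: real assume e: "e > 0"
  obtain f where f: "f \<in> euler_domain" "l2_norm M (\<lambda>x. F x - f x) < e / 3"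
    using approximable_l2[OF F] e unfolding approximable_def by (meson divide_pos_pos zero_less_numeral)
  have fl [simp]: "f \<in> l2_functions M" using f(1) by (rule euler_domain_l2)
  have le: "l2_norm M (\<lambda>x. dilation \<gamma> h F x - F x) < 2 * (e / 3) + l2_norm M (\<lambda>x. dilation \<gamma> h f x - f x)" for h
  proof -
    have "l2_norm M (\<lambda>x. dilation \<gamma> h F x - dilation \<gamma> h f x) = l2_norm M (dilation \<gamma> h (\<lambda>x. F x - f x))"
      by (simp add: dilation_def[abs_def] right_diff_distrib)
    also have "\<dots> = l2_norm M (\<lambda>x. F x - f x)" using F by (intro dilation_norm) simp
    finally have "l2_norm M (\<lambda>x. dilation \<gamma> h F x - dilation \<gamma> h f x) < e / 3" using f(2) by simp
    moreover have "l2_norm M (\<lambda>x. dilation \<gamma> h F x - F x) \<le>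
        l2_norm M (\<lambda>x. dilation \<gamma> h F x - dilation \<gamma> h f x) + l2_norm M (\<lambda>x. dilation \<gamma> h f x - F x)"
      using F by (intro l2_norm_triangle_diff) auto
    moreover have "l2_norm M (\<lambda>x. dilation \<gamma> h f x - F x) \<le>
        l2_norm M (\<lambda>x. dilation \<gamma> h f x - f x) + l2_norm M (\<lambda>x. f x - F x)"
      using F by (intro l2_norm_triangle_diff) auto
    ultimately show ?thesis using f(2) by (simp add: l2_norm_minus_commute[of M f])
  qed
  have "\<forall>\<^sub>F h in at 0. l2_norm M (\<lambda>x. dilation \<gamma> h f x - f x) < e / 3"
    using e by (intro order_tendstoD(2)[OF generator_cont_0[OF euler_domain_subset_generator[OF f(1)]]]) simp
  then show "\<forall>\<^sub>F h in at 0. dist (l2_norm M (\<lambda>x. dilation \<gamma> h F x - F x)) 0 < e"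
  proof (rule eventually_mono)
    fix h assume "l2_norm M (\<lambda>x. dilation \<gamma> h f x - f x) < e / 3"
    with le[of h] show "dist (l2_norm M (\<lambda>x. dilation \<gamma> h F x - F x)) 0 < e" by simp
  qed
qed

text \<open>Continuity at t reduces to continuity at 0 by isometry; the group identities hold
  pointwise.\<close>

lemma dilation_unitary_group: "l2_unitary_group M (dilation \<gamma>)"
  unfolding l2_unitary_group_def
proof (intro conjI allI ballI)
  fix F t assume F: "F \<in> l2_functions M"
  have "l2_norm M (\<lambda>x. dilation \<gamma> (t + h) F x - dilation \<gamma> t F x) = l2_norm M (\<lambda>x. dilation \<gamma> h F x - F x)" for h
  proof -
    have "l2_norm M (\<lambda>x. dilation \<gamma> (t + h) F x - dilation \<gamma> t F x) =
        l2_norm M (dilation \<gamma> t (\<lambda>x. dilation \<gamma> h F x - F x))"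
      unfolding dilation_add by (simp add: dilation_def[of \<gamma> t, abs_def] right_diff_distrib)
    also have "\<dots> = l2_norm M (\<lambda>x. dilation \<gamma> h F x - F x)" using F by (intro dilation_norm) simp
    finally show ?thesis .
  qed
  then show "((\<lambda>s. l2_norm M (\<lambda>x. dilation \<gamma> s F x - dilation \<gamma> t F x)) \<longlongrightarrow> 0) (at t)"
    using dilation_cont_0[OF F] by (subst LIM_offset_zero_iff[where a = t]) simp_all
qed (auto simp: dilation_unitary dilation_add)

end

section \<open>Generation of the dilations and the exponential\<close>

context homogeneous_measure
begin

text \<open>The graph contains all representatives, so each hypothesis of the core criterion is
  checked on a function F0 of the domain and carried over along almost everywhere equality.\<close>

lemma euler_graph_generates_dilation:
  defines "A \<equiv> l2_operator M euler_domain (\<lambda>F x. 2 * euler_operator F x + of_real \<gamma> * F x)"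
  shows "l2_essentially_skew_adjoint M A"
    and "l2_generates M (l2_closure M A) (dilation \<gamma>)"
proof -
  let ?T = "\<lambda>F x. 2 * euler_operator F x + of_real \<gamma> * F x :: complex"
  note group = dilation_unitary_group
  have A_iff: "(F, G) \<in> A \<longleftrightarrow> F \<in> l2_functions M \<and> G \<in> l2_functions M \<and>
      (\<exists>F0\<in>euler_domain. (AE x in M. F x = F0 x) \<and> (AE x in M. G x = ?T F0 x))" for F G
    by (simp add: A_def l2_operator_def)
  have sub: "A \<subseteq> l2_generator M (dilation \<gamma>)"
  proof clarify
    fix F G assume "(F, G) \<in> A"
    then obtain F0 where [simp]: "F \<in> l2_functions M" "G \<in> l2_functions M"
      and F0: "F0 \<in> euler_domain" "AE x in M. F x = F0 x" "AE x in M. G x = ?T F0 x"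
      unfolding A_iff by blast
    note gen = euler_domain_subset_generator[OF F0(1)]
    note [simp] = l2_generatorD(1,2)[OF gen]
    have "l2_norm M (\<lambda>x. (dilation \<gamma> h F x - F x) / of_real h - G x) =
        l2_norm M (\<lambda>x. (dilation \<gamma> h F0 x - F0 x) / of_real h - ?T F0 x)" for h
    proof (rule l2_norm_cong_AE)
      show "AE x in M. (dilation \<gamma> h F x - F x) / of_real h - G x =
          (dilation \<gamma> h F0 x - F0 x) / of_real h - ?T F0 x"
        using F0(2,3) dilation_AE[OF F0(2), of h] by eventually_elim simp
    qed (intro l2_diff l2_divide; simp)+
    then show "(F, G) \<in> l2_generator M (dilation \<gamma>)"
      using l2_generatorD(3)[OF gen] by (simp add: l2_generator_def)
  qed
  have dense: "l2_densely_defined M A"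
    unfolding l2_densely_defined_def
  proof (intro ballI allI impI)
    fix F and e :: real assume "F \<in> l2_functions M" "e > 0"
    then obtain G where G: "G \<in> euler_domain" "l2_norm M (\<lambda>x. F x - G x) < e"
      using approximable_l2 unfolding approximable_def by blast
    then have "(G, ?T G) \<in> A"
      unfolding A_iff
      using euler_domain_l2 shifted_euler_euler_domain[OF G(1), of \<gamma>] by auto
    with G(2) show "\<exists>G\<in>Domain A. l2_norm M (\<lambda>x. F x - G x) < e" by blast
  qed
  have lin: "(\<lambda>x. a * F x + b * G x, \<lambda>x. a * F' x + b * G' x) \<in> A"
    if FG: "(F, F') \<in> A" "(G, G') \<in> A" for F F' G G' a b
  proof -
    obtain F0 where F0: "F0 \<in> euler_domain" "AE x in M. F x = F0 x" "AE x in M. F' x = ?T F0 x"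
      using FG(1) unfolding A_iff by blast
    obtain G0 where G0: "G0 \<in> euler_domain" "AE x in M. G x = G0 x" "AE x in M. G' x = ?T G0 x"
      using FG(2) unfolding A_iff by blast
    have "?T (\<lambda>x. a * F0 x + b * G0 x) x = a * ?T F0 x + b * ?T G0 x" for x
      by (simp add: euler_operator_euler_domain_lincomb[OF F0(1) G0(1)] algebra_simps)
    moreover have "AE x in M. a * F x + b * G x = a * F0 x + b * G0 x"
      using F0(2) G0(2) by eventually_elim simp
    moreover have "AE x in M. a * F' x + b * G' x = a * ?T F0 x + b * ?T G0 x"
      using F0(3) G0(3) by eventually_elim simp
    ultimately show ?thesis
      using FG euler_domain_lincomb[OF F0(1) G0(1), of a b] unfolding A_iff
      by (intro conjI bexI[of _ "\<lambda>x. a * F0 x + b * G0 x"]) auto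
  qed
  have inv: "(dilation \<gamma> t F, dilation \<gamma> t F') \<in> A" if FF: "(F, F') \<in> A" for F F' t
  proof -
    obtain F0 where F0: "F0 \<in> euler_domain" "AE x in M. F x = F0 x" "AE x in M. F' x = ?T F0 x"
      using FF unfolding A_iff by blast
    show ?thesis
      using FF dilation_euler_domain[OF F0(1), where t = t and \<gamma> = \<gamma>] dilation_l2
        dilation_AE[OF F0(2), of t] dilation_AE[OF F0(3), of t]
      unfolding A_iff by (intro conjI bexI[of _ "dilation \<gamma> t F0"]) auto
  qed
  show "l2_essentially_skew_adjoint M A"
    using group sub dense lin inv by (rule essentially_skew_adjoint)
  show "l2_generates M (l2_closure M A) (dilation \<gamma>)"
  proof -
    have "l2_closure M A = l2_generator M (dilation \<gamma>)"
      using group sub dense lin inv by (rule closure_eq_generator)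
    then show ?thesis using group by (simp add: l2_generates_def)
  qed
qed

end

text \<open>The group V witnesses that the choice is not vacuous; skew-adjointness includes the
  dense domain that uniqueness rests on.\<close>

lemma l2_exp_unique:
  assumes A: "l2_skew_adjoint M A" and V: "l2_generates M A V"
  shows "l2_generates M A (l2_exp M A)"
    and "F \<in> l2_functions M \<Longrightarrow> AE x in M. l2_exp M A t F x = V t F x"
proof -
  show U: "l2_generates M A (l2_exp M A)"
    unfolding l2_exp_def using someI[of "l2_generates M A"] V by blast
  show "AE x in M. l2_exp M A t F x = V t F x" if "F \<in> l2_functions M"
    using U V A that
    by (intro unitary_group_unique) (auto simp: l2_generates_def l2_skew_adjoint_def)
qed

section \<open>The Dunkl weight\<close>

lemma dunkl_weight_nonneg: "0 \<le> dunkl_weight R k x"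
  by (simp add: dunkl_weight_def prod_nonneg)

lemma dunkl_weight_measurable [measurable]: "dunkl_weight R k \<in> borel_measurable borel"
  unfolding dunkl_weight_def[abs_def] by measurable

text \<open>Each root contributes its multiplicity, 2<k> in all, and |x|^-2 contributes the
  -2.\<close>

lemma dunkl_weight_homogeneous:
  assumes s: "s > 0"
  shows "dunkl_weight R k (s *\<^sub>R x) = s powr ((\<Sum>a\<in>R. Re (k a)) - 2) * dunkl_weight R k x"
proof -
  have "(\<Prod>a\<in>R. \<bar>a \<bullet> (s *\<^sub>R x)\<bar> powr Re (k a)) = (\<Prod>a\<in>R. s powr Re (k a) * \<bar>a \<bullet> x\<bar> powr Re (k a))"
    using s by (intro prod.cong) (auto simp: abs_mult powr_mult)
  also have "\<dots> = s powr (\<Sum>a\<in>R. Re (k a)) * (\<Prod>a\<in>R. \<bar>a \<bullet> x\<bar> powr Re (k a))"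
    using s by (cases "finite R") (simp_all add: prod.distrib powr_sum)
  finally show ?thesis
    using s by (simp add: dunkl_weight_def powr_diff power_mult_distrib powr_numeral)
qed

text \<open>Nonnegative exponents make the powers monotone, so the outer radius bounds the product;
  the inner radius bounds |x|^-2.\<close>

lemma dunkl_weight_bounded_on_annulus:
  assumes k: "nonneg_multiplicity R k" and a: "0 < a" and x: "x \<in> annulus a b"
  shows "dunkl_weight R k x \<le> (1 / a\<^sup>2) * (\<Prod>r\<in>R. (norm r * b) powr Re (k r))"
proof -
  have *: "a \<le> norm x" "norm x \<le> b" using x by (auto simp: annulus_def)
  have "\<bar>r \<bullet> x\<bar> powr Re (k r) \<le> (norm r * b) powr Re (k r)" if "r \<in> R" for r
  proof (rule powr_mono2)
    show "0 \<le> Re (k r)"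
      using k that by (auto simp: nonneg_multiplicity_def complex_nonneg_Reals_iff)
    have "\<bar>r \<bullet> x\<bar> \<le> norm r * norm x" by (rule Cauchy_Schwarz_ineq2)
    also have "\<dots> \<le> norm r * b" using * by (intro mult_left_mono) auto
    finally show "\<bar>r \<bullet> x\<bar> \<le> norm r * b" .
  qed auto
  moreover have "1 / (norm x)\<^sup>2 \<le> 1 / a\<^sup>2"
    using * a by (intro divide_left_mono power_mono mult_pos_pos zero_less_power) auto
  ultimately show ?thesis
    unfolding dunkl_weight_def using a by (intro mult_mono prod_mono prod_nonneg) auto
qed

lemma sets_dunkl_measure [measurable_cong]: "sets (dunkl_measure R k) = sets borel"
  by (simp add: dunkl_measure_def)

lemma dunkl_measure_annulus_finite:
  fixes R :: "(real^'n) set"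
  assumes "nonneg_multiplicity R k" "0 < a"
  shows "emeasure (dunkl_measure R k) (annulus a b) < \<infinity>"
proof -
  define C where "C = (1 / a\<^sup>2) * (\<Prod>r\<in>R. (norm r * b) powr Re (k r))"
  have "emeasure (dunkl_measure R k) (annulus a b) =
      (\<integral>\<^sup>+x. ennreal (dunkl_weight R k x) * indicator (annulus a b) x \<partial>lborel)"
    unfolding dunkl_measure_def by (intro emeasure_density) auto
  also have "\<dots> \<le> (\<integral>\<^sup>+x. ennreal C * indicator (annulus a b :: (real^'n) set) x \<partial>lborel)"
    using dunkl_weight_bounded_on_annulus[OF assms]
    by (intro nn_integral_mono) (auto simp: indicator_def C_def intro!: ennreal_leI)
  also have "\<dots> = ennreal C * emeasure lborel (annulus a b :: (real^'n) set)"
    by (intro nn_integral_cmult_indicator) auto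
  also have "\<dots> < \<infinity>"
    using emeasure_compact_finite[OF compact_annulus[where 'a = "real^'n"]]
    by (simp add: ennreal_mult_less_top)
  finally show ?thesis .
qed

lemma dunkl_measure_AE_nonzero: "AE x in dunkl_measure R k. x \<noteq> 0"
  unfolding dunkl_measure_def using AE_lborel_singleton[of 0]
  by (subst AE_density) auto

text \<open>The exponent adds the degree of the weight to N, the latter from the substitution y = s
  x in Lebesgue measure.\<close>

lemma dunkl_measure_scaling:
  fixes R :: "(real^'n) set"
  assumes s: "s > 0"
  shows "distr (dunkl_measure R k) (dunkl_measure R k) ((*\<^sub>R) s) =
    density (dunkl_measure R k) (\<lambda>_. ennreal (s powr - ((\<Sum>a\<in>R. Re (k a)) + CARD('n) - 2)))"
    (is "_ = density _ (\<lambda>_. ennreal (s powr - ?\<gamma>))")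
proof (rule measure_eqI)
  fix B assume "B \<in> sets (distr (dunkl_measure R k) (dunkl_measure R k) ((*\<^sub>R) s))"
  then have B [measurable]: "B \<in> sets borel" by (simp add: sets_dunkl_measure)
  let ?w = "\<lambda>x. ennreal (dunkl_weight R k x)" and ?\<delta> = "(\<Sum>a\<in>R. Re (k a)) - 2"
  \<comment> \<open>The weight is rewritten at s x so that the whole integrand becomes a function of
    s x, ready for the substitution.\<close>
  have w: "?w x = ennreal (s powr - ?\<delta>) * ?w (s *\<^sub>R x)" for x
  proof -
    have "dunkl_weight R k x = s powr - ?\<delta> * dunkl_weight R k (s *\<^sub>R x)"
      using s by (simp add: dunkl_weight_homogeneous mult.assoc[symmetric] flip: powr_add)
    then show ?thesis by (simp add: ennreal_mult dunkl_weight_nonneg)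
  qed
  have "emeasure (distr (dunkl_measure R k) (dunkl_measure R k) ((*\<^sub>R) s)) B =
      (\<integral>\<^sup>+x. ?w x * indicator B (s *\<^sub>R x) \<partial>lborel)"
  proof -
    have [measurable]: "(*\<^sub>R) s -` B \<in> sets borel"
      by (rule measurable_sets_borel[OF _ B]) measurable
    have "emeasure (distr (dunkl_measure R k) (dunkl_measure R k) ((*\<^sub>R) s)) B =
        emeasure (dunkl_measure R k) ((*\<^sub>R) s -` B)"
      by (subst emeasure_distr) (auto simp: sets_dunkl_measure sets_eq_imp_space_eq[OF sets_dunkl_measure])
    also have "\<dots> = (\<integral>\<^sup>+x. ?w x * indicator ((*\<^sub>R) s -` B) x \<partial>lborel)"
      unfolding dunkl_measure_def by (intro emeasure_density) auto
    finally show ?thesis by (simp add: indicator_def)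
  qed
  also have "\<dots> = (\<integral>\<^sup>+x. ennreal (s powr - ?\<delta>) * (?w (s *\<^sub>R x) * indicator B (s *\<^sub>R x)) \<partial>lborel)"
    by (subst w) (simp add: mult.assoc)
  also have "\<dots> = ennreal (s powr - ?\<delta>) * (\<integral>\<^sup>+x. ?w (s *\<^sub>R x) * indicator B (s *\<^sub>R x) \<partial>lborel)"
    by (intro nn_integral_cmult) auto
  also have "(\<integral>\<^sup>+x. ?w (s *\<^sub>R x) * indicator B (s *\<^sub>R x) \<partial>lborel) =
      ennreal (s powr - CARD('n)) * (\<integral>\<^sup>+x. ?w x * indicator B x \<partial>lborel)"
  proof -
    have "(\<integral>\<^sup>+x. ?w x * indicator B x \<partial>lborel) =
        (\<integral>\<^sup>+x. ?w x * indicator B x \<partial>density (distr lborel borel (\<lambda>x. 0 + s *\<^sub>R x)) (\<lambda>_. ennreal (\<bar>s\<bar> ^ DIM(real^'n))))"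
      using s by (subst lborel_affine[of s 0]) auto
    also have "\<dots> = ennreal (s ^ CARD('n)) * (\<integral>\<^sup>+x. ?w (s *\<^sub>R x) * indicator B (s *\<^sub>R x) \<partial>lborel)"
      using s by (simp add: nn_integral_density nn_integral_distr nn_integral_cmult)
    finally have "ennreal (s powr - CARD('n)) * (\<integral>\<^sup>+x. ?w x * indicator B x \<partial>lborel) =
        ennreal (s powr - CARD('n) * s ^ CARD('n)) * (\<integral>\<^sup>+x. ?w (s *\<^sub>R x) * indicator B (s *\<^sub>R x) \<partial>lborel)"
      using s by (simp add: ennreal_mult mult.assoc)
    also have "s powr - CARD('n) * s ^ CARD('n) = 1" using s by (simp add: powr_minus powr_realpow)
    finally show ?thesis by simp
  qed
  also have "ennreal (s powr - ?\<delta>) * (ennreal (s powr - CARD('n)) * (\<integral>\<^sup>+x. ?w x * indicator B x \<partial>lborel)) =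
      ennreal (s powr - ?\<gamma>) * (\<integral>\<^sup>+x. ?w x * indicator B x \<partial>lborel)"
  proof -
    have "s powr - ?\<delta> * s powr - CARD('n) = s powr - ?\<gamma>"
      unfolding powr_add[symmetric] by (simp add: algebra_simps)
    then show ?thesis by (simp add: mult.assoc[symmetric] flip: ennreal_mult)
  qed
  also have "(\<integral>\<^sup>+x. ?w x * indicator B x \<partial>lborel) = emeasure (dunkl_measure R k) B"
    unfolding dunkl_measure_def by (rule emeasure_density[symmetric]) auto
  also have "ennreal (s powr - ?\<gamma>) * emeasure (dunkl_measure R k) B =
      emeasure (density (dunkl_measure R k) (\<lambda>_. ennreal (s powr - ?\<gamma>))) B"
    by (subst emeasure_density) (auto simp: sets_dunkl_measure nn_integral_cmult)
  finally show "emeasure (distr (dunkl_measure R k) (dunkl_measure R k) ((*\<^sub>R) s)) B =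
      emeasure (density (dunkl_measure R k) (\<lambda>_. ennreal (s powr - ?\<gamma>))) B" .
qed simp

text \<open>The first two conjuncts certify that the choice behind \<open>l2_exp\<close> really
  yields the unitary group of the skew-adjoint closure, so that the formula speaks of the intended
  exponential.\<close>

theorem theorem3p8:
  fixes R :: "(real^'n) set" and k :: "real^'n \<Rightarrow> complex"
  assumes "reduced_root_system R"
    and "multiplicity_function R k"
    and "nonneg_multiplicity R k"
  shows "l2_essentially_skew_adjoint (dunkl_measure R k) (shifted_euler_graph R k) \<and>
    l2_generates (dunkl_measure R k) (shifted_euler_closure R k)
      (l2_exp (dunkl_measure R k) (shifted_euler_closure R k)) \<and>
    (\<forall>t. \<forall>F \<in> l2_functions (dunkl_measure R k).
      AE x in dunkl_measure R k.
        l2_exp (dunkl_measure R k) (shifted_euler_closure R k) t F x =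
        exp ((2 * multiplicity_index R k + of_nat CARD('n) - 2) * of_real t)
          * F (exp (2 * t) *\<^sub>R x))"
proof -
  let ?M = "dunkl_measure R k"
  define \<gamma> where "\<gamma> = (\<Sum>a\<in>R. Re (k a)) + CARD('n) - 2"
  \<comment> \<open>The multiplicities are complex by type but real by nonnegativity, so the shift
    in the operator is the real number \<gamma>.\<close>
  have "(\<Sum>a\<in>R. k a) = (\<Sum>a\<in>R. of_real (Re (k a)))"
    using assms(3) by (intro sum.cong)
      (auto simp: nonneg_multiplicity_def complex_nonneg_Reals_iff complex_eq_iff)
  then have \<gamma>: "2 * multiplicity_index R k + of_nat CARD('n) - 2 = of_real \<gamma>"
    by (simp add: \<gamma>_def multiplicity_index_def)
  have graph: "shifted_euler_graph R k =
      l2_operator ?M euler_domain (\<lambda>F x. 2 * euler_operator F x + of_real \<gamma> * F x)"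
    by (simp add: shifted_euler_graph_def shifted_euler_def[abs_def] \<gamma>)
  interpret homogeneous_measure ?M \<gamma>
    using dunkl_measure_scaling[of _ R k] dunkl_measure_annulus_finite[OF assms(3)]
    by unfold_locales (simp_all add: sets_dunkl_measure dunkl_measure_AE_nonzero \<gamma>_def)
  have skew: "l2_essentially_skew_adjoint ?M (shifted_euler_graph R k)"
    unfolding graph by (rule euler_graph_generates_dilation(1))
  have gen: "l2_generates ?M (shifted_euler_closure R k) (dilation \<gamma>)"
    unfolding shifted_euler_closure_def graph by (rule euler_graph_generates_dilation(2))
  have "l2_skew_adjoint ?M (shifted_euler_closure R k)"
    using skew by (simp add: l2_essentially_skew_adjoint_def shifted_euler_closure_def)
  note exp = l2_exp_unique[OF this gen]
  have "dilation \<gamma> t F x = exp ((2 * multiplicity_index R k + of_nat CARD('n) - 2) * of_real t)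
      * F (exp (2 * t) *\<^sub>R x)" for t F and x :: "real^'n"
    unfolding \<gamma> dilation_def by (simp flip: exp_of_real)
  with skew exp show ?thesis by auto
qed

end
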